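(* Let $G$ be a simple, connected, nonbipartite, 2-connected graph of order $n\geq 3$. (i) If $n$ is odd, then $q(C_{n})\leq q(G)$. Moreover, if equality holds, then $G\cong C_{n}$ or $G\cong H(i_{1},\ldots,i_{k})$ for some $1\leq k\leq \frac{n-3}{2}$ and some integers $1\leq i_{1}\leq\cdots\leq i_{k}\leq\frac{n-3}{2}$. (ii) If $n$ is even, then $q(\Theta)\leq q(G)$, with equality if and only if $G\cong\Theta$.
   Context: All graphs are finite, simple, undirected and connected. For a graph $G$, $Q(G)=D(G)+A(G)$ is the signless Laplacian matrix ($A(G)$ the adjacency matrix, $D(G)$ the diagonal matrix of vertex degrees), and $q(G)$ denotes the least eigenvalue of $Q(G)$. A graph is 2-connected if it has at least $3$ vertices and any two distinct vertices are joined by at least two internally vertex-disjoint paths (equivalently, it is connected, has at least 3 vertices and has no cut vertex). $C_{n}=v_{0}v_{1}\cdots v_{n-1}v_{0}$ denotes the cycle on $n$ vertices. For odd $n\geq 5$ and integers $1\leq i_{1}\leq\cdots\leq i_{k}\leq\frac{n-3}{2}$ (with $1\leq k\leq\frac{n-3}{2}$), $H(i_{1},\ldots,i_{k})$ is the graph obtained from $C_{n}$ by adding the edges $v_{i_{1}}v_{n-i_{1}},\ldots,v_{i_{k}}v_{n-i_{k}}$. For even $n\geq 4$, $\Theta$ is the graph on vertices $v_{0},v_{1},\ldots,v_{n-1}$ consisting of the odd cycle $v_{1}v_{2}\cdots v_{n-1}v_{1}$ together with the two edges $v_{0}v_{2}$ and $v_{0}v_{n-1}$. *)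

theory Defs
  imports
    "Graph_Theory.Graph_Theory"
    "Jordan_Normal_Form.Spectral_Radius"
    "HOL-Library.Countable_Set"
begin

definition bipartite :: "('a, 'b) pre_digraph \<Rightarrow> bool" where
  "bipartite G \<longleftrightarrow> (\<exists>X Y. X \<union> Y = verts G \<and> X \<inter> Y = {} \<and>
     (\<forall>e \<in> arcs G. (tail G e \<in> X \<and> head G e \<in> Y) \<or> (tail G e \<in> Y \<and> head G e \<in> X)))"

text \<open>The two paths are required to be distinct: the path consisting of a single edge has no inner
  vertices, hence is internally disjoint from itself.\<close>

definition two_connected :: "('a, 'b) pre_digraph \<Rightarrow> bool" where
  "two_connected G \<longleftrightarrow> card (verts G) \<ge> 3 \<and>
     (\<forall>u \<in> verts G. \<forall>v \<in> verts G. u \<noteq> v \<longrightarrow>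
       (\<exists>p p'. pre_digraph.apath G u p v \<and> pre_digraph.apath G u p' v \<and> p \<noteq> p' \<and>
         set (pre_digraph.inner_verts G p) \<inter> set (pre_digraph.inner_verts G p') = {}))"

text \<open>A matrix needs an enumeration of the vertices. For finite \<open>V\<close>, the function
  \<open>from_nat_into V\<close> is a bijection from \<open>{..<card V}\<close> onto \<open>V\<close>; a different enumeration conjugates
  the matrices below by a permutation matrix and leaves their eigenvalues unchanged.\<close>

definition adjacency_matrix :: "('a, 'b) pre_digraph \<Rightarrow> real mat" where
  "adjacency_matrix G = (let n = card (verts G); v = from_nat_into (verts G) in
     mat n n (\<lambda>(i, j). if (v i, v j) \<in> arcs_ends G then 1 else 0))"

text \<open>An undirected edge is a pair of opposite arcs, so the degree of a vertex is its out-degree.\<close>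

definition degree_matrix :: "('a, 'b) pre_digraph \<Rightarrow> real mat" where
  "degree_matrix G = (let n = card (verts G); v = from_nat_into (verts G) in
     mat n n (\<lambda>(i, j). if i = j then real (out_degree G (v i)) else 0))"

definition signless_laplacian :: "('a, 'b) pre_digraph \<Rightarrow> real mat" where
  "signless_laplacian G = degree_matrix G + adjacency_matrix G"

text \<open>For a nonempty finite graph the matrix is real symmetric of positive dimension, so its set of
  real eigenvalues is finite, nonempty and contains all its complex eigenvalues.\<close>

definition least_q :: "('a, 'b) pre_digraph \<Rightarrow> real" where
  "least_q G = Min (spectrum (signless_laplacian G))"

text \<open>In the following graphs the vertex \<open>v\<^sub>i\<close> is the number \<open>i\<close>.\<close>

definition graph_of_edges :: "nat \<Rightarrow> (nat \<times> nat) set \<Rightarrow> nat pair_pre_digraph" where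
  "graph_of_edges n E = \<lparr> pverts = {..<n}, parcs = E \<union> E\<inverse> \<rparr>"

definition cycle_edges :: "nat \<Rightarrow> (nat \<times> nat) set" where
  "cycle_edges n = {(i, (i + 1) mod n) | i. i < n}"

definition cycle_graph :: "nat \<Rightarrow> nat pair_pre_digraph" where
  "cycle_graph n = graph_of_edges n (cycle_edges n)"

definition H_graph :: "nat \<Rightarrow> nat list \<Rightarrow> nat pair_pre_digraph" where
  "H_graph n js = graph_of_edges n (cycle_edges n \<union> {(j, n - j) | j. j \<in> set js})"

definition Theta_graph :: "nat \<Rightarrow> nat pair_pre_digraph" where
  "Theta_graph n = graph_of_edges n
     ({(i, i + 1) | i. 1 \<le> i \<and> i < n - 1} \<union> {(n - 1, 1), (0, 2), (0, n - 1)})"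

end

theory Submission
  imports Defs
begin

text \<open>
  Let \<open>x\<close> be an eigenvector for \<open>q(G)\<close>, so that the energy \<open>\<Sum>(x\<^sub>u + x\<^sub>v)\<^sup>2\<close> over the edges is \<open>q(G) \<Sum>x\<^sub>v\<^sup>2\<close>,
  let \<open>u\<close> maximize \<open>\<bar>x\<^sub>u\<bar>\<close>, and take a longest odd cycle \<open>C\<close> through \<open>u\<close>. Along a path the signs of \<open>x\<close> are
  alternated, which turns the energy into a sum of squared differences; around \<open>C\<close> the resulting sequence
  closes up with the opposite sign.

  If \<open>C\<close> is Hamiltonian, then \<open>n\<close> is odd and an antiperiodic sequence of length \<open>n\<close> has energy at least
  \<open>2 - 2 cos(\<pi>/n) = q(C\<^sub>n)\<close> times its square sum; equality forces a sinusoid, and every chord must join two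
  vertices with \<open>x\<^sub>u = - x\<^sub>v\<close>, which makes the sum of their indices constant modulo \<open>n\<close>.

  Otherwise \<open>C\<close> has an ear with an inner vertex, and \<open>C\<close> with this ear consists of three paths between two
  vertices \<open>a, b\<close>: paths \<open>A, B\<close> whose lengths have the same parity, and a path \<open>L\<close> of the other parity. As \<open>C\<close> is
  longest, \<open>A\<close> and \<open>B\<close> both have inner vertices. A value \<open>t\<close> of a vertex outside, up to sign, lies between
  two consecutive values \<open>e, e'\<close> on \<open>B\<close> or \<open>L\<close>, and inserting it there does not increase the energy because
  \<open>(e - t)\<^sup>2 + (t - e')\<^sup>2 \<le> (e - e')\<^sup>2\<close>. What remains is a form on three sequences with \<open>n\<close> values in total.
  Minimizing over the inner values leaves a quadratic form in the end values \<open>p, r\<close> that is diagonal in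
  \<open>p - r\<close> and \<open>p + r\<close>; convexity of the tangent shows that the smallest possible quotient is attained
  exactly for \<open>\<Theta>\<close>, and that it exceeds \<open>2 - 2 cos(\<pi>/n)\<close>.
\<close>

section \<open>Energy of real sequences\<close>

fun path_energy :: "real list \<Rightarrow> real" where
  "path_energy (x # y # xs) = (x - y)\<^sup>2 + path_energy (y # xs)"
| "path_energy _ = 0"

definition sumsq :: "real list \<Rightarrow> real" where
  "sumsq xs = sum_list (map (\<lambda>x. x\<^sup>2) xs)"

lemma sumsq_simps [simp]:
  "sumsq [] = 0" "sumsq (x # xs) = x\<^sup>2 + sumsq xs" "sumsq (xs @ ys) = sumsq xs + sumsq ys"
  by (simp_all add: sumsq_def)

lemma path_energy_append:
  "path_energy (xs @ x # ys) = path_energy (xs @ [x]) + path_energy (x # ys)"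
proof (induction xs)
  case (Cons a xs) then show ?case by (cases xs) auto
qed simp

lemma path_energy_snoc: "path_energy (xs @ [x, y]) = path_energy (xs @ [x]) + (x - y)\<^sup>2"
  using path_energy_append[of xs x "[y]"] by simp

text \<open>For \<open>0 < k\<theta> < \<pi>\<close> this is the minimum of the energy minus \<open>2 - 2 cos \<theta>\<close> times the square sum of the
  inner values, over all sequences of \<open>k\<close> steps from \<open>p\<close> to \<open>r\<close>.\<close>

definition path_form :: "real \<Rightarrow> nat \<Rightarrow> real \<Rightarrow> real \<Rightarrow> real" where
  "path_form \<theta> k p r = sin \<theta> * (cos (k * \<theta>) * (p\<^sup>2 + r\<^sup>2) - 2 * p * r) / sin (k * \<theta>)
     + (p\<^sup>2 + r\<^sup>2) * (1 - cos \<theta>)"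

text \<open>Completing the square in the joint value \<open>m\<close>. The coefficient of the square
  is positive as long as (k+1) \<theta> < \<pi>, so minimizing over \<open>m\<close> turns the form
  for \<open>k\<close> steps into the form for \<open>k + 1\<close> steps.\<close>

lemma path_form_step:
  fixes k :: nat and \<theta> :: real
  assumes "sin (k * \<theta>) \<noteq> 0" "sin (Suc k * \<theta>) \<noteq> 0"
  shows "path_form \<theta> k p m + (m - r)\<^sup>2 - (2 - 2 * cos \<theta>) * m\<^sup>2 =
    path_form \<theta> (Suc k) p r + sin (Suc k * \<theta>) / sin (k * \<theta>) *
      (m - (p * sin \<theta> + r * sin (k * \<theta>)) / sin (Suc k * \<theta>))\<^sup>2"
proof -
  define s c S C where "s = sin \<theta>" and "c = cos \<theta>" and "S = sin (k * \<theta>)" and "C = cos (k * \<theta>)"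
  have k: "Suc k * \<theta> = k * \<theta> + \<theta>" by (simp add: algebra_simps)
  have S': "sin (Suc k * \<theta>) = S * c + C * s" and C': "cos (Suc k * \<theta>) = C * c - S * s"
    unfolding k sin_add cos_add S_def C_def s_def c_def by (rule refl)+
  define T where "T = S * c + C * s"
  have T0: "T \<noteq> 0" and S0: "S \<noteq> 0" using assms S' by (auto simp: T_def S_def)
  have sc: "s\<^sup>2 = 1 - c\<^sup>2" and SC: "C\<^sup>2 = 1 - S\<^sup>2"
    by (simp_all only: s_def c_def S_def C_def sin_squared_eq[of \<theta>] cos_squared_eq[of "k * \<theta>"])
  define X where "X = C * c - S * s"
  \<comment> \<open>Addition theorems for the angles k \<theta>, \<theta> and (k+1) \<theta>. The
    three relations match the coefficients of p^2, m^2 and r^2 in \<open>key\<close>.\<close>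
  have e1: "C * T - X * S - s = 0" and e2: "s * C + c * S - T = 0" and e3: "c * T - s * X - S = 0"
  proof -
    have "C * T - X * S - s = s * (C\<^sup>2 + S\<^sup>2 - 1)" "c * T - s * X - S = S * (s\<^sup>2 + c\<^sup>2 - 1)"
      by (simp_all add: T_def X_def algebra_simps power2_eq_square)
    then show "C * T - X * S - s = 0" "c * T - s * X - S = 0" using sc SC by simp_all
  qed (simp add: T_def)
  have key: "s * (C * (p\<^sup>2 + m\<^sup>2) - 2 * p * m) * T + (p\<^sup>2 + m\<^sup>2) * (1 - c) * (S * T) + (m - r)\<^sup>2 * (S * T)
      - (2 - 2 * c) * m\<^sup>2 * (S * T) =
      s * (X * (p\<^sup>2 + r\<^sup>2) - 2 * p * r) * S + (p\<^sup>2 + r\<^sup>2) * (1 - c) * (S * T)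
      + (T * m - (p * s + r * S))\<^sup>2" (is "?l = ?r")
  proof -
    have "?l = ?r + p\<^sup>2 * s * (C * T - X * S - s) + m\<^sup>2 * T * (s * C + c * S - T) + r\<^sup>2 * S * (c * T - s * X - S)"
      by (simp add: algebra_simps power2_eq_square)
    then show ?thesis unfolding e1 e2 e3 by simp
  qed
  have "path_form \<theta> k p m + (m - r)\<^sup>2 - (2 - 2 * cos \<theta>) * m\<^sup>2 =
     (s * (C * (p\<^sup>2 + m\<^sup>2) - 2 * p * m) * T + (p\<^sup>2 + m\<^sup>2) * (1 - c) * (S * T) + (m - r)\<^sup>2 * (S * T)
      - (2 - 2 * c) * m\<^sup>2 * (S * T)) / (S * T)"
    unfolding path_form_def s_def[symmetric] c_def[symmetric] S_def[symmetric] C_def[symmetric]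
    using T0 S0 by (simp add: field_simps)
  also have "\<dots> = path_form \<theta> (Suc k) p r + T / S * (m - (p * s + r * S) / T)\<^sup>2"
  proof -
    have "T / S * (m - (p * s + r * S) / T)\<^sup>2 = (T * m - (p * s + r * S))\<^sup>2 / (S * T)"
      using T0 S0 by (simp add: field_simps power2_eq_square)
    then show ?thesis unfolding key path_form_def S' C' T_def[symmetric] X_def[symmetric] s_def[symmetric] c_def[symmetric]
      using T0 S0 by (simp add: add_divide_distrib)
  qed
  finally show ?thesis by (simp only: S' T_def s_def S_def)
qed

lemma sin_mult_angle_pos: "0 < (\<theta>::real) \<Longrightarrow> 0 < k \<Longrightarrow> real k * \<theta> < pi \<Longrightarrow> sin (real k * \<theta>) > 0"
  by (rule sin_gt_zero) auto

text \<open>The sequence grows at its end, and each new inner value is eliminated by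
  \<open>path_form_step\<close> with a nonnegative remainder. At equality all these squares vanish,
  and the values are those of the sinusoid of step \<theta> that takes the values \<open>p\<close>
  and \<open>r\<close> at the two ends.\<close>

lemma path_bound:
  fixes \<theta> p r :: real
  assumes "0 < \<theta>" "real (Suc (length m)) * \<theta> < pi"
  defines "k \<equiv> Suc (length m)"
  shows "path_energy (p # m @ [r]) - (2 - 2 * cos \<theta>) * sumsq m \<ge> path_form \<theta> k p r"
    and "path_energy (p # m @ [r]) - (2 - 2 * cos \<theta>) * sumsq m = path_form \<theta> k p r \<Longrightarrow>
      i \<le> k \<Longrightarrow> (p # m @ [r]) ! i = (p * sin (real (k - i) * \<theta>) + r * sin (real i * \<theta>)) / sin (real k * \<theta>)"
proof -
  have "path_energy (p # m @ [r]) - (2 - 2 * cos \<theta>) * sumsq m \<ge> path_form \<theta> (Suc (length m)) p r \<and>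
    (path_energy (p # m @ [r]) - (2 - 2 * cos \<theta>) * sumsq m = path_form \<theta> (Suc (length m)) p r \<longrightarrow>
      (\<forall>i\<le>Suc (length m). (p # m @ [r]) ! i = (p * sin (real (Suc (length m) - i) * \<theta>) + r * sin (real i * \<theta>)) / sin (real (Suc (length m)) * \<theta>)))"
    using assms(2)
  proof (induction m arbitrary: r rule: rev_induct)
    case Nil
    have "\<theta> < pi" using Nil by simp
    then have s: "sin \<theta> > 0" using assms(1) by (simp add: sin_gt_zero)
    have "path_form \<theta> (Suc 0) p r = (p - r)\<^sup>2"
      using s by (simp add: path_form_def field_simps power2_eq_square)
    moreover have "i = 0 \<or> i = 1" if "i \<le> Suc 0" for i using that by auto
    ultimately show ?case using s by (auto simp: le_Suc_eq)
  next
    case (snoc y m)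
    define K where "K = Suc (length m)"
    have K2: "real (Suc K) * \<theta> < pi" using snoc.prems by (simp add: K_def)
    then have K1: "real K * \<theta> < pi" using assms(1) by (simp add: algebra_simps)
    have s1: "sin (real K * \<theta>) > 0" and s2: "sin (real (Suc K) * \<theta>) > 0"
      using sin_mult_angle_pos[of \<theta> K] sin_mult_angle_pos[of \<theta> "Suc K"] assms(1) K1 K2 by (auto simp: K_def)
    define y0 where "y0 = (p * sin \<theta> + r * sin (real K * \<theta>)) / sin (real (Suc K) * \<theta>)"
    define q where "q = sin (real (Suc K) * \<theta>) / sin (real K * \<theta>)"
    have q: "q > 0" using s1 s2 by (simp add: q_def)
    have IH: "path_energy (p # m @ [y]) - (2 - 2 * cos \<theta>) * sumsq m \<ge> path_form \<theta> K p y"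
      "path_energy (p # m @ [y]) - (2 - 2 * cos \<theta>) * sumsq m = path_form \<theta> K p y \<Longrightarrow> 
      i\<le>K \<Longrightarrow> (p # m @ [y]) ! i = (p * sin (real (K - i) * \<theta>) + y * sin (real i * \<theta>)) / sin (real K * \<theta>)" for i
      using snoc.IH[of y] K1 unfolding K_def by auto
    have st: "path_form \<theta> K p y + (y - r)\<^sup>2 - (2 - 2 * cos \<theta>) * y\<^sup>2 = path_form \<theta> (Suc K) p r + q * (y - y0)\<^sup>2"
      using path_form_step[of K \<theta> p y r] s1 s2 unfolding y0_def q_def by simp
    have pe: "path_energy (p # (m @ [y]) @ [r]) = path_energy (p # m @ [y]) + (y - r)\<^sup>2"
      using path_energy_snoc[of "p # m" y r] by simp
    have tot: "path_energy (p # (m @ [y]) @ [r]) - (2 - 2 * cos \<theta>) * sumsq (m @ [y]) =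
      (path_energy (p # m @ [y]) - (2 - 2 * cos \<theta>) * sumsq m - path_form \<theta> K p y) + path_form \<theta> (Suc K) p r + q * (y - y0)\<^sup>2"
      using st unfolding pe by (simp add: algebra_simps)
    have nn: "q * (y - y0)\<^sup>2 \<ge> 0" using q by simp
    have len: "Suc (length (m @ [y])) = Suc K" by (simp add: K_def)
    show ?case unfolding len
    proof (intro conjI impI allI)
      show "path_form \<theta> (Suc K) p r \<le> path_energy (p # (m @ [y]) @ [r]) - (2 - 2 * cos \<theta>) * sumsq (m @ [y])"
        using tot nn IH(1) by linarith
    next
      fix i assume eq: "path_energy (p # (m @ [y]) @ [r]) - (2 - 2 * cos \<theta>) * sumsq (m @ [y]) = path_form \<theta> (Suc K) p r"
        and i: "i \<le> Suc K"
      have "q * (y - y0)\<^sup>2 = 0" and e2: "path_energy (p # m @ [y]) - (2 - 2 * cos \<theta>) * sumsq m = path_form \<theta> K p y"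
        using tot nn IH(1) eq by linarith+
      then have yy: "y = y0" using q by simp
      show "(p # (m @ [y]) @ [r]) ! i = (p * sin (real (Suc K - i) * \<theta>) + r * sin (real i * \<theta>)) / sin (real (Suc K) * \<theta>)"
      proof (cases "i = Suc K")
        case True
        then show ?thesis using s2 by (simp add: nth_append K_def)
      next
        case False
        then have iK: "i \<le> K" using i by simp
        have "(p # (m @ [y]) @ [r]) ! i = (p # m @ [y]) ! i"
          using iK by (cases i) (auto simp: nth_append K_def)
        also have "\<dots> = (p * sin (real (K - i) * \<theta>) + y * sin (real i * \<theta>)) / sin (real K * \<theta>)"
          using IH(2)[OF e2 iK] .
        \<comment> \<open>Since \<open>y\<close> is the value at position \<open>K\<close> of the
          sinusoid from \<open>p\<close> to \<open>r\<close> in K + 1 steps, the sinusoid from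
          \<open>p\<close> to \<open>y\<close> in \<open>K\<close> steps is its initial
          part.\<close>
        also have "\<dots> = (p * sin (real (Suc K - i) * \<theta>) + r * sin (real i * \<theta>)) / sin (real (Suc K) * \<theta>)"
        proof -
          define a b where "a = real i * \<theta>" and "b = real (K - i) * \<theta>"
          have e: "real K * \<theta> = a + b" "real (Suc K) * \<theta> = a + b + \<theta>" "real (Suc K - i) * \<theta> = b + \<theta>"
            using iK by (simp_all add: a_def b_def of_nat_diff Suc_diff_le algebra_simps)
          have id: "sin (a + b + \<theta>) * sin b + sin \<theta> * sin a = sin (a + b) * sin (b + \<theta>)"
          proof -
            have a: "a = (a + b) - b" by simp
            show ?thesis unfolding sin_add[of "a + b" \<theta>] sin_add[of b \<theta>]
              by (subst (3) a, unfold sin_diff) (simp add: algebra_simps)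
          qed
          have p1: "sin (a + b) \<noteq> 0" "sin (a + b + \<theta>) \<noteq> 0" using s1 s2 e by auto
          have Y: "y * sin (a + b + \<theta>) = p * sin \<theta> + r * sin (a + b)"
            unfolding yy y0_def e using p1 by simp
          have "(p * sin b + y * sin a) * sin (a + b + \<theta>) = (p * sin (b + \<theta>) + r * sin a) * sin (a + b)"
          proof -
            have "(p * sin b + y * sin a) * sin (a + b + \<theta>) =
              p * (sin (a + b + \<theta>) * sin b + sin \<theta> * sin a) + sin a * (y * sin (a + b + \<theta>) - p * sin \<theta>)"
              by (simp add: algebra_simps)
            then show ?thesis unfolding id Y by (simp add: algebra_simps)
          qed
          then show ?thesis unfolding e a_def[symmetric] b_def[symmetric] using p1
            by (simp add: frac_eq_eq)
        qed
        finally show ?thesis .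
      qed
    qed
  qed
  then show "path_energy (p # m @ [r]) - (2 - 2 * cos \<theta>) * sumsq m \<ge> path_form \<theta> k p r"
    and "path_energy (p # m @ [r]) - (2 - 2 * cos \<theta>) * sumsq m = path_form \<theta> k p r \<Longrightarrow>
      i \<le> k \<Longrightarrow> (p # m @ [r]) ! i = (p * sin (real (k - i) * \<theta>) + r * sin (real i * \<theta>)) / sin (real k * \<theta>)"
    unfolding k_def by auto
qed

text \<open>All n steps together would span the angle \<pi>, where \<open>path_bound\<close> does
  not apply. The last inner value \<open>y\<close> is therefore split off, and the remaining n - 1
  steps span only \<pi> - \<theta>.\<close>

lemma antiperiodic_bound:
  fixes \<theta> p :: real
  assumes n: "length m + 1 = n" "n \<ge> 2" and \<theta>: "\<theta> = pi / n"
  shows "path_energy (p # m @ [- p]) \<ge> (2 - 2 * cos \<theta>) * sumsq (p # m)"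
    and "path_energy (p # m @ [- p]) = (2 - 2 * cos \<theta>) * sumsq (p # m) \<Longrightarrow>
      \<exists>a b. \<forall>i<n. (p # m) ! i = a * cos (real i * \<theta>) + b * sin (real i * \<theta>)"
proof -
  from n obtain m' y where m: "m = m' @ [y]" by (cases m rule: rev_cases) auto
  define K where "K = Suc (length m')"
  have nK: "n = Suc K" using n by (simp add: m K_def)
  have th: "0 < \<theta>" and pn: "real n * \<theta> = pi" using n(2) \<theta> by auto
  have K\<theta>: "real K * \<theta> = pi - \<theta>" using pn nK by (simp add: algebra_simps)
  have Kp: "real (Suc (length m')) * \<theta> < pi" using K\<theta> th by (simp add: K_def)
  have "\<theta> < pi" using pn n(2) th by (auto simp: \<theta> field_simps)
  then have s: "sin \<theta> > 0" using th by (simp add: sin_gt_zero)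
  \<comment> \<open>At the angle \<pi> - \<theta> all terms containing \<open>y\<close> cancel, so
    no condition on \<open>y\<close> arises: at equality both \<open>p\<close> and \<open>y\<close>
    stay free, which gives the two parameters \<open>a\<close> and \<open>b\<close>.\<close>
  have pf: "path_form \<theta> K p y + (y + p)\<^sup>2 - (2 - 2 * cos \<theta>) * y\<^sup>2 = (2 - 2 * cos \<theta>) * p\<^sup>2"
    unfolding path_form_def K\<theta> sin_pi_minus cos_pi_minus using s by (simp add: field_simps power2_eq_square)
  have pe: "path_energy (p # m @ [- p]) = path_energy (p # m' @ [y]) + (y + p)\<^sup>2"
    using path_energy_snoc[of "p # m'" y "- p"] by (simp add: m)
  note pb = path_bound[OF th Kp, of p y, folded K_def]
  show "path_energy (p # m @ [- p]) \<ge> (2 - 2 * cos \<theta>) * sumsq (p # m)"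
    using pb(1) pf pe by (simp add: m algebra_simps)
  assume "path_energy (p # m @ [- p]) = (2 - 2 * cos \<theta>) * sumsq (p # m)"
  then have "path_energy (p # m' @ [y]) - (2 - 2 * cos \<theta>) * sumsq m' = path_form \<theta> K p y"
    using pf pe by (simp add: m algebra_simps)
  from pb(2)[OF this] have i: "(p # m) ! i = (p * sin (real (K - i) * \<theta>) + y * sin (real i * \<theta>)) / sin (real K * \<theta>)" if "i < n" for i
    using that nK by (simp add: m)
  have "(p # m) ! i = p * cos (real i * \<theta>) + ((p * cos \<theta> + y) / sin \<theta>) * sin (real i * \<theta>)" if "i < n" for i
  proof -
    have e: "real (K - i) * \<theta> = pi - (real i * \<theta> + \<theta>)" using that nK K\<theta> by (simp add: of_nat_diff algebra_simps)
    show ?thesis unfolding i[OF that] K\<theta> e sin_pi_minus using s by (simp add: sin_add add_divide_distrib distrib_left distrib_right)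
  qed
  then show "\<exists>a b. \<forall>i<n. (p # m) ! i = a * cos (real i * \<theta>) + b * sin (real i * \<theta>)" by blast
qed


section \<open>Inserting further values into a sequence\<close>

text \<open>Some consecutive pair brackets \<open>t\<close>, and placing \<open>t\<close> between
  its members changes the energy by -2 times a nonnegative product. If the energy stays the same,
  \<open>t\<close> equals a neighbour; the resulting repetition is what later contradicts the shape
  of an extremal sequence.\<close>

lemma insert_interior:
  assumes "e \<in> set (p # m @ [r])" "e' \<in> set (p # m @ [r])" "e \<le> t" "t \<le> e'"
  shows "\<exists>m'. length m' = Suc (length m) \<and> sumsq m' = sumsq m + t\<^sup>2 \<and> set m \<subseteq> set m' \<and>
    path_energy (p # m' @ [r]) \<le> path_energy (p # m @ [r]) \<and>
    (path_energy (p # m' @ [r]) = path_energy (p # m @ [r]) \<longrightarrow> (\<exists>us z vs. p # m' @ [r] = us @ z # z # vs))"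
  using assms
proof (induction m arbitrary: p e e')
  case Nil
  have e: "(p - r)\<^sup>2 - ((p - t)\<^sup>2 + (t - r)\<^sup>2) = 2 * ((p - t) * (t - r))"
    by (simp add: power2_eq_square algebra_simps)
  have "p \<le> t \<and> t \<le> r \<or> r \<le> t \<and> t \<le> p" using Nil by auto
  then have nn: "(p - t) * (t - r) \<ge> 0" by (auto simp: mult_nonneg_nonneg mult_nonpos_nonpos)
  have "\<exists>us z vs. p # [t] @ [r] = us @ z # z # vs" if "(p - t)\<^sup>2 + (t - r)\<^sup>2 = (p - r)\<^sup>2"
  proof -
    have "p = t \<or> t = r" using e that by auto
    then show ?thesis
    proof
      assume "p = t" then have "p # [t] @ [r] = [] @ t # t # [r]" by simp
      then show ?thesis by blast
    next
      assume "t = r" then have "p # [t] @ [r] = [p] @ t # t # []" by simp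
      then show ?thesis by blast
    qed
  qed
  then show ?case using e nn by (intro exI[of _ "[t]"]) auto
next
  case (Cons y m)
  show ?case
  proof (cases "p \<le> t \<and> t \<le> y \<or> y \<le> t \<and> t \<le> p")
    case True
    have e: "(p - y)\<^sup>2 - ((p - t)\<^sup>2 + (t - y)\<^sup>2) = 2 * ((p - t) * (t - y))"
      by (simp add: power2_eq_square algebra_simps)
    from True have nn: "(p - t) * (t - y) \<ge> 0" by (auto simp: mult_nonneg_nonneg mult_nonpos_nonpos)
    have "\<exists>us z vs. p # (t # y # m) @ [r] = us @ z # z # vs" if "(p - t)\<^sup>2 + (t - y)\<^sup>2 = (p - y)\<^sup>2"
    proof -
      have "p = t \<or> t = y" using e that by auto
      then show ?thesis
      proof
        assume "p = t" then have "p # (t # y # m) @ [r] = [] @ t # t # y # m @ [r]" by simp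
        then show ?thesis by blast
      next
        assume "t = y" then have "p # (t # y # m) @ [r] = [p] @ t # t # m @ [r]" by simp
        then show ?thesis by blast
      qed
    qed
    then show ?thesis using e nn by (intro exI[of _ "t # y # m"]) auto
  next
    case False
    \<comment> \<open>Here \<open>p\<close> and \<open>y\<close> lie strictly on the same side of
      \<open>t\<close>, so \<open>y\<close> can replace \<open>p\<close> as a bracketing
      value.\<close>
    have "\<exists>d\<in>set (y # m @ [r]). \<exists>d'\<in>set (y # m @ [r]). d \<le> t \<and> t \<le> d'"
      using Cons.prems False by (auto; force)
    then obtain d d' where d: "d \<in> set (y # m @ [r])" "d' \<in> set (y # m @ [r])" "d \<le> t" "t \<le> d'" by blast
    from Cons.IH[OF d] obtain m' where m': "length m' = Suc (length m)" "sumsq m' = sumsq m + t\<^sup>2" "set m \<subseteq> set m'"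
      "path_energy (y # m' @ [r]) \<le> path_energy (y # m @ [r])"
      "path_energy (y # m' @ [r]) = path_energy (y # m @ [r]) \<longrightarrow> (\<exists>us z vs. y # m' @ [r] = us @ z # z # vs)"
      by blast
    have "\<exists>us z vs. p # (y # m') @ [r] = us @ z # z # vs" if "path_energy (y # m' @ [r]) = path_energy (y # m @ [r])"
    proof -
      from m'(5) that obtain us z vs where "y # m' @ [r] = us @ z # z # vs" by blast
      then have "p # (y # m') @ [r] = (p # us) @ z # z # vs" by simp
      then show ?thesis by blast
    qed
    then show ?thesis using m' by (intro exI[of _ "y # m'"]) auto
  qed
qed

text \<open>Without a crossing each sequence stays in one of the three open intervals cut out by
  \<open>t\<close> and \<open>- t\<close>. Both contain \<open>p\<close>, so it is the same
  interval; it contains \<open>r\<close> and \<open>- r\<close>, so it is the middle one; but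
  \<open>z\<close> is too large in modulus to lie there.\<close>

lemma crossing_exists:
  fixes t z p r :: real
  assumes "z \<in> set (p # B @ [r]) \<union> set (p # L @ [- r])" "\<bar>t\<bar> \<le> \<bar>z\<bar>"
  shows "\<exists>s. (s = t \<or> s = - t) \<and>
    ((\<exists>e\<in>set (p # B @ [r]). \<exists>e'\<in>set (p # B @ [r]). e \<le> s \<and> s \<le> e') \<or>
     (\<exists>e\<in>set (p # L @ [- r]). \<exists>e'\<in>set (p # L @ [- r]). e \<le> s \<and> s \<le> e'))"
proof (rule ccontr)
  assume c: "\<not> ?thesis"
  have cB: "\<not> (e \<le> s \<and> s \<le> e')" if "e \<in> set (p # B @ [r])" "e' \<in> set (p # B @ [r])" "s = t \<or> s = - t" for e e' s
    using c that by blast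
  have cL: "\<not> (e \<le> s \<and> s \<le> e')" if "e \<in> set (p # L @ [- r])" "e' \<in> set (p # L @ [- r])" "s = t \<or> s = - t" for e e' s
    using c that by blast
  have pr: "p \<in> set (p # B @ [r])" "r \<in> set (p # B @ [r])" "p \<in> set (p # L @ [- r])" "- r \<in> set (p # L @ [- r])"
    by auto
  have 1: "\<not> (p \<le> s \<and> s \<le> r)" "\<not> (r \<le> s \<and> s \<le> p)" "\<not> (p \<le> s \<and> s \<le> - r)" "\<not> (- r \<le> s \<and> s \<le> p)"
    if "s = t \<or> s = - t" for s
    using cB[OF pr(1,2) that] cB[OF pr(2,1) that] cL[OF pr(3,4) that] cL[OF pr(4,3) that] by auto
  note 2 = 1[of t, simplified] 1[of "- t", simplified]
  show False
  proof (cases "z \<in> set (p # B @ [r])")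
    case True
    have "\<not> (p \<le> s \<and> s \<le> z)" "\<not> (z \<le> s \<and> s \<le> p)" if "s = t \<or> s = - t" for s
      using cB[OF pr(1) True that] cB[OF True pr(1) that] by auto
    note 3 = this[of t, simplified] this[of "- t", simplified]
    show False using 2 3 assms(2) by smt
  next
    case False
    then have T: "z \<in> set (p # L @ [- r])" using assms(1) by auto
    have "\<not> (p \<le> s \<and> s \<le> z)" "\<not> (z \<le> s \<and> s \<le> p)" if "s = t \<or> s = - t" for s
      using cL[OF pr(3) T that] cL[OF T pr(3) that] by auto
    note 3 = this[of t, simplified] this[of "- t", simplified]
    show False using 2 3 assms(2) by smt
  qed
qed

text \<open>The values are inserted one at a time; the inclusions of sets keep \<open>z\<close>
  available for the next crossing. Repetitions are recorded only for \<open>L\<close>: in the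
  equality case of \<open>theta_bound\<close> the list \<open>B'\<close> has a single element, which
  leaves no room for an insertion into a nonempty \<open>B\<close>.\<close>

lemma insert_all:
  fixes p r z :: real
  assumes "z \<in> set (p # B @ [r]) \<union> set (p # L @ [- r])" "\<forall>t\<in>set T. \<bar>t\<bar> \<le> \<bar>z\<bar>"
  shows "\<exists>B' L'. length B \<le> length B' \<and> length L \<le> length L' \<and>
    length B' + length L' = length B + length L + length T \<and>
    set B \<subseteq> set B' \<and> set L \<subseteq> set L' \<and> sumsq B' + sumsq L' = sumsq B + sumsq L + sumsq T \<and>
    path_energy (p # B' @ [r]) + path_energy (p # L' @ [- r]) \<le> path_energy (p # B @ [r]) + path_energy (p # L @ [- r]) \<and>
    (length L < length L' \<longrightarrow>
      path_energy (p # B' @ [r]) + path_energy (p # L' @ [- r]) < path_energy (p # B @ [r]) + path_energy (p # L @ [- r]) \<or>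
      (\<exists>us y vs. p # L' @ [- r] = us @ y # y # vs))"
  using assms(2)
proof (induction T)
  case Nil
  then show ?case by (intro exI[of _ B] exI[of _ L]) auto
next
  case (Cons t T)
  have "\<forall>t\<in>set T. \<bar>t\<bar> \<le> \<bar>z\<bar>" using Cons.prems by simp
  from Cons.IH[OF this] obtain B' L' where h: "length B \<le> length B'" "length L \<le> length L'"
    "length B' + length L' = length B + length L + length T"
    "set B \<subseteq> set B'" "set L \<subseteq> set L'" "sumsq B' + sumsq L' = sumsq B + sumsq L + sumsq T"
    "path_energy (p # B' @ [r]) + path_energy (p # L' @ [- r]) \<le> path_energy (p # B @ [r]) + path_energy (p # L @ [- r])"
    "length L < length L' \<longrightarrow>
      path_energy (p # B' @ [r]) + path_energy (p # L' @ [- r]) < path_energy (p # B @ [r]) + path_energy (p # L @ [- r]) \<or>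
      (\<exists>us y vs. p # L' @ [- r] = us @ y # y # vs)" by blast
  have "z \<in> set (p # B' @ [r]) \<union> set (p # L' @ [- r])" using assms(1) h(4,5) by auto
  from crossing_exists[OF this, of t] Cons.prems obtain s where s: "s = t \<or> s = - t" and
    "(\<exists>e\<in>set (p # B' @ [r]). \<exists>e'\<in>set (p # B' @ [r]). e \<le> s \<and> s \<le> e') \<or>
     (\<exists>e\<in>set (p # L' @ [- r]). \<exists>e'\<in>set (p # L' @ [- r]). e \<le> s \<and> s \<le> e')" by auto
  then consider e e' where "e \<in> set (p # B' @ [r])" "e' \<in> set (p # B' @ [r])" "e \<le> s" "s \<le> e'"
    | e e' where "e \<in> set (p # L' @ [- r])" "e' \<in> set (p # L' @ [- r])" "e \<le> s" "s \<le> e'" by blast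
  then show ?case
  proof cases
    case 1
    from insert_interior[OF 1] obtain m where m: "length m = Suc (length B')" "sumsq m = sumsq B' + s\<^sup>2" "set B' \<subseteq> set m"
      "path_energy (p # m @ [r]) \<le> path_energy (p # B' @ [r])" by blast
    have "length L < length L' \<longrightarrow>
      path_energy (p # m @ [r]) + path_energy (p # L' @ [- r]) < path_energy (p # B @ [r]) + path_energy (p # L @ [- r]) \<or>
      (\<exists>us y vs. p # L' @ [- r] = us @ y # y # vs)" (is "_ \<longrightarrow> ?lt \<or> ?rep")
    proof
      assume "length L < length L'"
      with h(8) show "?lt \<or> ?rep"
      proof (elim impE disjE)
        assume "path_energy (p # B' @ [r]) + path_energy (p # L' @ [- r]) < path_energy (p # B @ [r]) + path_energy (p # L @ [- r])"
        then have ?lt using m(4) by linarith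
        then show ?thesis ..
      qed auto
    qed
    moreover have "length B \<le> length m" "length m + length L' = length B + length L + length (t # T)" "set B \<subseteq> set m"
      using h(1,3,4) m(1,3) by auto
    moreover have "sumsq m + sumsq L' = sumsq B + sumsq L + sumsq (t # T)"
      using h(6) m(2) s by auto
    moreover have "path_energy (p # m @ [r]) + path_energy (p # L' @ [- r]) \<le> path_energy (p # B @ [r]) + path_energy (p # L @ [- r])"
      using h(7) m(4) by linarith
    ultimately show ?thesis using h(2,5) by blast
  next
    case 2
    from insert_interior[OF 2] obtain m where m: "length m = Suc (length L')" "sumsq m = sumsq L' + s\<^sup>2" "set L' \<subseteq> set m"
      "path_energy (p # m @ [- r]) \<le> path_energy (p # L' @ [- r])"
      "path_energy (p # m @ [- r]) = path_energy (p # L' @ [- r]) \<longrightarrow> (\<exists>us z vs. p # m @ [- r] = us @ z # z # vs)" by blast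
    have "path_energy (p # B' @ [r]) + path_energy (p # m @ [- r]) < path_energy (p # B @ [r]) + path_energy (p # L @ [- r]) \<or>
      (\<exists>us y vs. p # m @ [- r] = us @ y # y # vs)"
      using m(4,5) h(7) by (cases "path_energy (p # m @ [- r]) = path_energy (p # L' @ [- r])") auto
    moreover have "length L \<le> length m" "length B' + length m = length B + length L + length (t # T)" "set L \<subseteq> set m"
      using h(2,3,5) m(1,3) by auto
    moreover have "sumsq B' + sumsq m = sumsq B + sumsq L + sumsq (t # T)"
      using h(6) m(2) s by auto
    moreover have "path_energy (p # B' @ [r]) + path_energy (p # m @ [- r]) \<le> path_energy (p # B @ [r]) + path_energy (p # L @ [- r])"
      using h(7) m(4) by linarith
    ultimately show ?thesis using h(1,4) by blast
  qed
qed

section \<open>Trigonometric inequalities for the lengths of the three paths\<close>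

text \<open>Convexity of the tangent on [0, \<pi>/2). The difference equals sin d / (cos u cos (u +
  d)), whose denominator decreases in u.\<close>

lemma tan_gap:
  assumes "0 \<le> d" "0 \<le> x" "x \<le> y" "y + d < pi / 2"
  shows "tan (x + d) - tan x \<le> tan (y + d) - tan y"
    and "0 < d \<Longrightarrow> x < y \<Longrightarrow> tan (x + d) - tan x < tan (y + d) - tan y"
proof -
  have gap: "tan (u + d) - tan u = sin d / (cos u * cos (u + d))" if "0 \<le> u" "u \<le> y" for u
  proof -
    have "cos u > 0" "cos (u + d) > 0" using assms that by (auto intro!: cos_gt_zero_pi)
    then show ?thesis using add_tan_eq[of "u + d" "- u"] by (simp add: mult.commute)
  qed
  have c: "cos y > 0" "cos (y + d) > 0" "cos x > 0" "cos (x + d) > 0" using assms by (auto intro!: cos_gt_zero_pi)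
  have m: "cos y \<le> cos x" "cos (y + d) \<le> cos (x + d)" using assms by (auto intro!: cos_monotone_0_pi_le)
  have s: "sin d \<ge> 0" using assms by (intro sin_ge_zero) auto
  show "tan (x + d) - tan x \<le> tan (y + d) - tan y"
    using gap[of x] gap[of y] assms c m s by (auto intro!: divide_left_mono mult_mono)
  assume d: "0 < d" and xy: "x < y"
  have "sin d > 0" using assms d by (intro sin_gt_zero) auto
  moreover have "cos y * cos (y + d) < cos x * cos (x + d)"
    using assms c m xy by (intro mult_strict_mono' cos_monotone_0_pi) auto
  ultimately show "tan (x + d) - tan x < tan (y + d) - tan y"
    using gap[of x] gap[of y] assms c by (auto intro!: divide_strict_left_mono)
qed

lemma cot_eq_tan: "cot x = tan (pi / 2 - x)" for x :: real
  by (simp add: tan_cot cot_altdef)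

text \<open>Here \<open>A, B, L\<close> are the lengths of the three paths, multiplied by \<open>\<theta>/2\<close>.\<close>

lemma theta_coefficients:
  fixes \<theta> A B L :: real
  assumes "0 < \<theta>" "\<theta> \<le> A" "\<theta> \<le> B" "0 < L" and h: "A + B + L - \<theta> < pi / 2"
  defines "\<kappa> \<equiv> cot (A + B + L - 2 * \<theta>) - 2 * tan \<theta> + tan (\<theta> / 2)"
  shows "cot A + cot B - tan L + tan (\<theta> / 2) > 0"
    and "cot L - tan A - tan B + tan (\<theta> / 2) \<ge> \<kappa>"
    and "cot L - tan A - tan B + tan (\<theta> / 2) = \<kappa> \<Longrightarrow> A = \<theta> \<and> B = \<theta>"
proof -
  have "tan L < cot A" unfolding cot_eq_tan using assms by (intro tan_monotone) auto
  moreover have "cot B > 0" unfolding cot_eq_tan using assms by (intro tan_gt_zero) auto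
  moreover have "tan (\<theta> / 2) > 0" using assms by (intro tan_gt_zero) auto
  ultimately show "cot A + cot B - tan L + tan (\<theta> / 2) > 0" by simp
  \<comment> \<open>The tangent is convex, so tan A + tan B can only grow when \<open>A\<close>,
    \<open>B\<close> are replaced by \<theta> and \<open>Z\<close>, which have the same sum. A
    second comparison shortens \<open>Z\<close> to \<theta> and gives the excess to
    \<open>L\<close>. The number \<open>d\<close> is chosen so that \<open>L\<close> and
    \<open>Z + d\<close> are complementary angles.\<close>
  define Z d where "Z = A + B - \<theta>" and "d = pi / 2 - (A + B + L - \<theta>)"
  have L: "cot L = tan (Z + d)" unfolding cot_eq_tan by (rule arg_cong[of _ _ tan]) (simp add: Z_def d_def)
  have k: "cot (A + B + L - 2 * \<theta>) = tan (\<theta> + d)" unfolding cot_eq_tan by (rule arg_cong[of _ _ tan]) (simp add: d_def)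
  have g1: "tan (\<theta> + (B - \<theta>)) - tan \<theta> \<le> tan (A + (B - \<theta>)) - tan A"
    using assms by (intro tan_gap) auto
  have g2: "tan (\<theta> + d) - tan \<theta> \<le> tan (Z + d) - tan Z"
    using assms by (intro tan_gap) (auto simp: Z_def d_def)
  have AB: "A + (B - \<theta>) = Z" "\<theta> + (B - \<theta>) = B" by (simp_all add: Z_def)
  show "cot L - tan A - tan B + tan (\<theta> / 2) \<ge> \<kappa>"
    using g1 g2 unfolding \<kappa>_def L k AB by linarith
  assume eq: "cot L - tan A - tan B + tan (\<theta> / 2) = \<kappa>"
  \<comment> \<open>The second comparison is strict unless Z = \<theta>, that is A + B = 2 \<theta>,
    where both summands are at least \<theta>.\<close>
  have "\<not> \<theta> < Z"
  proof
    assume "\<theta> < Z"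
    then have "tan (\<theta> + d) - tan \<theta> < tan (Z + d) - tan Z"
      using assms by (intro tan_gap) (auto simp: Z_def d_def)
    then show False using g1 eq unfolding \<kappa>_def L k AB by linarith
  qed
  then show "A = \<theta> \<and> B = \<theta>" using assms by (auto simp: Z_def)
qed

lemma one_minus_cos_eq:
  fixes \<theta> :: real
  assumes "cos (\<theta> / 2) \<noteq> 0"
  shows "1 - cos \<theta> = sin \<theta> * tan (\<theta> / 2)"
proof -
  have "cos \<theta> = 1 - 2 * (sin (\<theta> / 2))\<^sup>2" "sin \<theta> = 2 * sin (\<theta> / 2) * cos (\<theta> / 2)"
    using cos_double_sin[of "\<theta> / 2"] sin_double[of "\<theta> / 2"] by simp_all
  then show ?thesis using assms by (simp add: tan_def power2_eq_square)
qed

text \<open>Reversing a path exchanges \<open>p\<close> and \<open>r\<close>, so the form is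
  diagonal in the symmetric and antisymmetric combinations of the end values; the half angle makes
  the two coefficients a cotangent and a tangent.\<close>

lemma path_form_half:
  assumes "sin (k * \<theta> / 2) \<noteq> 0" "cos (k * \<theta> / 2) \<noteq> 0" "cos (\<theta> / 2) \<noteq> 0"
  shows "path_form \<theta> k p r = sin \<theta> / 2 * ((p - r)\<^sup>2 * (cot (k * \<theta> / 2) + tan (\<theta> / 2))
    + (p + r)\<^sup>2 * (tan (\<theta> / 2) - tan (k * \<theta> / 2)))"
proof -
  define s c where "s = sin (k * \<theta> / 2)" and "c = cos (k * \<theta> / 2)"
  have d: "sin (k * \<theta>) = 2 * s * c" "cos (k * \<theta>) = c\<^sup>2 - s\<^sup>2"
    using sin_double[of "k * \<theta> / 2"] cos_double[of "k * \<theta> / 2"] by (simp_all add: s_def c_def)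
  have sc: "s\<^sup>2 + c\<^sup>2 = 1" by (simp add: s_def c_def)
  have nz: "s \<noteq> 0" "c \<noteq> 0" using assms by (auto simp: s_def c_def)
  note t = one_minus_cos_eq[OF assms(3)]
  have e: "cos (k * \<theta>) * (p\<^sup>2 + r\<^sup>2) - 2 * p * r = (p - r)\<^sup>2 * c\<^sup>2 - (p + r)\<^sup>2 * s\<^sup>2"
  proof -
    have "(p - r)\<^sup>2 * c\<^sup>2 - (p + r)\<^sup>2 * s\<^sup>2 = (c\<^sup>2 - s\<^sup>2) * (p\<^sup>2 + r\<^sup>2) - 2 * p * r * (s\<^sup>2 + c\<^sup>2)"
      by (simp add: power2_eq_square algebra_simps)
    then show ?thesis unfolding d sc by simp
  qed
  have frac: "(cos (k * \<theta>) * (p\<^sup>2 + r\<^sup>2) - 2 * p * r) / sin (k * \<theta>) = ((p - r)\<^sup>2 * (c / s) - (p + r)\<^sup>2 * (s / c)) / 2"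
    unfolding e unfolding d using nz by (simp add: field_simps power2_eq_square)
  have "path_form \<theta> k p r = sin \<theta> * ((cos (k * \<theta>) * (p\<^sup>2 + r\<^sup>2) - 2 * p * r) / sin (k * \<theta>)) + (p\<^sup>2 + r\<^sup>2) * (sin \<theta> * tan (\<theta> / 2))"
    unfolding path_form_def t by (simp only: times_divide_eq_right)
  also have "\<dots> = sin \<theta> * (((p - r)\<^sup>2 * (c / s) - (p + r)\<^sup>2 * (s / c)) / 2) + (p\<^sup>2 + r\<^sup>2) * (sin \<theta> * tan (\<theta> / 2))"
    unfolding frac ..
  also have "p\<^sup>2 + r\<^sup>2 = ((p - r)\<^sup>2 + (p + r)\<^sup>2) / 2"
    by (simp add: power2_eq_square algebra_simps)
  also have "sin \<theta> * (((p - r)\<^sup>2 * (c / s) - (p + r)\<^sup>2 * (s / c)) / 2) + ((p - r)\<^sup>2 + (p + r)\<^sup>2) / 2 * (sin \<theta> * tan (\<theta> / 2))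
     = sin \<theta> / 2 * ((p - r)\<^sup>2 * (c / s + tan (\<theta> / 2)) + (p + r)\<^sup>2 * (tan (\<theta> / 2) - s / c))"
    by (simp add: algebra_simps add_divide_distrib diff_divide_distrib)
  finally show ?thesis by (simp add: s_def c_def cot_def tan_def)
qed

text \<open>The coefficient of \<open>(p + r)\<^sup>2\<close> for \<open>\<Theta>\<close>, whose paths \<open>A, B, L\<close> have lengths \<open>2, 2, n - 3\<close>; its zero below
  \<open>\<pi>/(n - 1)\<close> gives \<open>q(\<Theta>) = 2 - 2 cos \<theta>\<close>.\<close>

definition kappa :: "nat \<Rightarrow> real \<Rightarrow> real" where
  "kappa n \<theta> = cot ((real n - 3) * \<theta> / 2) - 2 * tan \<theta> + tan (\<theta> / 2)"

text \<open>\<open>path_bound\<close> on the three paths leaves a form with coefficients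
  \<open>cD\<close> for (p - r)^2 and \<open>cS\<close> for (p + r)^2, where \<open>cD > 0\<close>
  and \<open>cS\<close> is at least \<open>kappa n \<theta>\<close>. At equality p = r, and p is
  nonzero, so \<open>cS = 0\<close>; then the equality case of \<open>theta_coefficients\<close>
  gives the two short paths.\<close>

lemma theta_bound:
  fixes \<theta> p r :: real and A B L :: "real list"
  assumes n: "length A + length B + length L + 2 = n" "A \<noteq> []" "B \<noteq> []"
    and \<theta>: "0 < \<theta>" "(real n - 1) * \<theta> < pi" and k: "kappa n \<theta> \<ge> 0"
  defines "E \<equiv> path_energy (p # A @ [r]) + path_energy (p # B @ [r]) + path_energy (p # L @ [- r])"
    and "N \<equiv> p\<^sup>2 + r\<^sup>2 + sumsq A + sumsq B + sumsq L"
  shows "E \<ge> (2 - 2 * cos \<theta>) * N"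
    and "E = (2 - 2 * cos \<theta>) * N \<Longrightarrow> N \<noteq> 0 \<Longrightarrow>
      kappa n \<theta> = 0 \<and> length A = 1 \<and> length B = 1 \<and> p = r \<and> p \<noteq> 0 \<and> A = [p / cos \<theta>] \<and> B = [p / cos \<theta>] \<and>
      (\<forall>i\<le>n - 3. (p # L @ [- r]) ! i = p * sin (((real n - 3) / 2 - real i) * \<theta>) / sin ((real n - 3) / 2 * \<theta>))"
proof -
  define a b l where "a = Suc (length A)" and "b = Suc (length B)" and "l = Suc (length L)"
  have ab: "a \<ge> 2" "b \<ge> 2" "l \<ge> 1" and sum: "a + b + l = n + 1"
    using n by (cases A; cases B; auto simp: a_def b_def l_def)+
  have sumr: "real a + real b + real l = real n + 1" using sum by (metis of_nat_1 of_nat_add)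
  define x y z where "x = a * \<theta> / 2" and "y = b * \<theta> / 2" and "z = l * \<theta> / 2"
  have xy: "\<theta> \<le> x" "\<theta> \<le> y" "0 < z" using ab \<theta>(1) by (auto simp: x_def y_def z_def)
  \<comment> \<open>The three paths have n + 1 edges in total, so with \<open>A\<close> and
    \<open>B\<close> of length 2 the third has n - 3, as in \<open>kappa\<close>.\<close>
  have xyz: "x + y + z = (real n + 1) * \<theta> / 2" unfolding sumr[symmetric] by (simp add: x_def y_def z_def field_simps)
  have h: "x + y + z - \<theta> < pi / 2" using \<theta>(2) unfolding xyz by (simp add: field_simps)
  have kap: "cot (x + y + z - 2 * \<theta>) - 2 * tan \<theta> + tan (\<theta> / 2) = kappa n \<theta>"
    unfolding kappa_def xyz by (simp add: field_simps)
  note co = theta_coefficients[OF \<theta>(1) xy h, unfolded kap]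
  define cD cS where "cD = cot x + cot y - tan z + tan (\<theta> / 2)" and "cS = cot z - tan x - tan y + tan (\<theta> / 2)"
  have small: "x < pi / 2" "y < pi / 2" "z < pi / 2" "\<theta> < pi / 2" using xy h \<theta> by auto
  have nz: "sin x \<noteq> 0" "cos x \<noteq> 0" "sin y \<noteq> 0" "cos y \<noteq> 0" "sin z \<noteq> 0" "cos z \<noteq> 0" "cos (\<theta> / 2) \<noteq> 0"
    using xy small \<theta>(1) by (auto intro!: less_imp_neq[symmetric] sin_gt_zero cos_gt_zero_pi)
  have s: "sin \<theta> > 0" using small \<theta> by (intro sin_gt_zero) auto
  have lam: "2 - 2 * cos \<theta> = 2 * (sin \<theta> * tan (\<theta> / 2))"
    using one_minus_cos_eq[OF nz(7)] by simp
  have forms: "path_form \<theta> a p r + path_form \<theta> b p r + path_form \<theta> l p (- r) - (2 - 2 * cos \<theta>) * (p\<^sup>2 + r\<^sup>2) =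
    sin \<theta> / 2 * ((p - r)\<^sup>2 * cD + (p + r)\<^sup>2 * cS)"
  proof -
    \<comment> \<open>On \<open>L\<close> the end value is \<open>- r\<close>, which exchanges the
      roles of p - r and p + r.\<close>
    have "path_form \<theta> a p r = sin \<theta> / 2 * ((p - r)\<^sup>2 * (cot x + tan (\<theta> / 2)) + (p + r)\<^sup>2 * (tan (\<theta> / 2) - tan x))"
      "path_form \<theta> b p r = sin \<theta> / 2 * ((p - r)\<^sup>2 * (cot y + tan (\<theta> / 2)) + (p + r)\<^sup>2 * (tan (\<theta> / 2) - tan y))"
      "path_form \<theta> l p (- r) = sin \<theta> / 2 * ((p + r)\<^sup>2 * (cot z + tan (\<theta> / 2)) + (p - r)\<^sup>2 * (tan (\<theta> / 2) - tan z))"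
      using path_form_half[of a \<theta> p r] path_form_half[of b \<theta> p r] path_form_half[of l \<theta> p "- r"] nz
      by (simp_all add: x_def y_def z_def)
    moreover have "(2 - 2 * cos \<theta>) * (p\<^sup>2 + r\<^sup>2) = sin \<theta> / 2 * (2 * tan (\<theta> / 2) * ((p - r)\<^sup>2 + (p + r)\<^sup>2))"
      unfolding lam by (simp add: power2_eq_square algebra_simps)
    ultimately show ?thesis unfolding cD_def cS_def by (simp add: algebra_simps)
  qed
  have ang: "real (Suc (length A)) * \<theta> < pi" "real (Suc (length B)) * \<theta> < pi" "real (Suc (length L)) * \<theta> < pi"
    using small unfolding x_def y_def z_def a_def b_def l_def by simp_all
  note pA = path_bound[OF \<theta>(1) ang(1), of p r, folded a_def]
  note pB = path_bound[OF \<theta>(1) ang(2), of p r, folded b_def]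
  note pL = path_bound[OF \<theta>(1) ang(3), of p "- r", folded l_def]
  define eA eB eL where "eA = path_energy (p # A @ [r]) - (2 - 2 * cos \<theta>) * sumsq A - path_form \<theta> a p r"
    and "eB = path_energy (p # B @ [r]) - (2 - 2 * cos \<theta>) * sumsq B - path_form \<theta> b p r"
    and "eL = path_energy (p # L @ [- r]) - (2 - 2 * cos \<theta>) * sumsq L - path_form \<theta> l p (- r)"
  have e0: "eA \<ge> 0" "eB \<ge> 0" "eL \<ge> 0" using pA(1) pB(1) pL(1) by (auto simp: eA_def eB_def eL_def)
  have cD: "cD > 0" and cS: "cS \<ge> kappa n \<theta>" using co(1,2) by (simp_all add: cD_def cS_def)
  have tot: "E - (2 - 2 * cos \<theta>) * N = eA + eB + eL + sin \<theta> / 2 * ((p - r)\<^sup>2 * cD + (p + r)\<^sup>2 * cS)"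
    unfolding forms[symmetric] E_def N_def eA_def eB_def eL_def by (simp add: algebra_simps)
  have q0: "(p - r)\<^sup>2 * cD \<ge> 0" "(p + r)\<^sup>2 * cS \<ge> 0" using cD cS k by auto
  then have q: "sin \<theta> / 2 * ((p - r)\<^sup>2 * cD + (p + r)\<^sup>2 * cS) \<ge> 0" using s by simp
  show "E \<ge> (2 - 2 * cos \<theta>) * N" using tot e0 q by linarith
  assume eq: "E = (2 - 2 * cos \<theta>) * N" and N: "N \<noteq> 0"
  have "sin \<theta> / 2 * ((p - r)\<^sup>2 * cD + (p + r)\<^sup>2 * cS) = 0" and ez: "eA = 0" "eB = 0" "eL = 0"
    using tot e0 q eq by linarith+
  then have "(p - r)\<^sup>2 * cD + (p + r)\<^sup>2 * cS = 0" using s by simp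
  then have "(p - r)\<^sup>2 * cD = 0" "(p + r)\<^sup>2 * cS = 0" using q0 by linarith+
  then have pr: "r = p" and pS: "p = 0 \<or> cS = 0" using cD by auto
  have iA: "(p # A @ [r]) ! i = (p * sin (real (a - i) * \<theta>) + r * sin (real i * \<theta>)) / sin (real a * \<theta>)" if "i \<le> a" for i
    using pA(2)[OF _ that] ez by (simp add: eA_def)
  have iB: "(p # B @ [r]) ! i = (p * sin (real (b - i) * \<theta>) + r * sin (real i * \<theta>)) / sin (real b * \<theta>)" if "i \<le> b" for i
    using pB(2)[OF _ that] ez by (simp add: eB_def)
  have iL: "(p # L @ [- r]) ! i = (p * sin (real (l - i) * \<theta>) + (- r) * sin (real i * \<theta>)) / sin (real l * \<theta>)" if "i \<le> l" for i
    using pL(2)[OF _ that] ez by (simp add: eL_def)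
  \<comment> \<open>Otherwise both end values vanish, and with them the sinusoids on all three
    paths, against \<open>N \<noteq> 0\<close>.\<close>
  have p0: "p \<noteq> 0"
  proof
    assume p: "p = 0"
    have "sumsq A = 0"
    proof -
      have "A ! i = 0" if "i < length A" for i using iA[of "Suc i"] that p pr by (simp add: a_def nth_append)
      then have "\<forall>v\<in>set A. v = 0" by (metis in_set_conv_nth)
      then show ?thesis by (induction A) auto
    qed
    moreover have "sumsq B = 0"
    proof -
      have "B ! i = 0" if "i < length B" for i using iB[of "Suc i"] that p pr by (simp add: b_def nth_append)
      then have "\<forall>v\<in>set B. v = 0" by (metis in_set_conv_nth)
      then show ?thesis by (induction B) auto
    qed
    moreover have "sumsq L = 0"
    proof -
      have "L ! i = 0" if "i < length L" for i using iL[of "Suc i"] that p pr by (simp add: l_def nth_append)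
      then have "\<forall>v\<in>set L. v = 0" by (metis in_set_conv_nth)
      then show ?thesis by (induction L) auto
    qed
    ultimately show False using N p pr by (simp add: N_def)
  qed
  then have "cS = 0" using pS by simp
  then have k0: "kappa n \<theta> = 0" using cS k by simp
  then have "x = \<theta> \<and> y = \<theta>" using co(3) \<open>cS = 0\<close> by (simp add: cS_def)
  then have ab2: "a = 2" "b = 2" using \<theta>(1) by (simp_all add: x_def y_def)
  then have ln: "l = n - 3" "n \<ge> 4" using sum ab(3) by auto
  have c0: "cos \<theta> > 0" using small \<theta>(1) by (intro cos_gt_zero_pi) auto
  have mid: "(p * sin (real (2 - 1) * \<theta>) + r * sin (real 1 * \<theta>)) / sin (real 2 * \<theta>) = p / cos \<theta>"
    using s c0 pr sin_double[of \<theta>] by (simp add: field_simps)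
  obtain u where u: "A = [u]" using ab2(1) by (cases A) (auto simp: a_def)
  obtain v where v: "B = [v]" using ab2(2) by (cases B) (auto simp: b_def)
  have "u = p / cos \<theta>" "v = p / cos \<theta>" using iA[of 1] iB[of 1] mid ab2 u v by simp_all
  \<comment> \<open>With end values \<open>p\<close> and \<open>- p\<close> the sinusoid is
    antisymmetric about the middle of the path, hence a single sine centred there.\<close>
  moreover have "(p # L @ [- r]) ! i = p * sin (((real n - 3) / 2 - real i) * \<theta>) / sin ((real n - 3) / 2 * \<theta>)" if "i \<le> n - 3" for i
  proof -
    define w e where "w = real l * \<theta> / 2" and "e = (real l / 2 - real i) * \<theta>"
    have il: "i \<le> l" using that ln by simp
    have rl: "real n - 3 = real l" using ln by (simp add: of_nat_diff)
    have e1: "real (l - i) * \<theta> = w + e" "real i * \<theta> = w - e" "real l * \<theta> = 2 * w"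
      using il by (simp_all add: w_def e_def of_nat_diff field_simps)
    have wz: "sin w \<noteq> 0" "cos w \<noteq> 0" using nz(5,6) by (simp_all add: w_def z_def)
    have "(p # L @ [- r]) ! i = (p * sin (w + e) + (- p) * sin (w - e)) / (2 * sin w * cos w)"
      using iL[OF il] unfolding e1 sin_double pr .
    also have "\<dots> = p * sin e / sin w"
      unfolding sin_add sin_diff using wz by (simp add: field_simps)
    finally show ?thesis unfolding rl e_def w_def by simp
  qed
  ultimately show "kappa n \<theta> = 0 \<and> length A = 1 \<and> length B = 1 \<and> p = r \<and> p \<noteq> 0 \<and> A = [p / cos \<theta>] \<and> B = [p / cos \<theta>] \<and>
      (\<forall>i\<le>n - 3. (p # L @ [- r]) ! i = p * sin (((real n - 3) / 2 - real i) * \<theta>) / sin ((real n - 3) / 2 * \<theta>))"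
    using k0 p0 pr u v by auto
qed

section \<open>Sign and zero of \<open>kappa\<close>\<close>

text \<open>At \<theta> = \<pi>/n the cotangent becomes tan (3 \<theta>/2), and the claim is strict
  convexity of the tangent at \<theta>/2, \<theta>, 3 \<theta>/2. For odd n it excludes equality in
  the theta case; it also supplies one sign for \<open>kappa_root\<close>.\<close>

lemma kappa_pos:
  assumes "n \<ge> 4"
  shows "kappa n (pi / n) > 0"
proof -
  define \<theta> where "\<theta> = pi / n"
  have n\<theta>: "real n * \<theta> = pi" "\<theta> > 0" using assms by (auto simp: \<theta>_def)
  have "4 * \<theta> \<le> real n * \<theta>" using n\<theta>(2) assms by (intro mult_right_mono) auto
  then have t4: "4 * \<theta> \<le> pi" using n\<theta> by simp
  have "pi / 2 - (real n - 3) * \<theta> / 2 = \<theta> + \<theta> / 2" using n\<theta>(1) by (simp add: field_simps)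
  then have c: "cot ((real n - 3) * \<theta> / 2) = tan (\<theta> + \<theta> / 2)" by (simp only: cot_eq_tan)
  have "tan (\<theta> / 2 + \<theta> / 2) - tan (\<theta> / 2) < tan (\<theta> + \<theta> / 2) - tan \<theta>"
    using n\<theta> t4 by (intro tan_gap) (auto simp: field_simps)
  then show ?thesis unfolding kappa_def \<theta>_def[symmetric] c by simp
qed

text \<open>Intermediate value theorem between \<pi>/n and \<pi>/(n - 1): at the right end the
  cotangent equals tan v, so \<open>kappa\<close> is tan (v/2) - tan v < 0.\<close>

lemma kappa_root:
  assumes "n \<ge> 4"
  obtains \<theta> where "0 < \<theta>" "(real n - 1) * \<theta> < pi" "kappa n \<theta> = 0"
proof -
  have n: "real n \<ge> 4" using assms by simp
  define u v where "u = pi / n" and "v = pi / (real n - 1)"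
  have uv: "0 < u" "u < v" using n by (auto simp: u_def v_def field_simps)
  have v1: "(real n - 1) * v = pi" using n by (simp add: v_def)
  have "3 * v \<le> (real n - 1) * v" using n uv by (intro mult_right_mono) auto
  then have v3: "v \<le> pi / 3" using v1 by simp
  have "kappa n v < 0"
  proof -
    have "pi / 2 - (real n - 3) * v / 2 = v" using v1 by (simp add: field_simps)
    then have "cot ((real n - 3) * v / 2) = tan v" by (simp only: cot_eq_tan)
    moreover have "tan (v / 2) < tan v" using uv v3 by (intro tan_monotone) auto
    ultimately show ?thesis by (simp add: kappa_def)
  qed
  moreover have "kappa n u > 0" unfolding u_def by (rule kappa_pos[OF assms])
  moreover have "continuous_on {u..v} (kappa n)"
    unfolding kappa_def[abs_def]
  proof (intro continuous_intros ballI)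
    fix x assume x: "x \<in> {u..v}"
    have xv: "x > 0" "x \<le> v" "x \<le> pi / 3" using x uv v3 by auto
    have "(real n - 3) * x \<le> (real n - 3) * v" using n xv by (intro mult_left_mono) auto
    also have "\<dots> = pi - 2 * v" using v1 by (simp add: algebra_simps)
    finally have "(real n - 3) * x / 2 < pi" using uv pi_gt_zero by linarith
    moreover have "(real n - 3) * x / 2 > 0" using n xv by simp
    ultimately show "sin ((real n - 3) * x / 2) \<noteq> 0" using sin_gt_zero[of "(real n - 3) * x / 2"] by linarith
    show "cos x \<noteq> 0" "cos (x / 2) \<noteq> 0" using xv by (auto intro!: less_imp_neq[symmetric] cos_gt_zero_pi)
  qed simp_all
  ultimately obtain \<theta> where \<theta>: "u \<le> \<theta>" "\<theta> \<le> v" "kappa n \<theta> = 0"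
    using IVT2'[of "kappa n" v 0 u] uv by (auto intro: less_imp_le)
  with \<open>kappa n v < 0\<close> have "\<theta> < v" by (cases "\<theta> = v") auto
  then have "(real n - 1) * \<theta> < pi" using n by (simp add: v_def field_simps)
  then show ?thesis using that[of \<theta>] \<theta> uv by auto
qed

section \<open>Odd cycles and theta subgraphs of 2-connected graphs\<close>

lemma successively_symp_rev:
  assumes "\<And>x y. P x y \<Longrightarrow> P y x" "successively P xs"
  shows "successively P (rev xs)"
  using assms(2) unfolding successively_rev by (rule successively_mono) (auto intro: assms(1))

lemma successively_split:
  "successively P (xs @ y # ys) \<longleftrightarrow> successively P (xs @ [y]) \<and> successively P (y # ys)"
  by (auto simp: successively_append_iff)

lemma walk_to_path:
  assumes "successively P xs" "xs \<noteq> []"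
  shows "\<exists>ys. successively P ys \<and> ys \<noteq> [] \<and> hd ys = hd xs \<and> last ys = last xs \<and> distinct ys \<and> set ys \<subseteq> set xs"
  using assms
proof (induction "length xs" arbitrary: xs rule: less_induct)
  case less
  show ?case
  proof (cases "distinct xs")
    case False
    then obtain as bs cs y where xs: "xs = as @ [y] @ bs @ [y] @ cs" using not_distinct_decomp by blast
    let ?xs = "as @ [y] @ cs"
    have s1: "successively P ?xs"
      using less.prems(1) successively_split[of P as y "bs @ y # cs"] successively_split[of P "y # bs" y cs]
        successively_split[of P as y cs] by (simp add: xs)
    have s2: "length ?xs < length xs" "?xs \<noteq> []" by (auto simp: xs)
    have s3: "hd ?xs = hd xs" "last ?xs = last xs" by (auto simp: xs hd_append)
    have s4: "set ?xs \<subseteq> set xs" by (auto simp: xs)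
    from less.hyps[OF s2(1) s1 s2(2)] show ?thesis using s3 s4 by (metis subset_trans)
  qed (use less.prems in blast)
qed

text \<open>2-connectedness enters as reachability that avoids a vertex. As \<open>z\<close> ranges
  over the whole type, ordinary connectedness is included. Being nonbipartite is the absence of a
  proper 2-colouring.\<close>

locale nonbipartite_2_connected =
  fixes V :: "'a set" and R :: "'a \<Rightarrow> 'a \<Rightarrow> bool"
  assumes finite_V: "finite V" and card_V: "3 \<le> card V"
    and sym: "R u v \<Longrightarrow> R v u" and irrefl: "\<not> R u u" and in_V: "R u v \<Longrightarrow> u \<in> V"
    and no_cut_vertex: "\<lbrakk>s \<in> V; t \<in> V; s \<noteq> z; t \<noteq> z\<rbrakk> \<Longrightarrow> (\<lambda>x y. R x y \<and> x \<noteq> z \<and> y \<noteq> z)\<^sup>*\<^sup>* s t"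
    and nonbipartite: "\<not> (\<exists>c :: 'a \<Rightarrow> bool. \<forall>u v. R u v \<longrightarrow> c u \<noteq> c v)"
begin

lemma in_V': "R u v \<Longrightarrow> v \<in> V"
  using in_V sym by blast

lemma connected: assumes "s \<in> V" "t \<in> V" shows "R\<^sup>*\<^sup>* s t"
proof -
  have "card {s, t} < card V" using card_V card_insert_le_m1[of 2 "{t}" s] by (auto simp: card_insert_if)
  then obtain z where "z \<notin> {s, t}" by (metis card_mono finite.emptyI finite.insertI leD subsetI)
  then have "(\<lambda>x y. R x y \<and> x \<noteq> z \<and> y \<noteq> z)\<^sup>*\<^sup>* s t" using no_cut_vertex assms by auto
  then show ?thesis by (rule rtranclp_mono[THEN predicate2D, rotated]) auto
qed

definition closed_walk :: "'a list \<Rightarrow> bool" where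
  "closed_walk xs \<longleftrightarrow> xs \<noteq> [] \<and> successively R (xs @ [hd xs])"

definition cycle_list :: "'a list \<Rightarrow> bool" where
  "cycle_list xs \<longleftrightarrow> 3 \<le> length xs \<and> distinct xs \<and> successively R (xs @ [hd xs])"

section \<open>Existence of odd cycles\<close>

text \<open>A repeated vertex splits the walk into two shorter closed walks, one of which is again
  odd. Length 1 would be a loop.\<close>

lemma odd_closed_walk_imp_cycle:
  assumes "closed_walk xs" "odd (length xs)"
  shows "\<exists>ys. cycle_list ys \<and> odd (length ys)"
  using assms
proof (induction "length xs" arbitrary: xs rule: less_induct)
  case less
  show ?case
  proof (cases "distinct xs")
    case True
    have "length xs \<noteq> 1"
    proof
      assume "length xs = 1"
      then obtain x where "xs = [x]" by (cases xs) auto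
      then show False using less.prems irrefl by (auto simp: closed_walk_def)
    qed
    then have "3 \<le> length xs" using less.prems(2) by (cases xs; cases "tl xs"; auto simp: Suc_le_eq)
    then show ?thesis using less.prems True by (auto simp: cycle_list_def closed_walk_def)
  next
    case False
    then obtain as bs cs y where xs: "xs = as @ [y] @ bs @ [y] @ cs" using not_distinct_decomp by blast
    have s: "successively R (as @ y # bs @ y # cs @ [hd (as @ [y])])"
      using less.prems(1) by (cases as) (auto simp: closed_walk_def xs)
    have c1: "closed_walk (y # bs)" and c2: "closed_walk (as @ [y] @ cs)"
      using s successively_split[of R as y "bs @ y # cs @ [hd (as @ [y])]"]
        successively_split[of R "y # bs" y "cs @ [hd (as @ [y])]"] successively_split[of R as y "cs @ [hd (as @ [y])]"]
      by (auto simp: closed_walk_def hd_append)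
    have len: "length xs = length (y # bs) + length (as @ [y] @ cs)" by (simp add: xs)
    show ?thesis
    proof (cases "odd (length (y # bs))")
      case True
      show ?thesis by (rule less.hyps[OF _ c1 True]) (simp add: xs)
    next
      case False
      then have o: "odd (length (as @ [y] @ cs))" using less.prems(2) len by simp
      show ?thesis by (rule less.hyps[OF _ c2 o]) (simp add: xs)
    qed
  qed
qed

lemma walk_exists:
  assumes "R\<^sup>*\<^sup>* s t"
  shows "\<exists>xs. successively R xs \<and> xs \<noteq> [] \<and> hd xs = s \<and> last xs = t"
  using assms
proof (induction rule: rtranclp_induct)
  case base
  then show ?case by (intro exI[of _ "[s]"]) auto
next
  case (step y z)
  then obtain xs where "successively R xs" "xs \<noteq> []" "hd xs = s" "last xs = y" by blast
  then show ?case using step by (intro exI[of _ "xs @ [z]"]) (auto simp: successively_append_iff)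
qed

text \<open>Without odd cycles the parity of a walk from \<open>r\<close> depends only on its
  endpoint and changes along every edge, which gives a proper 2-colouring.\<close>

lemma odd_cycle_exists: "\<exists>xs. cycle_list xs \<and> odd (length xs)"
proof (rule ccontr)
  assume no: "\<not> ?thesis"
  obtain r where r: "r \<in> V" using card_V by (cases "V = {}") auto
  define walk where "walk v xs \<longleftrightarrow> successively R xs \<and> xs \<noteq> [] \<and> hd xs = r \<and> last xs = v" for v xs
  have parity: "even (length p) \<noteq> even (length q)" if "walk u p" "walk v q" "R u v" for u v p q
  proof
    assume eq: "even (length p) = even (length q)"
    from that obtain q' where q: "q = r # q'" by (cases q) (auto simp: walk_def)
    have "successively R (rev q)" using that sym by (intro successively_symp_rev) (auto simp: walk_def)
    \<comment> \<open>Walking to \<open>u\<close>, across to \<open>v\<close> and back closes up at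
      \<open>r\<close>; the second copy of \<open>r\<close> is dropped, which makes the length
      odd.\<close>
    then have "successively R (p @ rev q)"
      using that by (auto simp: walk_def successively_append_iff hd_rev)
    then have "closed_walk (p @ rev q')"
      using that(1) q by (auto simp: closed_walk_def walk_def)
    moreover have "odd (length (p @ rev q'))" using eq q by auto
    ultimately show False using odd_closed_walk_imp_cycle no by blast
  qed
  define c where "c v \<longleftrightarrow> (\<exists>p. walk v p \<and> even (length p))" for v
  have ex: "\<exists>p. walk v p" if "v \<in> V" for v
    using walk_exists[OF connected[OF r that]] by (auto simp: walk_def)
  have "c u \<noteq> c v" if uv: "R u v" for u v
  proof -
    obtain p q where "walk u p" "walk v q" using ex in_V[OF uv] in_V'[OF uv] by blast
    then show ?thesis using parity uv unfolding c_def by blast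
  qed
  then show False using nonbipartite by blast
qed

lemma cycle_rotate:
  assumes "cycle_list xs" "a \<in> set xs"
  shows "\<exists>ys. cycle_list (a # ys) \<and> set (a # ys) = set xs \<and> length (a # ys) = length xs"
proof -
  from assms(2) obtain us vs where xs: "xs = us @ a # vs" by (auto simp: in_set_conv_decomp)
  have "cycle_list (a # vs @ us)"
  proof (cases us)
    case Nil
    then show ?thesis using assms(1) by (simp add: xs)
  next
    case (Cons h t)
    then show ?thesis using assms(1) successively_split[of R us a "vs @ [h]"] successively_split[of R "a # vs" h "t @ [a]"]
      by (auto simp: xs cycle_list_def)
  qed
  then show ?thesis by (intro exI[of _ "vs @ us"]) (auto simp: xs)
qed

section \<open>Ears of cycles\<close>

text \<open>Since \<open>a\<close> is not a cut vertex, a walk from \<open>w\<close> reaches another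
  vertex of the cycle while avoiding \<open>a\<close>. It is stopped at its first vertex on the
  cycle and then shortened to a path.\<close>

lemma ear_exists:
  assumes xs: "cycle_list xs" "a \<in> set xs" "R a w" "w \<notin> set xs"
  shows "\<exists>ws b. w \<in> set ws \<and> b \<in> set xs \<and> b \<noteq> a \<and> distinct ws \<and> set ws \<inter> set xs = {} \<and> successively R (a # ws @ [b])"
proof -
  have "card (set xs) \<ge> 3" using xs by (simp add: cycle_list_def distinct_card)
  then have "\<not> set xs \<subseteq> {a}" using card_mono[of "{a}" "set xs"] by auto
  then obtain t where t: "t \<in> set xs" "t \<noteq> a" by auto
  have wa: "w \<noteq> a" using xs by auto
  have "set xs \<subseteq> V"
  proof
    fix x assume "x \<in> set xs"
    from cycle_rotate[OF xs(1) this] obtain ys where "cycle_list (x # ys)" by blast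
    then show "x \<in> V" by (cases ys) (auto simp: cycle_list_def intro: in_V)
  qed
  then have "(\<lambda>x y. R x y \<and> x \<noteq> a \<and> y \<noteq> a)\<^sup>*\<^sup>* w t"
    using no_cut_vertex[of w t a] t wa in_V'[OF xs(3)] by auto
  then have "w \<notin> set xs \<longrightarrow> (\<exists>zs b. successively R (w # zs) \<and> R (last (w # zs)) b \<and> set (w # zs) \<inter> set xs = {} \<and> b \<in> set xs \<and> b \<noteq> a)"
  proof (induction rule: converse_rtranclp_induct)
    case base
    then show ?case using t by simp
  next
    case (step y y')
    show ?case
    proof
      assume y: "y \<notin> set xs"
      show "\<exists>zs b. successively R (y # zs) \<and> R (last (y # zs)) b \<and> set (y # zs) \<inter> set xs = {} \<and> b \<in> set xs \<and> b \<noteq> a"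
      proof (cases "y' \<in> set xs")
        case True
        then show ?thesis using step(1) y by (intro exI[of _ "[]"] exI[of _ y']) auto
      next
        case False
        with step(3) obtain zs b where "successively R (y' # zs)" "R (last (y' # zs)) b" "set (y' # zs) \<inter> set xs = {}" "b \<in> set xs" "b \<noteq> a"
          by blast
        then show ?thesis using step(1) y by (intro exI[of _ "y' # zs"] exI[of _ b]) auto
      qed
    qed
  qed
  then obtain zs b where z: "successively R (w # zs)" "R (last (w # zs)) b" "set (w # zs) \<inter> set xs = {}" "b \<in> set xs" "b \<noteq> a"
    using xs(4) by blast
  from walk_to_path[OF z(1)] obtain ws where ws: "successively R ws" "ws \<noteq> []" "hd ws = w" "last ws = last (w # zs)" "distinct ws" "set ws \<subseteq> set (w # zs)"
    by auto
  have "successively R (a # ws @ [b])"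
    using ws z xs(3) by (auto simp: successively_append_iff successively_Cons)
  moreover have "w \<in> set ws" using ws by (metis hd_in_set)
  moreover have "set ws \<inter> set xs = {}" using ws(6) z(3) by blast
  ultimately show ?thesis using ws(5) z(4,5) by blast
qed

text \<open>The ends of the ear cut the cycle into two arcs; one is reversed, so that all three
  paths run from \<open>a\<close> to \<open>b\<close>.\<close>

lemma cycle_with_ear:
  assumes xs: "cycle_list xs" "a \<in> set xs" "R a w" "w \<notin> set xs"
  obtains ws b P Q where "w \<in> set ws" "successively R (a # ws @ [b])" "successively R (a # P @ [b])" "successively R (a # Q @ [b])"
    "distinct (a # b # ws @ P @ Q)" "set xs = set (a # b # P @ Q)" "length xs = length P + length Q + 2"
proof -
  from ear_exists[OF xs] obtain ws b where ear: "w \<in> set ws" "b \<in> set xs" "b \<noteq> a" "distinct ws" "set ws \<inter> set xs = {}" "successively R (a # ws @ [b])"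
    by blast
  from cycle_rotate[OF xs(1,2)] obtain ys where ys: "cycle_list (a # ys)" "set (a # ys) = set xs" "length (a # ys) = length xs" by blast
  have "b \<in> set ys" using ear(2,3) ys(2) by auto
  then obtain P Q where y: "ys = P @ b # Q" by (auto simp: in_set_conv_decomp)
  have "successively R ((a # P) @ b # Q @ [a])" using ys(1) by (simp add: cycle_list_def y)
  then have s: "successively R (a # P @ [b])" "successively R (b # Q @ [a])"
    unfolding successively_split[of R "a # P" b "Q @ [a]"] by auto
  have "successively R (rev (b # Q @ [a]))" by (rule successively_symp_rev[OF sym s(2)])
  then have s3: "successively R (a # rev Q @ [b])" by simp
  have d: "distinct (a # P @ b # Q)" using ys(1) by (simp add: cycle_list_def y)
  show thesis
    by (rule that[OF ear(1,6) s(1) s3]) (use d ear ys y in auto)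
qed

lemma cycle_of_two_paths:
  assumes "successively R (a # P @ [b])" "successively R (a # Q @ [b])" "distinct (a # b # P @ Q)" "P \<noteq> [] \<or> Q \<noteq> []"
  shows "cycle_list (a # P @ b # rev Q)"
proof -
  have "successively R (rev (a # Q @ [b]))" by (rule successively_symp_rev[OF sym assms(2)])
  then have "successively R ((a # P) @ b # rev Q @ [a])"
    unfolding successively_split[of R "a # P" b "rev Q @ [a]"] using assms(1) by simp
  then show ?thesis using assms(3,4) by (cases P; cases Q) (auto simp: cycle_list_def)
qed

text \<open>Starting from any odd cycle, the property spreads along edges. If \<open>w\<close> is
  off the cycle, the ear through \<open>w\<close> is joined to either arc; the arcs have different
  parities, so one of the two new cycles is odd.\<close>

lemma odd_cycle_through:
  assumes "u \<in> V"
  shows "\<exists>xs. cycle_list xs \<and> odd (length xs) \<and> u \<in> set xs"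
proof -
  obtain xs where xs: "cycle_list xs" "odd (length xs)" using odd_cycle_exists by blast
  then obtain x where x: "x \<in> set xs" by (cases xs) (auto simp: cycle_list_def)
  have "x \<in> V"
  proof -
    from cycle_rotate[OF xs(1) x] obtain ys where "cycle_list (x # ys)" by blast
    then show "x \<in> V" by (cases ys) (auto simp: cycle_list_def intro: in_V)
  qed
  from connected[OF this assms] show ?thesis
  proof (induction rule: rtranclp_induct)
    case base
    then show ?case using xs x by blast
  next
    case (step a w)
    then obtain xs where xs: "cycle_list xs" "odd (length xs)" "a \<in> set xs" by blast
    show ?case
    proof (cases "w \<in> set xs")
      case True
      then show ?thesis using xs by blast
    next
      case False
      obtain ws b P Q where e: "w \<in> set ws" "successively R (a # ws @ [b])" "successively R (a # P @ [b])" "successively R (a # Q @ [b])"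
        "distinct (a # b # ws @ P @ Q)" "length xs = length P + length Q + 2"
        using cycle_with_ear[OF xs(1,3) step(2) False] by metis
      have w0: "ws \<noteq> []" using e(1) by auto
      have "cycle_list (a # ws @ b # rev P)" "cycle_list (a # ws @ b # rev Q)"
        using e w0 by (auto intro!: cycle_of_two_paths)
      moreover have "odd (length (a # ws @ b # rev P)) \<or> odd (length (a # ws @ b # rev Q))"
        using e(6) xs(2) by auto
      ultimately show ?thesis using e(1) by (metis UnCI list.set_intros(2) set_append)
    qed
  qed
qed

text \<open>The lists contain the inner vertices of the three paths. By the parity condition the cycles through \<open>L\<close>
  are odd.\<close>

definition theta :: "'a \<Rightarrow> 'a \<Rightarrow> 'a list \<Rightarrow> 'a list \<Rightarrow> 'a list \<Rightarrow> bool" where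
  "theta a b A B L \<longleftrightarrow> distinct (a # b # A @ B @ L) \<and>
    successively R (a # A @ [b]) \<and> successively R (a # B @ [b]) \<and> successively R (a # L @ [b]) \<and>
    A \<noteq> [] \<and> B \<noteq> [] \<and> even (length A + length B) \<and> odd (length A + length L)"

lemma walk_subset_V:
  assumes "successively R xs" "length xs \<ge> 2" shows "set xs \<subseteq> V"
  using assms
proof (induction xs rule: induct_list012)
  case (3 x y zs)
  then show ?case using in_V in_V' by (cases zs) auto
qed auto

text \<open>On a longest odd cycle through \<open>u\<close> that is not Hamiltonian, an ear with an
  inner vertex serves as \<open>A\<close>, the arc of the same parity as \<open>B\<close> and the
  other as \<open>L\<close>. So \<open>u\<close> lies on \<open>B\<close> or \<open>L\<close>, ends
  included, as the insertion of values requires.\<close>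

lemma hamiltonian_or_theta:
  assumes "u \<in> V"
  shows "(\<exists>xs. cycle_list xs \<and> odd (length xs) \<and> set xs = V) \<or> (\<exists>a b A B L. theta a b A B L \<and> u \<in> set (a # b # B @ L))"
proof -
  let ?P = "\<lambda>xs. cycle_list xs \<and> odd (length xs) \<and> u \<in> set xs"
  have sub: "set xs \<subseteq> V" if "cycle_list xs" for xs
    using walk_subset_V[of "xs @ [hd xs]"] that by (auto simp: cycle_list_def)
  have "length xs < Suc (card V)" if "?P xs" for xs
    using that sub[of xs] card_mono[OF finite_V sub[of xs]] by (auto simp: cycle_list_def distinct_card less_Suc_eq_le)
  then obtain xs where xs: "?P xs" and max: "\<And>ys. ?P ys \<Longrightarrow> length ys \<le> length xs"
    using odd_cycle_through[OF assms] ex_has_greatest_nat[of ?P _ length "Suc (card V)"] by metis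
  show ?thesis
  proof (cases "set xs = V")
    case True
    then show ?thesis using xs by blast
  next
    case False
    then obtain v where v: "v \<in> V" "v \<notin> set xs" using sub xs by blast
    have "R\<^sup>*\<^sup>* u v" using connected assms v by blast
    then have "u \<in> set xs \<Longrightarrow> v \<notin> set xs \<Longrightarrow> \<exists>a w. a \<in> set xs \<and> w \<notin> set xs \<and> R a w"
      by (induction rule: rtranclp_induct) blast+
    then obtain a w where aw: "a \<in> set xs" "w \<notin> set xs" "R a w" using xs v by blast
    obtain ws b P Q where e: "w \<in> set ws" "successively R (a # ws @ [b])" "successively R (a # P @ [b])" "successively R (a # Q @ [b])"
        "distinct (a # b # ws @ P @ Q)" "set xs = set (a # b # P @ Q)" "length xs = length P + length Q + 2"
      using xs cycle_with_ear[of xs a w] aw by metis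
    have w0: "ws \<noteq> []" using e(1) by auto
    have u: "u \<in> set (a # b # P @ Q)" using xs e(6) by simp
    have longer: "theta a b ws B L" if BL: "(B = P \<and> L = Q) \<or> (B = Q \<and> L = P)" and ev: "even (length ws + length B)" for B L
    proof -
      have odd: "odd (length B + length L)" using BL e(7) xs by auto
      \<comment> \<open>If \<open>B\<close> were a single edge, replacing it by the ear would give a
        longer odd cycle, which still contains \<open>u\<close>.\<close>
      have "B \<noteq> []"
      proof
        assume B: "B = []"
        have u': "u \<in> set (a # ws @ b # rev L)" using u BL B by auto
        have "cycle_list (a # ws @ b # rev L)" using e BL w0 by (intro cycle_of_two_paths) auto
        moreover have "odd (length (a # ws @ b # rev L))" using odd ev B by auto
        ultimately have "length (a # ws @ b # rev L) \<le> length xs" using max u' by blast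
        then show False using e(7) BL B w0 by auto
      qed
      then show ?thesis using e BL ev odd w0 unfolding theta_def by auto
    qed
    have "even (length ws + length P) \<or> even (length ws + length Q)" using e(7) xs by auto
    then have "theta a b ws P Q \<or> theta a b ws Q P" using longer by blast
    moreover have "u \<in> set (a # b # Q @ P)" using u by auto
    ultimately show ?thesis using u by blast
  qed
qed

end

section \<open>Eigenfunctions of the signless Laplacian\<close>

lemma eigenvalue_enum:
  fixes f :: "'a \<Rightarrow> 'a \<Rightarrow> 'f :: field"
  assumes e: "bij_betw e {..<n} V"
  shows "eigenvalue (mat n n (\<lambda>(i, j). f (e i) (e j))) k \<longleftrightarrow>
    (\<exists>x. (\<exists>v\<in>V. x v \<noteq> 0) \<and> (\<forall>v\<in>V. (\<Sum>w\<in>V. f v w * x w) = k * x v))"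
proof -
  let ?M = "mat n n (\<lambda>(i, j). f (e i) (e j))"
  have inj: "inj_on e {..<n}" and V: "V = e ` {..<n}" using e by (auto simp: bij_betw_def)
  have mul: "(?M *\<^sub>v u) $ i = (\<Sum>w\<in>V. f (e i) w * x w)"
    if "i < n" "u \<in> carrier_vec n" "\<And>j. j < n \<Longrightarrow> x (e j) = u $ j" for u x i
  proof -
    have "(?M *\<^sub>v u) $ i = (\<Sum>j<n. f (e i) (e j) * u $ j)"
      using that by (auto simp: scalar_prod_def lessThan_atLeast0)
    also have "\<dots> = (\<Sum>j<n. f (e i) (e j) * x (e j))" using that by (intro sum.cong) auto
    also have "\<dots> = (\<Sum>w\<in>V. f (e i) w * x w)" unfolding V by (simp add: sum.reindex[OF inj])
    finally show ?thesis .
  qed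
  show ?thesis
  proof
    assume "eigenvalue ?M k"
    then obtain u where u: "u \<in> carrier_vec n" "u \<noteq> 0\<^sub>v n" "?M *\<^sub>v u = k \<cdot>\<^sub>v u"
      by (auto simp: eigenvalue_def eigenvector_def)
    define x where "x v = u $ the_inv_into {..<n} e v" for v
    have x: "x (e j) = u $ j" if "j < n" for j using that by (simp add: x_def the_inv_into_f_f[OF inj])
    from u obtain i where i: "i < n" "u $ i \<noteq> 0" by (metis carrier_vecD eq_vecI index_zero_vec)
    have "\<exists>v\<in>V. x v \<noteq> 0" using i x by (auto simp: V)
    moreover have "\<forall>v\<in>V. (\<Sum>w\<in>V. f v w * x w) = k * x v"
    proof
      fix v assume "v \<in> V"
      then obtain i where i: "i < n" "v = e i" by (auto simp: V)
      have "(\<Sum>w\<in>V. f v w * x w) = (?M *\<^sub>v u) $ i" using mul[OF i(1) u(1) x] i by simp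
      also have "\<dots> = k * u $ i" using u i by simp
      finally show "(\<Sum>w\<in>V. f v w * x w) = k * x v" using x i by simp
    qed
    ultimately show "\<exists>x. (\<exists>v\<in>V. x v \<noteq> 0) \<and> (\<forall>v\<in>V. (\<Sum>w\<in>V. f v w * x w) = k * x v)" by blast
  next
    assume "\<exists>x. (\<exists>v\<in>V. x v \<noteq> 0) \<and> (\<forall>v\<in>V. (\<Sum>w\<in>V. f v w * x w) = k * x v)"
    then obtain x v where x: "v \<in> V" "x v \<noteq> 0" "\<And>v. v \<in> V \<Longrightarrow> (\<Sum>w\<in>V. f v w * x w) = k * x v" by blast
    define u where "u = vec n (\<lambda>i. x (e i))"
    have u: "u \<in> carrier_vec n" by (simp add: u_def)
    obtain i where i: "i < n" "v = e i" using x(1) by (auto simp: V)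
    have "u $ i \<noteq> 0" using i x by (simp add: u_def)
    then have "u \<noteq> 0\<^sub>v n" using i by auto
    moreover have "?M *\<^sub>v u = k \<cdot>\<^sub>v u"
    proof (rule eq_vecI)
      fix i assume "i < dim_vec (k \<cdot>\<^sub>v u)"
      then have i: "i < n" by (simp add: u_def)
      show "(?M *\<^sub>v u) $ i = (k \<cdot>\<^sub>v u) $ i"
        using mul[OF i u, of x] x(3)[of "e i"] i by (auto simp: u_def V)
    qed (simp add: u_def)
    ultimately have "eigenvector ?M u k" using u by (simp add: eigenvector_def)
    then show "eigenvalue ?M k" unfolding eigenvalue_def by blast
  qed
qed

text \<open>The term \<open>x v\<close> is summed once per neighbour, so the sum is the entry of Q x
  at \<open>v\<close>. The field is arbitrary because complex eigenfunctions occur in the existence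
  proof.\<close>

definition Q_eigenfunction :: "'a pair_pre_digraph \<Rightarrow> 'f :: field \<Rightarrow> ('a \<Rightarrow> 'f) \<Rightarrow> bool" where
  "Q_eigenfunction G k x \<longleftrightarrow> (\<exists>v\<in>pverts G. x v \<noteq> 0) \<and>
    (\<forall>v\<in>pverts G. (\<Sum>w | (v, w) \<in> parcs G. x v + x w) = k * x v)"

lemma pair_graph_facts:
  assumes "pair_graph G"
  shows "finite (pverts G)" "finite (parcs G)" "(u, v) \<in> parcs G \<Longrightarrow> u \<in> pverts G" "(u, v) \<in> parcs G \<Longrightarrow> v \<in> pverts G"
    "(u, v) \<in> parcs G \<Longrightarrow> (v, u) \<in> parcs G" "(u, u) \<notin> parcs G"
proof -
  interpret pair_graph G by fact
  show "finite (pverts G)" "finite (parcs G)" by simp_all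
  show "(u, v) \<in> parcs G \<Longrightarrow> u \<in> pverts G" "(u, v) \<in> parcs G \<Longrightarrow> v \<in> pverts G" by (auto dest: wellformed')
  show "(u, v) \<in> parcs G \<Longrightarrow> (v, u) \<in> parcs G" using arcs_symmetric by blast
  show "(u, u) \<notin> parcs G" using pair_no_loops by force
qed

lemma arcs_as_Sigma:
  assumes "pair_graph G"
  shows "parcs G = Sigma (pverts G) (\<lambda>v. {w. (v, w) \<in> parcs G})" "finite {w. (v, w) \<in> parcs G}"
proof -
  show "parcs G = Sigma (pverts G) (\<lambda>v. {w. (v, w) \<in> parcs G})"
    using pair_graph_facts(3)[OF assms] by auto
  show "finite {w. (v, w) \<in> parcs G}"
    by (rule finite_subset[OF _ pair_graph_facts(1)[OF assms]]) (auto dest: pair_graph_facts(4)[OF assms])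
qed

lemma sum_arcs_swap:
  assumes "pair_graph G"
  shows "(\<Sum>(v, w)\<in>parcs G. f v w) = (\<Sum>(v, w)\<in>parcs G. f w v)"
  by (rule sum.reindex_bij_witness[of _ prod.swap prod.swap]) (auto dest: pair_graph_facts(5)[OF assms])

lemma out_degree_pair:
  "out_degree (with_proj G) v = card {w. (v, w) \<in> parcs G}"
proof -
  have "out_arcs (with_proj G) v = Pair v ` {w. (v, w) \<in> parcs G}" by (auto simp: out_arcs_def)
  then show ?thesis by (simp add: out_degree_def card_image inj_on_def)
qed

text \<open>The map \<open>h\<close> is the embedding into the complex numbers when the existence of
  an eigenvalue is shown, and the identity when the real spectrum is described.\<close>

lemma eigenvalue_signless_laplacian:
  fixes h :: "real \<Rightarrow> 'f :: field"
  assumes G: "pair_graph G" and h: "h 0 = 0" "h 1 = 1" "\<And>a b. h (a + b) = h a + h b" "\<And>m. h (real m) = of_nat m"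
  shows "eigenvalue (map_mat h (signless_laplacian (with_proj G))) k \<longleftrightarrow> (\<exists>x. Q_eigenfunction G k x)"
proof -
  let ?V = "pverts G" let ?n = "card ?V" let ?e = "from_nat_into ?V"
  have fin: "finite ?V" using pair_graph_facts[OF G] by simp
  have e: "bij_betw ?e {..<?n} ?V" using bij_betw_from_nat_into_finite[OF fin] .
  define f where "f v w = (if v = w then of_nat (card {w. (v, w) \<in> parcs G}) else 0) + (if (v, w) \<in> parcs G then 1 else (0 :: 'f))" for v w
  have inj: "?e i = ?e j \<longleftrightarrow> i = j" if "i < ?n" "j < ?n" for i j
    using e that by (auto simp: bij_betw_def inj_on_def)
  have M: "map_mat h (signless_laplacian (with_proj G)) = mat ?n ?n (\<lambda>(i, j). f (?e i) (?e j))"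
    by (rule eq_matI) (auto simp: signless_laplacian_def degree_matrix_def adjacency_matrix_def Let_def f_def inj h out_degree_pair)
  have sum: "(\<Sum>w\<in>?V. f v w * x w) = (\<Sum>w | (v, w) \<in> parcs G. x v + x w)" if "v \<in> ?V" for v x
  proof -
    have "(\<Sum>w\<in>?V. f v w * x w) = (\<Sum>w\<in>?V. if v = w then of_nat (card {w. (v, w) \<in> parcs G}) * x w else 0) + (\<Sum>w\<in>?V. if (v, w) \<in> parcs G then x w else 0)"
      unfolding sum.distrib[symmetric] by (intro sum.cong) (auto simp: f_def algebra_simps)
    also have "(\<Sum>w\<in>?V. if v = w then of_nat (card {w. (v, w) \<in> parcs G}) * x w else 0) = of_nat (card {w. (v, w) \<in> parcs G}) * x v"
      using fin that by simp
    also have "(\<Sum>w\<in>?V. if (v, w) \<in> parcs G then x w else 0) = (\<Sum>w | (v, w) \<in> parcs G. x w)"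
      using fin by (subst sum.inter_filter[symmetric]) (auto intro!: sum.cong dest: pair_graph_facts(4)[OF G])
    finally show ?thesis by (simp add: sum.distrib)
  qed
  show ?thesis unfolding M eigenvalue_enum[OF e] Q_eigenfunction_def using sum by auto
qed

text \<open>The quadratic form of Q at its eigenfunction; the factor 2 is there because every edge
  consists of two arcs.\<close>

lemma Q_eigenfunction_energy:
  assumes G: "pair_graph G" and x: "Q_eigenfunction G k x"
  shows "(\<Sum>(v, w)\<in>parcs G. (x v + x w)\<^sup>2) = 2 * k * (\<Sum>v\<in>pverts G. (x v)\<^sup>2)"
proof -
  have "(\<Sum>(v, w)\<in>parcs G. (x v + x w)\<^sup>2) = (\<Sum>(v, w)\<in>parcs G. x v * (x v + x w)) + (\<Sum>(v, w)\<in>parcs G. x w * (x w + x v))"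
    unfolding sum.distrib[symmetric] by (intro sum.cong) (auto simp: power2_eq_square algebra_simps)
  also have "(\<Sum>(v, w)\<in>parcs G. x w * (x w + x v)) = (\<Sum>(v, w)\<in>parcs G. x v * (x v + x w))"
    by (rule sum_arcs_swap[OF G, of "\<lambda>v w. x w * (x w + x v)"])
  also have "(\<Sum>(v, w)\<in>parcs G. x v * (x v + x w)) = (\<Sum>v\<in>pverts G. \<Sum>w | (v, w) \<in> parcs G. x v * (x v + x w))"
    by (subst arcs_as_Sigma(1)[OF G], subst sum.Sigma) (auto simp: pair_graph_facts[OF G] arcs_as_Sigma(2)[OF G])
  also have "\<dots> = (\<Sum>v\<in>pverts G. k * (x v)\<^sup>2)"
    using x by (intro sum.cong) (auto simp: Q_eigenfunction_def power2_eq_square simp flip: sum_distrib_left)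
  finally show ?thesis by (simp add: sum_distrib_left mult.assoc)
qed

text \<open>A complex eigenvalue exists, and symmetry makes it real. The real and imaginary parts of
  its eigenfunction then satisfy the same equation, and one of them is nonzero.\<close>

lemma real_Q_eigenfunction_exists:
  assumes G: "pair_graph G" and ne: "pverts G \<noteq> {}"
  shows "\<exists>k :: real. \<exists>x. Q_eigenfunction G k x"
proof -
  have n: "card (pverts G) > 0" using ne pair_graph_facts(1)[OF G] by (simp add: card_gt_0_iff)
  let ?M = "map_mat complex_of_real (signless_laplacian (with_proj G))"
  have "?M \<in> carrier_mat (card (pverts G)) (card (pverts G))"
    by (auto simp: signless_laplacian_def degree_matrix_def adjacency_matrix_def Let_def)
  from spectrum_non_empty[OF this n] obtain k where "eigenvalue ?M k" by (auto simp: spectrum_def)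
  then obtain z where z: "Q_eigenfunction G k z"
    using eigenvalue_signless_laplacian[OF G, of complex_of_real] by auto
  define S where "S = (\<Sum>(v, w)\<in>parcs G. cnj (z v) * (z v + z w))"
  have "S = (\<Sum>v\<in>pverts G. \<Sum>w | (v, w) \<in> parcs G. cnj (z v) * (z v + z w))"
    unfolding S_def by (subst arcs_as_Sigma(1)[OF G], subst sum.Sigma) (auto simp: pair_graph_facts[OF G] arcs_as_Sigma(2)[OF G])
  also have "\<dots> = (\<Sum>v\<in>pverts G. k * of_real ((cmod (z v))\<^sup>2))"
  proof (rule sum.cong)
    fix v assume "v \<in> pverts G"
    then have "(\<Sum>w | (v, w) \<in> parcs G. z v + z w) = k * z v" using z by (simp add: Q_eigenfunction_def)
    then show "(\<Sum>w | (v, w) \<in> parcs G. cnj (z v) * (z v + z w)) = k * of_real ((cmod (z v))\<^sup>2)"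
      unfolding sum_distrib_left[symmetric] complex_norm_square by (simp only: mult_ac)
  qed simp
  finally have S: "S = k * of_real (\<Sum>v\<in>pverts G. (cmod (z v))\<^sup>2)" by (simp add: sum_distrib_left)
  \<comment> \<open>\<open>S\<close> is the Hermitian form of Q at \<open>z\<close>. Reversing all
    arcs shows that it equals its conjugate.\<close>
  have "cnj S = (\<Sum>(v, w)\<in>parcs G. z v * cnj (z v)) + (\<Sum>(v, w)\<in>parcs G. z v * cnj (z w))"
    unfolding S_def cnj_sum sum.distrib[symmetric] by (intro sum.cong) (auto simp: algebra_simps)
  also have "(\<Sum>(v, w)\<in>parcs G. z v * cnj (z w)) = (\<Sum>(v, w)\<in>parcs G. z w * cnj (z v))"
    by (rule sum_arcs_swap[OF G])
  also have "(\<Sum>(v, w)\<in>parcs G. z v * cnj (z v)) + \<dots> = S"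
    unfolding S_def sum.distrib[symmetric] by (intro sum.cong) (auto simp: algebra_simps)
  finally have "Im S = 0" by (simp add: complex_eq_iff)
  moreover have "(\<Sum>v\<in>pverts G. (cmod (z v))\<^sup>2) > 0"
    using z pair_graph_facts(1)[OF G] by (auto simp: Q_eigenfunction_def intro!: sum_pos2)
  ultimately have k: "k = of_real (Re k)" unfolding S by (auto simp: complex_eq_iff)
  obtain v where v: "v \<in> pverts G" "z v \<noteq> 0" using z by (auto simp: Q_eigenfunction_def)
  have eqs: "(\<Sum>w | (v, w) \<in> parcs G. z v + z w) = of_real (Re k) * z v" if "v \<in> pverts G" for v
    using z that k by (auto simp: Q_eigenfunction_def)
  have "(\<Sum>w | (v, w) \<in> parcs G. Re (z v) + Re (z w)) = Re k * Re (z v)"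
    "(\<Sum>w | (v, w) \<in> parcs G. Im (z v) + Im (z w)) = Re k * Im (z v)" if "v \<in> pverts G" for v
    using arg_cong[OF eqs[OF that], of Re] arg_cong[OF eqs[OF that], of Im] by simp_all
  moreover have "Re (z v) \<noteq> 0 \<or> Im (z v) \<noteq> 0" using v by (auto simp: complex_eq_iff)
  ultimately have "Q_eigenfunction G (Re k) (\<lambda>v. Re (z v)) \<or> Q_eigenfunction G (Re k) (\<lambda>v. Im (z v))"
    using v(1) unfolding Q_eigenfunction_def by blast
  then show ?thesis by blast
qed

lemma spectrum_signless_laplacian:
  assumes G: "pair_graph G"
  shows "spectrum (signless_laplacian (with_proj G)) = {k. \<exists>x. Q_eigenfunction G k x}"
proof -
  have "map_mat (\<lambda>x. x) (signless_laplacian (with_proj G)) = signless_laplacian (with_proj G)"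
    by (rule eq_matI) auto
  then show ?thesis using eigenvalue_signless_laplacian[OF G, of "\<lambda>x. x"] by (auto simp: spectrum_def)
qed

lemma finite_spectrum_signless_laplacian:
  "finite (spectrum (signless_laplacian (with_proj G)))"
  by (rule card_finite_spectrum(1)[of _ "card (pverts G)"])
    (auto simp: signless_laplacian_def degree_matrix_def adjacency_matrix_def Let_def)

lemma least_q_eigenfunction:
  assumes G: "pair_graph G" and ne: "pverts G \<noteq> {}"
  shows "\<exists>x. Q_eigenfunction G (least_q (with_proj G)) x"
proof -
  have "spectrum (signless_laplacian (with_proj G)) \<noteq> {}"
    using real_Q_eigenfunction_exists[OF assms] spectrum_signless_laplacian[OF G] by auto
  from Min_in[OF finite_spectrum_signless_laplacian this] show ?thesis
    unfolding least_q_def by (simp add: spectrum_signless_laplacian[OF G])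
qed

lemma least_q_le:
  assumes G: "pair_graph G" and "Q_eigenfunction G k x"
  shows "least_q (with_proj G) \<le> k"
  unfolding least_q_def
  by (rule Min_le[OF finite_spectrum_signless_laplacian]) (use assms spectrum_signless_laplacian[OF G] in auto)

section \<open>Isomorphisms\<close>

text \<open>An eigenfunction of \<open>H\<close> is pulled back along the isomorphism.\<close>

lemma least_q_iso_le:
  assumes G: "pair_graph G" "pverts G \<noteq> {}" and H: "pair_graph H" and iso: "digraph_iso (with_proj G) (with_proj H)"
  shows "least_q (with_proj G) \<le> least_q (with_proj H)"
proof -
  from iso obtain hom where hom: "pre_digraph.digraph_isomorphism (with_proj G) hom" "with_proj H = app_iso hom (with_proj G)"
    by (auto simp: digraph_iso_def)
  define f where "f = iso_verts hom"
  have inj: "inj_on f (pverts G)" using hom(1) by (auto simp: pre_digraph.digraph_isomorphism_def f_def)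
  have VH: "pverts H = f ` pverts G" using arg_cong[OF hom(2), of verts] by (simp add: f_def)
  have th: "iso_tail hom = fst" "iso_head hom = snd"
    using arg_cong[OF hom(2), of tail] arg_cong[OF hom(2), of head] by simp_all
  \<comment> \<open>Tail and head are the two projections in both graphs, so the map on arcs is
    determined by the map on vertices.\<close>
  have "iso_arcs hom (u, v) = (f u, f v)" if "(u, v) \<in> parcs G" for u v
    using hom(1) that th by (auto simp: pre_digraph.digraph_isomorphism_def f_def prod_eq_iff)
  moreover have "parcs H = iso_arcs hom ` parcs G" using arg_cong[OF hom(2), of arcs] by simp
  ultimately have EH: "parcs H = (\<lambda>(u, v). (f u, f v)) ` parcs G" by (auto intro!: image_cong)
  have "pverts H \<noteq> {}" using VH G(2) by simp
  from least_q_eigenfunction[OF H this] obtain y where y: "Q_eigenfunction H (least_q (with_proj H)) y" by blast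
  have nb: "{w. (f v, w) \<in> parcs H} = f ` {w. (v, w) \<in> parcs G}" if "v \<in> pverts G" for v
    using that inj pair_graph_facts(3)[OF G(1)] unfolding EH by (auto dest: inj_onD)
  have "(\<Sum>w | (v, w) \<in> parcs G. y (f v) + y (f w)) = least_q (with_proj H) * y (f v)" if "v \<in> pverts G" for v
  proof -
    have "inj_on f {w. (v, w) \<in> parcs G}"
      by (rule inj_on_subset[OF inj]) (auto dest: pair_graph_facts(4)[OF G(1)])
    then have "(\<Sum>w | (v, w) \<in> parcs G. y (f v) + y (f w)) = (\<Sum>w | (f v, w) \<in> parcs H. y (f v) + y w)"
      unfolding nb[OF that] by (subst sum.reindex) auto
    then show ?thesis using y that VH by (auto simp: Q_eigenfunction_def)
  qed
  then have "Q_eigenfunction G (least_q (with_proj H)) (\<lambda>v. y (f v))"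
    using y VH by (auto simp: Q_eigenfunction_def)
  then show ?thesis by (rule least_q_le[OF G(1)])
qed

lemma graph_of_edges_simps [simp]:
  "pverts (graph_of_edges n E) = {..<n}" "parcs (graph_of_edges n E) = E \<union> E\<inverse>"
  by (simp_all add: graph_of_edges_def)

lemma pair_graph_graph_of_edges:
  assumes "E \<subseteq> {..<n} \<times> {..<n}" "irrefl E"
  shows "pair_graph (graph_of_edges n E)"
proof -
  have "finite E" using assms(1) finite_subset by blast
  then show ?thesis using assms by unfold_locales (auto simp: symmetric_def sym_def irrefl_def)
qed

text \<open>The list \<open>vs\<close> labels the vertices by their positions; sending a vertex to
  its position is the isomorphism.\<close>

lemma digraph_iso_graph_of_edges:
  fixes G :: "'a pair_pre_digraph"
  assumes G: "pair_graph G" and vs: "length vs = n" "distinct vs" "set vs = pverts G"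
    and E: "E \<subseteq> {..<n} \<times> {..<n}"
    and arcs: "\<And>i j. i < n \<Longrightarrow> j < n \<Longrightarrow> (vs ! i, vs ! j) \<in> parcs G \<longleftrightarrow> (i, j) \<in> E \<union> E\<inverse>"
  shows "digraph_iso (with_proj G) (with_proj (graph_of_edges n E))"
proof -
  have bij: "bij_betw ((!) vs) {..<n} (pverts G)" using vs by (metis bij_betw_nth)
  then have inj: "inj_on ((!) vs) {..<n}" and im: "pverts G = (!) vs ` {..<n}" by (auto simp: bij_betw_def)
  define g where "g = the_inv_into {..<n} ((!) vs)"
  have g: "g (vs ! i) = i" if "i < n" for i using that by (simp add: g_def the_inv_into_f_f[OF inj])
  have gV: "vs ! g v = v" "g v < n" if "v \<in> pverts G" for v
    using that g unfolding im by auto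
  define hom where "hom = \<lparr>iso_verts = g, iso_arcs = map_prod g g, iso_head = snd, iso_tail = fst\<rparr>"
  interpret pair_graph G by fact
  have "pre_digraph.digraph_isomorphism (with_proj G) hom"
    unfolding pre_digraph.digraph_isomorphism_def
  proof (intro conjI)
    show "wf_digraph (with_proj G)" by unfold_locales
    show "inj_on (iso_verts hom) (verts (with_proj G))"
      unfolding hom_def by (auto intro!: inj_on_inverseI[of _ "(!) vs"] gV)
    show "inj_on (iso_arcs hom) (arcs (with_proj G))"
      unfolding hom_def by (auto intro!: inj_on_inverseI[of _ "map_prod ((!) vs) ((!) vs)"] gV dest: pair_graph_facts(3,4)[OF G])
  qed (auto simp: hom_def)
  moreover have "with_proj (graph_of_edges n E) = app_iso hom (with_proj G)"
  proof -
    have "g ` pverts G = {..<n}" using g by (force simp: im image_image)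
    moreover have "map_prod g g ` parcs G = E \<union> E\<inverse>"
    proof (intro equalityI subsetI)
      fix e assume "e \<in> map_prod g g ` parcs G"
      then obtain u v where uv: "(u, v) \<in> parcs G" "e = (g u, g v)" by auto
      then show "e \<in> E \<union> E\<inverse>"
        using arcs[of "g u" "g v"] gV pair_graph_facts(3,4)[OF G] by metis
    next
      fix e assume e: "e \<in> E \<union> E\<inverse>"
      then obtain i j where ij: "e = (i, j)" "i < n" "j < n" using E by (cases e) auto
      then have "(vs ! i, vs ! j) \<in> parcs G" using arcs e by simp
      moreover have "e = map_prod g g (vs ! i, vs ! j)" using ij g by simp
      ultimately show "e \<in> map_prod g g ` parcs G" by blast
    qed
    ultimately show ?thesis by (simp add: app_iso_def hom_def with_proj_def)
  qed
  ultimately show ?thesis unfolding digraph_iso_def by blast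
qed

lemma cycle_edges_subset: "n > 0 \<Longrightarrow> cycle_edges n \<subseteq> {..<n} \<times> {..<n}"
  by (auto simp: cycle_edges_def)

lemma cycle_edges_iff:
  assumes "i < n" "j < n"
  shows "(i, j) \<in> cycle_edges n \<longleftrightarrow> j = Suc i \<or> j = 0 \<and> Suc i = n"
  using assms by (auto simp: cycle_edges_def mod_Suc)

section \<open>Eigenfunctions of the cycle and of Theta\<close>

lemma cos_step: "cos (\<phi> - \<theta>) + cos (\<phi> + \<theta>) = 2 * cos \<theta> * cos \<phi>" for \<phi> \<theta> :: real
  by (simp add: cos_add cos_diff)

lemma sin_step: "sin (\<phi> - \<theta>) + sin (\<phi> + \<theta>) = 2 * cos \<theta> * sin \<phi>" for \<phi> \<theta> :: real
  by (simp add: sin_add sin_diff)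

text \<open>The eigenfunction is the alternating cosine. It closes up at index n because both (-1)^n
  and cos (n \<theta>) equal -1.\<close>

lemma least_q_cycle_le:
  assumes n: "odd n" "n \<ge> 3"
  shows "least_q (with_proj (cycle_graph n)) \<le> 2 - 2 * cos (pi / n)"
proof -
  define \<theta> where "\<theta> = pi / n"
  have n\<theta>: "real n * \<theta> = pi" using n by (simp add: \<theta>_def)
  have G: "pair_graph (cycle_graph n)"
    unfolding cycle_graph_def
  proof (rule pair_graph_graph_of_edges)
    show "irrefl (cycle_edges n)"
    proof (rule irreflI)
      fix v
      show "(v, v) \<notin> cycle_edges n"
      proof
        assume v: "(v, v) \<in> cycle_edges n"
        then have "v < n" using cycle_edges_subset[of n] n by auto
        then show False using v cycle_edges_iff[of v n v] n by auto
      qed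
    qed
  qed (use n in \<open>auto intro!: cycle_edges_subset\<close>)
  define x where "x i = (- 1) ^ i * cos (real i * \<theta>)" for i
  have arcs: "(v, w) \<in> parcs (cycle_graph n) \<longleftrightarrow>
    v < n \<and> w < n \<and> (w = Suc v \<or> w = 0 \<and> Suc v = n \<or> v = Suc w \<or> v = 0 \<and> Suc w = n)" for v w
    using cycle_edges_subset[of n] n cycle_edges_iff[of v n w] cycle_edges_iff[of w n v]
    by (auto simp: cycle_graph_def)
  have step: "x (Suc i) = - ((- 1) ^ i * cos (real i * \<theta> + \<theta>))" for i
    by (simp add: x_def algebra_simps)
  have "(\<Sum>w | (v, w) \<in> parcs (cycle_graph n). x v + x w) = (2 - 2 * cos \<theta>) * x v" if v: "v < n" for v
  proof -
    consider "v = 0" | "Suc v = n" "v > 0" | "v > 0" "Suc v < n" using v by linarith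
    then show ?thesis
    proof cases
      case 1
      have "{w. (v, w) \<in> parcs (cycle_graph n)} = {1, n - 1}" using n 1 by (auto simp: arcs)
      moreover have "x (n - 1) = - cos \<theta>"
      proof -
        have "real (n - 1) * \<theta> = pi - \<theta>" using n n\<theta> by (simp add: of_nat_diff algebra_simps)
        then show ?thesis using n by (simp add: x_def)
      qed
      ultimately show ?thesis using n 1 by (simp add: x_def)
    next
      case 2
      then have v': "v = Suc (v - 1)" "even v" "even (Suc (v - 1))" using n by auto
      have "{w. (v, w) \<in> parcs (cycle_graph n)} = {v - 1, 0}" using n 2 by (auto simp: arcs)
      moreover have a: "real v * \<theta> = pi - \<theta>" "real (v - 1) * \<theta> = pi - 2 * \<theta>"
        using 2 n\<theta> by (auto simp: of_nat_diff algebra_simps)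
      moreover have "x v = - cos \<theta>" "x (v - 1) = 2 * (cos \<theta>)\<^sup>2 - 1" "x 0 = 1"
        using a v' by (auto simp: x_def cos_double_cos)
      moreover have "v - 1 \<noteq> 0" using 2 n by simp
      ultimately show ?thesis by (simp add: power2_eq_square algebra_simps)
    next
      case 3
      then obtain i where i: "v = Suc i" by (cases v) auto
      have "{w. (v, w) \<in> parcs (cycle_graph n)} = {i, Suc v}" using n 3 i by (auto simp: arcs)
      moreover have "x i + x (Suc v) = - (2 * cos \<theta> * x v)"
      proof -
        have "x i = - ((- 1) ^ v * cos (real v * \<theta> - \<theta>))" by (simp add: x_def i algebra_simps)
        then have "x i + x (Suc v) = - ((- 1) ^ v * (cos (real v * \<theta> - \<theta>) + cos (real v * \<theta> + \<theta>)))"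
          unfolding step by (simp add: algebra_simps)
        then show ?thesis unfolding cos_step by (simp add: x_def)
      qed
      ultimately show ?thesis by (simp add: i algebra_simps)
    qed
  qed
  moreover have "x 0 \<noteq> 0" by (simp add: x_def)
  ultimately have "Q_eigenfunction (cycle_graph n) (2 - 2 * cos \<theta>) x"
    using n by (auto simp: Q_eigenfunction_def cycle_graph_def)
  from least_q_le[OF G this] show ?thesis by (simp add: \<theta>_def)
qed

abbreviation theta_edges :: "nat \<Rightarrow> (nat \<times> nat) set" where
  "theta_edges n \<equiv> {(i, i + 1) | i. 1 \<le> i \<and> i < n - 1} \<union> {(n - 1, 1), (0, 2), (0, n - 1)}"

lemma pair_graph_Theta: "n \<ge> 4 \<Longrightarrow> pair_graph (Theta_graph n)"
  unfolding Theta_graph_def by (rule pair_graph_graph_of_edges) (auto simp: irrefl_def)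

text \<open>The eigenfunction is an alternating sine, centred at the middle of the path 2, ..., n -
  1, with equal values at the vertices 0 and 1, each of which is joined to both ends of that
  path.\<close>

lemma least_q_Theta_le:
  assumes n: "even n" "n \<ge> 4" and \<theta>: "0 < \<theta>" "(real n - 1) * \<theta> < pi" "kappa n \<theta> = 0"
  shows "least_q (with_proj (Theta_graph n)) \<le> 2 - 2 * cos \<theta>"
proof -
  define l where "l = n - 3"
  have l: "odd l" "l \<ge> 1" "n = l + 3" using n by (auto simp: l_def)
  define f where "f j = sin ((real l / 2 - j) * \<theta>)" for j :: real
  define c s where "c = cos \<theta>" and "s = sin \<theta>"
  have "3 * \<theta> \<le> (real n - 1) * \<theta>" using n \<theta> by (intro mult_right_mono) auto
  then have t3: "3 * \<theta> < pi" using \<theta>(2) by linarith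
  have cs: "c > 0" "s > 0" using t3 \<theta> by (auto simp: c_def s_def intro!: cos_gt_zero_pi sin_gt_zero)
  have l\<theta>: "0 < real l * \<theta>" "real l * \<theta> < pi"
  proof -
    show "0 < real l * \<theta>" using l \<theta> by simp
    have "real l * \<theta> \<le> (real n - 1) * \<theta>" using l(3) \<theta> by (intro mult_right_mono) auto
    then show "real l * \<theta> < pi" using \<theta>(2) by linarith
  qed
  define h where "h = f 0"
  have h: "h > 0" using l\<theta> by (auto simp: h_def f_def intro!: sin_gt_zero)
  have fs: "f (j - 1) + f (j + 1) = 2 * c * f j" for j
    using sin_step[of "(real l / 2 - j) * \<theta>" \<theta>] by (simp add: f_def c_def algebra_simps)
  have frefl: "f (real l - j) = - f j" for j
  proof -
    have "(real l / 2 - (real l - j)) * \<theta> = - ((real l / 2 - j) * \<theta>)" by (simp add: algebra_simps)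
    then show ?thesis by (simp add: f_def)
  qed
  \<comment> \<open>This is the eigenvalue equation at the two vertices of degree 3, and it is where
    \<open>kappa n \<theta> = 0\<close> is used.\<close>
  have f1: "f 1 = h + 2 * c * h - 2 * h / c"
  proof -
    have "cot (real l * \<theta> / 2) = 2 * tan \<theta> - tan (\<theta> / 2)" using \<theta>(3) l(3) by (simp add: kappa_def)
    moreover have "tan (\<theta> / 2) = (1 - c) / s"
      using one_minus_cos_eq[of \<theta>] cs cos_gt_zero_pi[of "\<theta> / 2"] \<theta>(1) t3 by (simp add: c_def s_def)
    ultimately have "cos (real l * \<theta> / 2) = h * (2 * (s / c) - (1 - c) / s)"
      using h by (simp add: h_def f_def cot_def tan_def c_def s_def field_simps)
    then have "cos (real l * \<theta> / 2) * s = h * (2 * (s * s) / c - (1 - c))"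
      using cs by (simp add: field_simps)
    also have "s * s = 1 - c * c" using sin_cos_squared_add[of \<theta>] by (simp add: s_def c_def power2_eq_square)
    finally have "cos (real l * \<theta> / 2) * s = h * (2 / c - c - 1)" using cs by (simp add: field_simps)
    moreover have "f 1 = h * c - cos (real l * \<theta> / 2) * s"
      by (simp add: f_def h_def c_def s_def left_diff_distrib sin_diff)
    ultimately show ?thesis by (simp add: algebra_simps)
  qed
  define x where "x i = (if i < 2 then - h / c else (- 1) ^ i * f (real i - 2))" for i :: nat
  have arcs: "(v, w) \<in> parcs (Theta_graph n) \<longleftrightarrow> (v, w) \<in> theta_edges n \<or> (w, v) \<in> theta_edges n" for v w
    by (simp add: Theta_graph_def)
  have xl: "x (n - 1) = h" "x (n - 2) = - f 1" "x 2 = h" "x 3 = - f 1" "x 0 = - h / c" "x 1 = - h / c"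
  proof -
    have e: "even (n - 2)" "odd (n - 1)" "n - 2 \<ge> 2" "n - 1 \<ge> 2" using n by auto
    have r: "real (n - 1) - 2 = real l - 0" "real (n - 2) - 2 = real l - 1" using l by auto
    show "x (n - 1) = h" "x (n - 2) = - f 1"
      unfolding x_def r frefl using e by (simp_all add: h_def)
  qed (simp_all add: x_def h_def)
  have "(\<Sum>w | (v, w) \<in> parcs (Theta_graph n). x v + x w) = (2 - 2 * c) * x v" if v: "v < n" for v
  proof -
    consider "v < 2" | "v = 2" | "v = n - 1" | "2 < v" "v < n - 1" using v by linarith
    then show ?thesis
    proof cases
      case 1
      have "{w. (v, w) \<in> parcs (Theta_graph n)} = {2, n - 1}" using n 1 by (auto simp: arcs)
      then show ?thesis using 1 n xl cs by (auto simp: less_2_cases_iff field_simps)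
    next
      case 2
      have "{w. (v, w) \<in> parcs (Theta_graph n)} = {0, 1, 3}" using n 2 by (auto simp: arcs)
      then have "(\<Sum>w | (v, w) \<in> parcs (Theta_graph n). x v + x w) = (x 2 + x 0) + (x 2 + x 1) + (x 2 + x 3)"
        using 2 by simp
      then show ?thesis unfolding 2 xl f1 by (simp add: algebra_simps)
    next
      case 3
      have "{w. (v, w) \<in> parcs (Theta_graph n)} = {0, 1, n - 2}" using n 3 by (auto simp: arcs)
      moreover have "n - 2 \<noteq> 0" "n - 2 \<noteq> 1" using n by auto
      ultimately have "(\<Sum>w | (v, w) \<in> parcs (Theta_graph n). x v + x w)
          = (x (n - 1) + x 0) + (x (n - 1) + x 1) + (x (n - 1) + x (n - 2))"
        using 3 by simp
      then show ?thesis unfolding 3 xl f1 by (simp add: algebra_simps)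
    next
      case 4
      then obtain i where i: "v = Suc i" "i \<ge> 2" by (cases v) auto
      have "{w. (v, w) \<in> parcs (Theta_graph n)} = {i, Suc v}" using n 4 i by (auto simp: arcs)
      moreover have "x i + x (Suc v) = - (2 * c * x v)"
      proof -
        have "x i = - ((- 1) ^ v * f ((real v - 2) - 1))" "x (Suc v) = - ((- 1) ^ v * f ((real v - 2) + 1))"
          using i by (simp_all add: x_def algebra_simps)
        then have "x i + x (Suc v) = - ((- 1) ^ v * (f ((real v - 2) - 1) + f ((real v - 2) + 1)))"
          by (simp add: algebra_simps)
        then show ?thesis unfolding fs using i by (simp add: x_def)
      qed
      ultimately show ?thesis using i by (simp add: algebra_simps)
    qed
  qed
  moreover have "x 2 \<noteq> 0" using xl h by simp
  ultimately have "Q_eigenfunction (Theta_graph n) (2 - 2 * c) x"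
    using n by (auto simp: Q_eigenfunction_def Theta_graph_def intro!: bexI[of _ 2])
  from least_q_le[OF pair_graph_Theta[OF n(2)] this] show ?thesis by (simp add: c_def)
qed

section \<open>Energy bounds for graphs\<close>

lemma avoiding_walk:
  assumes "pcas u p v" "set p \<subseteq> parcs G" "z \<notin> set (map fst p)" "z \<noteq> v"
  shows "(\<lambda>x y. (x, y) \<in> parcs G \<and> x \<noteq> z \<and> y \<noteq> z)\<^sup>*\<^sup>* u v"
  using assms
proof (induction p arbitrary: u)
  case (Cons e p)
  then have IH: "(\<lambda>x y. (x, y) \<in> parcs G \<and> x \<noteq> z \<and> y \<noteq> z)\<^sup>*\<^sup>* (snd e) v" by auto
  have "snd e \<noteq> z" using Cons.prems by (cases p) auto
  then have "(\<lambda>x y. (x, y) \<in> parcs G \<and> x \<noteq> z \<and> y \<noteq> z) u (snd e)" using Cons.prems by (cases e) auto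
  then show ?case using IH by (rule converse_rtranclp_into_rtranclp)
qed simp

text \<open>Of two internally disjoint paths from \<open>s\<close> to \<open>t\<close>, at least one
  avoids \<open>z\<close>.\<close>

lemma nonbipartite_2_connected_graph:
  assumes G: "pair_graph G" and nb: "\<not> bipartite (with_proj G)" and tc: "two_connected (with_proj G)"
  shows "nonbipartite_2_connected (pverts G) (\<lambda>u v. (u, v) \<in> parcs G)"
proof
  show "finite (pverts G)" "3 \<le> card (pverts G)" using pair_graph_facts[OF G] tc by (auto simp: two_connected_def)
  show "\<And>u v. (u, v) \<in> parcs G \<Longrightarrow> (v, u) \<in> parcs G" "\<And>u. (u, u) \<notin> parcs G" "\<And>u v. (u, v) \<in> parcs G \<Longrightarrow> u \<in> pverts G"
    using pair_graph_facts[OF G] by blast+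
  show "\<not> (\<exists>c :: 'a \<Rightarrow> bool. \<forall>u v. (u, v) \<in> parcs G \<longrightarrow> c u \<noteq> c v)"
  proof
    assume "\<exists>c :: 'a \<Rightarrow> bool. \<forall>u v. (u, v) \<in> parcs G \<longrightarrow> c u \<noteq> c v"
    then obtain c :: "'a \<Rightarrow> bool" where c: "\<And>u v. (u, v) \<in> parcs G \<Longrightarrow> c u \<noteq> c v" by blast
    have "bipartite (with_proj G)" unfolding bipartite_def
      by (rule exI[of _ "{v \<in> pverts G. c v}"], rule exI[of _ "{v \<in> pverts G. \<not> c v}"])
        (use pair_graph_facts(3,4)[OF G] c in auto)
    then show False using nb by simp
  qed
  fix s t z assume st: "s \<in> pverts G" "t \<in> pverts G" "s \<noteq> z" "t \<noteq> z"
  show "(\<lambda>x y. (x, y) \<in> parcs G \<and> x \<noteq> z \<and> y \<noteq> z)\<^sup>*\<^sup>* s t"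
  proof (cases "s = t")
    case False
    then obtain p p' where p: "pre_digraph.apath (with_proj G) s p t" "pre_digraph.apath (with_proj G) s p' t"
      "set (pre_digraph.inner_verts (with_proj G) p) \<inter> set (pre_digraph.inner_verts (with_proj G) p') = {}"
      using tc st by (fastforce simp: two_connected_def)
    have walk: ?thesis if q: "pre_digraph.apath (with_proj G) s q t" "z \<notin> set (pre_digraph.inner_verts (with_proj G) q)" for q
    proof -
      have w: "pcas s q t" "set q \<subseteq> parcs G"
        using q(1) by (auto simp: pre_digraph.apath_def pre_digraph.awalk_def cas_with_proj_eq)
      moreover have "z \<notin> set (map fst q)"
        using q(2) w(1) st by (cases q) (auto simp: pre_digraph.inner_verts_def)
      ultimately show ?thesis using avoiding_walk[of s q t G z] st by blast
    qed
    show ?thesis using walk p by blast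
  qed simp
qed

section \<open>Energy of the arcs along a path\<close>

definition path_arcs :: "'a list \<Rightarrow> ('a \<times> 'a) set" where
  "path_arcs xs = set (zip xs (tl xs))"

lemma path_arcs_simps [simp]:
  "path_arcs [] = {}" "path_arcs [x] = {}" "path_arcs (x # y # zs) = insert (x, y) (path_arcs (y # zs))"
  by (simp_all add: path_arcs_def)

lemma finite_path_arcs [simp]: "finite (path_arcs xs)"
  by (simp add: path_arcs_def)

lemma path_arcsD: "(u, v) \<in> path_arcs xs \<Longrightarrow> u \<in> set (butlast xs) \<and> v \<in> set (tl xs)"
  by (induction xs rule: induct_list012) (auto split: if_splits)

lemma path_arcs_nth: "path_arcs xs = {(xs ! i, xs ! Suc i) | i. Suc i < length xs}"
  by (auto simp: path_arcs_def set_zip nth_tl)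

lemma successively_path_arcs: "successively P xs \<longleftrightarrow> (\<forall>(u, v)\<in>path_arcs xs. P u v)"
  by (induction xs rule: induct_list012) auto

text \<open>Alternating signs turns \<open>x\<^sub>u + x\<^sub>v\<close> on consecutive vertices into a difference of consecutive values, up to sign.\<close>

fun alternate :: "real \<Rightarrow> real list \<Rightarrow> real list" where
  "alternate s [] = []"
| "alternate s (x # xs) = s * x # alternate (- s) xs"

lemma length_alternate [simp]: "length (alternate s xs) = length xs"
  by (induction xs arbitrary: s) auto

lemma alternate_append: "alternate s (xs @ ys) = alternate s xs @ alternate (s * (- 1) ^ length xs) ys"
  by (induction xs arbitrary: s) auto

lemma nth_alternate: "i < length xs \<Longrightarrow> alternate s xs ! i = s * (- 1) ^ i * xs ! i"
proof (induction xs arbitrary: s i)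
  case (Cons a xs)
  then show ?case by (cases i) auto
qed simp

lemma sumsq_alternate: "s\<^sup>2 = 1 \<Longrightarrow> sumsq (alternate s xs) = sumsq xs"
  by (induction xs arbitrary: s) (auto simp: power_mult_distrib)

lemma sumsq_map_distinct: "distinct xs \<Longrightarrow> sumsq (map x xs) = (\<Sum>v\<in>set xs. (x v)\<^sup>2)"
  by (induction xs) auto

text \<open>Distinctness is required without the last vertex, so that closed cycles are covered as
  well.\<close>

lemma sum_path_arcs:
  assumes "distinct (butlast xs)" "s\<^sup>2 = 1"
  shows "(\<Sum>(u, v)\<in>path_arcs xs. (x u + x v)\<^sup>2) = path_energy (alternate s (map x xs))"
  using assms
proof (induction xs arbitrary: s rule: induct_list012)
  case (3 a b zs)
  have "(a, b) \<notin> path_arcs (b # zs)" using path_arcsD[of a b "b # zs"] 3(3) by auto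
  moreover have "distinct (butlast (b # zs))" using 3(3) by (auto split: if_splits)
  moreover have "(x a + x b)\<^sup>2 = (s * x a - - s * x b)\<^sup>2"
    using 3(4) by (simp add: power_mult_distrib flip: distrib_left)
  ultimately show ?case using 3(2)[of "- s"] 3(4) by simp
qed auto

text \<open>The set \<open>F\<close> contains one orientation of some of the edges. The other edges
  contribute squares, which all vanish in the equality case.\<close>

lemma sum_arcs_ge:
  assumes G: "pair_graph G" and F: "F \<subseteq> parcs G" "F \<inter> F\<inverse> = {}"
  shows "2 * (\<Sum>(u, v)\<in>F. (x u + x v)\<^sup>2) \<le> (\<Sum>(u, v)\<in>parcs G. (x u + x v)\<^sup>2)" (is "2 * ?f \<le> ?g")
    and "2 * (\<Sum>(u, v)\<in>F. (x u + x v)\<^sup>2) = (\<Sum>(u, v)\<in>parcs G. (x u + x v)\<^sup>2) \<Longrightarrow>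
      (u, v) \<in> parcs G \<Longrightarrow> (u, v) \<notin> F \<Longrightarrow> (v, u) \<notin> F \<Longrightarrow> x u + x v = (0 :: real)"
proof -
  let ?h = "\<lambda>(u, v). (x u + x v)\<^sup>2"
  have fin: "finite (parcs G)" "finite F" using pair_graph_facts(2)[OF G] F finite_subset by auto
  have F': "F\<inverse> \<subseteq> parcs G" using F pair_graph_facts(5)[OF G] by auto
  have "sum ?h (F\<inverse>) = ?f"
    by (rule sum.reindex_bij_witness[of _ prod.swap prod.swap]) (auto simp: add.commute)
  then have FF: "sum ?h (F \<union> F\<inverse>) = 2 * ?f" using fin F by (subst sum.union_disjoint) auto
  have tot: "?g = sum ?h (F \<union> F\<inverse>) + sum ?h (parcs G - (F \<union> F\<inverse>))"
    using fin F F' sum.subset_diff[of "F \<union> F\<inverse>" "parcs G" ?h] by (simp add: add.commute)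
  have nn: "sum ?h (parcs G - (F \<union> F\<inverse>)) \<ge> 0" by (rule sum_nonneg) auto
  show "2 * ?f \<le> ?g" using tot FF nn by linarith
  assume "2 * ?f = ?g" and uv: "(u, v) \<in> parcs G" "(u, v) \<notin> F" "(v, u) \<notin> F"
  then have "sum ?h (parcs G - (F \<union> F\<inverse>)) = 0" using tot FF by linarith
  then have "\<forall>e\<in>parcs G - (F \<union> F\<inverse>). ?h e = 0"
    using fin by (subst (asm) sum_nonneg_eq_0_iff) auto
  moreover have "(u, v) \<in> parcs G - (F \<union> F\<inverse>)" using uv by auto
  ultimately have "?h (u, v) = 0" by blast
  then show "x u + x v = 0" by simp
qed

lemma abs_alternate:
  assumes "v \<in> set xs" "\<bar>s\<bar> = 1"
  shows "\<exists>y\<in>set (alternate s (map x xs)). \<bar>y\<bar> = \<bar>x v\<bar>"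
  using assms by (induction xs arbitrary: s) (auto simp: abs_mult)

lemma alternate_path:
  "alternate 1 (map x (a # P @ [b])) = x a # alternate (- 1) (map x P) @ [(- 1) ^ Suc (length P) * x b]"
  by (simp add: alternate_append)

section \<open>Lower bounds from Hamiltonian cycles and theta subgraphs\<close>

locale nonbipartite_2_connected_pair_graph =
  fixes G :: "'a pair_pre_digraph" and n :: nat
  assumes G: "pair_graph G" and card_n: "card (pverts G) = n"
    and nb: "nonbipartite_2_connected (pverts G) (\<lambda>u v. (u, v) \<in> parcs G)"
begin

sublocale nonbipartite_2_connected "pverts G" "\<lambda>u v. (u, v) \<in> parcs G"
  by (rule nb)

lemma cycle_list_nth:
  "cycle_list xs \<longleftrightarrow> 3 \<le> length xs \<and> distinct xs \<and> (\<forall>i<length xs. (xs ! i, xs ! (Suc i mod length xs)) \<in> parcs G)"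
proof (cases "xs = []")
  case False
  have nth: "(xs @ [hd xs]) ! i = xs ! (i mod length xs)" if "i \<le> length xs" for i
    using that False by (auto simp: nth_append hd_conv_nth)
  have "successively (\<lambda>u v. (u, v) \<in> parcs G) (xs @ [hd xs]) \<longleftrightarrow>
      (\<forall>i<length xs. ((xs @ [hd xs]) ! i, (xs @ [hd xs]) ! Suc i) \<in> parcs G)"
    by (simp add: successively_conv_nth)
  also have "\<dots> \<longleftrightarrow> (\<forall>i<length xs. (xs ! i, xs ! (Suc i mod length xs)) \<in> parcs G)"
    using nth by (simp add: Suc_le_eq)
  finally show ?thesis by (simp add: cycle_list_def)
qed (simp add: cycle_list_def)

lemma path_arcs_cycle:
  assumes "xs \<noteq> []"
  shows "path_arcs (xs @ [hd xs]) = {(xs ! i, xs ! (Suc i mod length xs)) | i. i < length xs}"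
proof -
  have nth: "(xs @ [hd xs]) ! i = xs ! (i mod length xs)" if "i \<le> length xs" for i
    using that assms by (auto simp: nth_append hd_conv_nth)
  have "path_arcs (xs @ [hd xs]) = {((xs @ [hd xs]) ! i, (xs @ [hd xs]) ! Suc i) | i. i < length xs}"
    by (simp add: path_arcs_nth)
  also have "\<dots> = {(xs ! i, xs ! (Suc i mod length xs)) | i. i < length xs}"
  proof -
    have "((xs @ [hd xs]) ! i, (xs @ [hd xs]) ! Suc i) = (xs ! i, xs ! (Suc i mod length xs))" if "i < length xs" for i
      using nth[of i] nth[of "Suc i"] that by simp
    then show ?thesis by (intro Collect_cong) metis
  qed
  finally show ?thesis .
qed

text \<open>Alternating signs around the odd cycle yield an antiperiodic sequence for
  \<open>antiperiodic_bound\<close>. The chords only add energy, and at equality their energy is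
  zero.\<close>

lemma hamiltonian_bound:
  fixes x :: "'a \<Rightarrow> real"
  assumes c: "cycle_list xs" "set xs = pverts G" and odd: "odd n"
  defines "\<theta> \<equiv> pi / n"
  shows "2 * (2 - 2 * cos \<theta>) * (\<Sum>v\<in>pverts G. (x v)\<^sup>2) \<le> (\<Sum>(u, v)\<in>parcs G. (x u + x v)\<^sup>2)" (is "2 * _ * ?N \<le> ?E")
    and "(\<Sum>(u, v)\<in>parcs G. (x u + x v)\<^sup>2) = 2 * (2 - 2 * cos \<theta>) * (\<Sum>v\<in>pverts G. (x v)\<^sup>2) \<Longrightarrow>
      (\<exists>a b. \<forall>i<n. (- 1) ^ i * x (xs ! i) = a * cos (real i * \<theta>) + b * sin (real i * \<theta>)) \<and>
      (\<forall>i<n. \<forall>j<n. (xs ! i, xs ! j) \<in> parcs G \<longrightarrow> (i, j) \<in> cycle_edges n \<union> (cycle_edges n)\<inverse> \<or> x (xs ! i) + x (xs ! j) = 0)"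
proof -
  have xs: "distinct xs" "length xs = n" "n \<ge> 3" using c card_n distinct_card[of xs] by (auto simp: cycle_list_def)
  obtain a ys where ays: "xs = a # ys" using xs by (cases xs) auto
  let ?F = "path_arcs (xs @ [hd xs])"
  have Feq: "?F = {(xs ! i, xs ! (Suc i mod n)) | i. i < n}" using path_arcs_cycle[of xs] ays xs(2) by simp
  have inj: "xs ! i = xs ! j \<longleftrightarrow> i = j" if "i < n" "j < n" for i j
    using xs that by (simp add: nth_eq_iff_index_eq)
  have Fiff: "(xs ! i, xs ! j) \<in> ?F \<longleftrightarrow> (i, j) \<in> cycle_edges n" if "i < n" "j < n" for i j
    unfolding Feq cycle_edges_def using that inj by auto
  have F: "?F \<subseteq> parcs G" using c(1) by (auto simp: cycle_list_def successively_path_arcs)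
  have anti: "?F \<inter> ?F\<inverse> = {}"
  proof -
    have False if "(u, v) \<in> ?F" "(v, u) \<in> ?F" for u v
    proof -
      from that(1) obtain i where i: "i < n" "u = xs ! i" "v = xs ! (Suc i mod n)" unfolding Feq by blast
      define j where "j = Suc i mod n"
      have j: "j < n" using xs(3) by (simp add: j_def)
      have "(i, j) \<in> cycle_edges n" "(j, i) \<in> cycle_edges n"
        using that i j Fiff by (auto simp flip: j_def)
      then show False using i j xs(3) by (auto simp: cycle_edges_iff)
    qed
    then show ?thesis by auto
  qed
  define m where "m = alternate (- 1) (map x ys)"
  have "alternate 1 (map x (xs @ [hd xs])) = x a # m @ [- x a]"
  proof -
    have "even (length ys)" using odd xs(2) ays by auto
    then show ?thesis using alternate_path[of x a ys a] by (simp add: ays m_def)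
  qed
  then have SF: "(\<Sum>(u, v)\<in>?F. (x u + x v)\<^sup>2) = path_energy (x a # m @ [- x a])"
    using sum_path_arcs[of "xs @ [hd xs]" 1 x] xs(1) by simp
  have N: "?N = sumsq (x a # m)"
    using sumsq_map_distinct[OF xs(1), of x] c(2) by (simp add: ays m_def sumsq_alternate)
  have len: "length m + 1 = n" "n \<ge> 2" using xs by (auto simp: m_def ays)
  note ab = antiperiodic_bound[OF len, of \<theta> "x a", unfolded \<theta>_def, OF refl, folded \<theta>_def]
  note ge = sum_arcs_ge[OF G F anti, of x]
  show "2 * (2 - 2 * cos \<theta>) * ?N \<le> ?E" using ge(1) ab(1) unfolding SF N by linarith
  assume eq: "?E = 2 * (2 - 2 * cos \<theta>) * ?N"
  have e1: "path_energy (x a # m @ [- x a]) = (2 - 2 * cos \<theta>) * sumsq (x a # m)"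
    using ge(1) ab(1) eq unfolding SF N by linarith
  have e2: "2 * (\<Sum>(u, v)\<in>?F. (x u + x v)\<^sup>2) = ?E" using eq e1 unfolding SF N by linarith
  have "x a # m = alternate 1 (map x xs)" by (simp add: ays m_def)
  then have nth: "(x a # m) ! i = (- 1) ^ i * x (xs ! i)" if "i < n" for i
    using that xs(2) by (simp add: nth_alternate)
  have "\<exists>a b. \<forall>i<n. (- 1) ^ i * x (xs ! i) = a * cos (real i * \<theta>) + b * sin (real i * \<theta>)"
    using ab(2)[OF e1] nth by simp
  moreover have "(i, j) \<in> cycle_edges n \<union> (cycle_edges n)\<inverse> \<or> x (xs ! i) + x (xs ! j) = 0"
    if "i < n" "j < n" "(xs ! i, xs ! j) \<in> parcs G" for i j
    using ge(2)[OF e2 that(3)] Fiff that by auto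
  ultimately show "(\<exists>a b. \<forall>i<n. (- 1) ^ i * x (xs ! i) = a * cos (real i * \<theta>) + b * sin (real i * \<theta>)) \<and>
      (\<forall>i<n. \<forall>j<n. (xs ! i, xs ! j) \<in> parcs G \<longrightarrow> (i, j) \<in> cycle_edges n \<union> (cycle_edges n)\<inverse> \<or> x (xs ! i) + x (xs ! j) = 0)"
    by blast
qed

text \<open>The paths share only their ends, and since \<open>A\<close> and \<open>B\<close> have
  inner vertices, only \<open>L\<close> can be the single edge between \<open>a\<close> and
  \<open>b\<close>. Hence no edge is counted twice.\<close>

lemma theta_arcs:
  assumes th: "theta a b A B L"
  defines "F \<equiv> path_arcs (a # A @ [b]) \<union> path_arcs (a # B @ [b]) \<union> path_arcs (a # L @ [b])"
  shows "F \<subseteq> parcs G" "F \<inter> F\<inverse> = {}"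
    "(\<Sum>(u, v)\<in>F. (x u + x v :: real)\<^sup>2) = path_energy (alternate 1 (map x (a # A @ [b])))
      + path_energy (alternate 1 (map x (a # B @ [b]))) + path_energy (alternate 1 (map x (a # L @ [b])))"
proof -
  have d: "distinct (a # b # A @ B @ L)" and ne: "A \<noteq> []" "B \<noteq> []" using th by (auto simp: theta_def)
  show "F \<subseteq> parcs G" using th by (auto simp: theta_def F_def successively_path_arcs)
  have mem: "u \<in> insert a (set P) \<and> v \<in> insert b (set P)" if "(u, v) \<in> path_arcs (a # P @ [b])" for u v P
    using path_arcsD[OF that] by (auto simp: butlast_append)
  have noab: "(a, b) \<notin> path_arcs (a # P @ [b])" if P: "P \<noteq> []" "a \<noteq> b" "b \<notin> set P" "a \<notin> set P" for P
  proof -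
    obtain y ys where "P = y # ys" using P(1) by (cases P) auto
    then show ?thesis using P path_arcsD[of a b "y # ys @ [b]"] by (auto simp: butlast_append)
  qed
  have anti: "(v, u) \<notin> path_arcs xs" if "distinct xs" "(u, v) \<in> path_arcs xs" for u v and xs :: "'a list"
  proof
    assume vu: "(v, u) \<in> path_arcs xs"
    from that(2) obtain i where i: "Suc i < length xs" "u = xs ! i" "v = xs ! Suc i" by (auto simp: path_arcs_nth)
    from vu obtain j where j: "Suc j < length xs" "v = xs ! j" "u = xs ! Suc j" by (auto simp: path_arcs_nth)
    have "i = Suc j" "j = Suc i" using i j that(1) by (metis Suc_lessD nth_eq_iff_index_eq)+
    then show False by simp
  qed
  have cross: "(v, u) \<notin> path_arcs (a # Q @ [b])"
    if "(u, v) \<in> path_arcs (a # P @ [b])" "set P \<inter> set Q = {}" "a \<noteq> b" "a \<notin> set P" "b \<notin> set P" "a \<notin> set Q" "b \<notin> set Q" for P Q u v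
    using mem[OF that(1)] mem[of v u Q] that by auto
  show "F \<inter> F\<inverse> = {}"
  proof -
    have "(v, u) \<notin> F" if "(u, v) \<in> F" for u v
      using that d unfolding F_def by (auto dest: anti[rotated] cross)
    then show ?thesis by auto
  qed
  have disj: "path_arcs (a # P @ [b]) \<inter> path_arcs (a # Q @ [b]) = {}"
    if "set P \<inter> set Q = {}" "a \<noteq> b" "a \<notin> set P" "b \<notin> set P" "a \<notin> set Q" "b \<notin> set Q" "P \<noteq> []" for P Q
    using mem[of _ _ P] mem[of _ _ Q] noab[of P] that by fastforce
  have "path_arcs (a # A @ [b]) \<inter> path_arcs (a # B @ [b]) = {}"
    "(path_arcs (a # A @ [b]) \<union> path_arcs (a # B @ [b])) \<inter> path_arcs (a # L @ [b]) = {}"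
    using disj[of A B] disj[of A L] disj[of B L] d ne by (auto simp: Int_Un_distrib2)
  moreover have "(\<Sum>(u, v)\<in>path_arcs (a # P @ [b]). (x u + x v)\<^sup>2) = path_energy (alternate 1 (map x (a # P @ [b])))"
    if "a \<notin> set P" "distinct P" for P
    using sum_path_arcs[of "a # P @ [b]" 1 x] that by (simp add: butlast_append)
  ultimately show "(\<Sum>(u, v)\<in>F. (x u + x v :: real)\<^sup>2) = path_energy (alternate 1 (map x (a # A @ [b])))
      + path_energy (alternate 1 (map x (a # B @ [b]))) + path_energy (alternate 1 (map x (a # L @ [b])))"
    unfolding F_def using d by (simp add: sum.union_disjoint del: path_arcs_simps list.map map_append)
qed

text \<open>Edges outside the theta subgraph are discarded, the values of the vertices outside it
  are inserted into the sequences of \<open>B\<close> and \<open>L\<close>, and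
  \<open>theta_bound\<close> is applied. At equality no vertex can have been inserted, so the theta
  subgraph is spanning.\<close>

lemma theta_graph_bound:
  fixes x :: "'a \<Rightarrow> real"
  assumes th: "theta a b A B L" and u: "u \<in> set (a # b # B @ L)" "\<And>v. v \<in> pverts G \<Longrightarrow> \<bar>x v\<bar> \<le> \<bar>x u\<bar>"
    and \<theta>: "0 < \<theta>" "(real n - 1) * \<theta> < pi" "kappa n \<theta> \<ge> 0"
  shows "2 * (2 - 2 * cos \<theta>) * (\<Sum>v\<in>pverts G. (x v)\<^sup>2) \<le> (\<Sum>(u, v)\<in>parcs G. (x u + x v)\<^sup>2)" (is "2 * _ * ?N \<le> ?E")
    and "(\<Sum>(u, v)\<in>parcs G. (x u + x v)\<^sup>2) = 2 * (2 - 2 * cos \<theta>) * (\<Sum>v\<in>pverts G. (x v)\<^sup>2) \<Longrightarrow>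
      (\<Sum>v\<in>pverts G. (x v)\<^sup>2) \<noteq> 0 \<Longrightarrow>
      kappa n \<theta> = 0 \<and> set (a # b # A @ B @ L) = pverts G \<and> length L + 4 = n \<and>
      (\<exists>w v p. A = [w] \<and> B = [v] \<and> p \<noteq> 0 \<and> x a = p \<and> x b = p \<and> x w = - p / cos \<theta> \<and> x v = - p / cos \<theta> \<and>
        (\<forall>i\<le>n - 3. (- 1) ^ i * x ((a # L @ [b]) ! i) = p * sin (((real n - 3) / 2 - real i) * \<theta>) / sin ((real n - 3) / 2 * \<theta>))) \<and>
      (\<forall>(u, v)\<in>parcs G. (u, v) \<in> path_arcs (a # A @ [b]) \<union> path_arcs (a # B @ [b]) \<union> path_arcs (a # L @ [b]) \<or>
        (v, u) \<in> path_arcs (a # A @ [b]) \<union> path_arcs (a # B @ [b]) \<union> path_arcs (a # L @ [b]) \<or> x u + x v = 0)"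
proof -
  have d: "distinct (a # b # A @ B @ L)" and ne: "A \<noteq> []" "B \<noteq> []"
    and par: "even (length A + length B)" "odd (length A + length L)" using th by (auto simp: theta_def)
  let ?S = "set (a # b # A @ B @ L)"
  have sub: "?S \<subseteq> pverts G"
    using walk_subset_V[of "a # A @ [b]"] walk_subset_V[of "a # B @ [b]"] walk_subset_V[of "a # L @ [b]"] th
    by (auto simp: theta_def)
  obtain ws where ws: "set ws = pverts G - ?S" "distinct ws"
    using finite_distinct_list[of "pverts G - ?S"] finite_V by auto
  define p r where "p = x a" and "r = (- 1) ^ Suc (length A) * x b"
  define sA sB sL T where "sA = alternate (- 1) (map x A)" and "sB = alternate (- 1) (map x B)"
    and "sL = alternate (- 1) (map x L)" and "T = map x ws"
  have lens: "length sA = length A" "length sB = length B" "length sL = length L" "length T = length ws"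
    by (simp_all add: sA_def sB_def sL_def T_def)
  \<comment> \<open>The parities of the three paths enter here: the sign at \<open>b\<close> is the
    same along \<open>A\<close> and \<open>B\<close> and opposite along \<open>L\<close>.\<close>
  have rB: "(- 1) ^ Suc (length B) * x b = r" and rL: "(- 1) ^ Suc (length L) * x b = - r"
    using par unfolding r_def by (cases "even (length A)"; simp)+
  have paths: "alternate 1 (map x (a # A @ [b])) = p # sA @ [r]" "alternate 1 (map x (a # B @ [b])) = p # sB @ [r]"
    "alternate 1 (map x (a # L @ [b])) = p # sL @ [- r]"
    unfolding alternate_path rB rL by (simp_all add: p_def r_def sA_def sB_def sL_def)
  let ?F = "path_arcs (a # A @ [b]) \<union> path_arcs (a # B @ [b]) \<union> path_arcs (a # L @ [b])"
  note ge = sum_arcs_ge[OF G theta_arcs(1,2)[OF th], of x, unfolded theta_arcs(3)[OF th] paths]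
  have all: "distinct (a # b # A @ B @ L @ ws)" "set (a # b # A @ B @ L @ ws) = pverts G"
    using d ws sub by auto
  have n_eq: "length A + length B + length L + 2 + length ws = n"
    using distinct_card[OF all(1)] all(2) card_n by simp
  have r2: "r\<^sup>2 = (x b)\<^sup>2" by (simp add: r_def power_mult_distrib flip: power_mult)
  have N: "?N = p\<^sup>2 + r\<^sup>2 + sumsq sA + sumsq sB + sumsq sL + sumsq T"
    using sumsq_map_distinct[OF all(1), of x] unfolding all(2) r2
    by (simp add: p_def sA_def sB_def sL_def T_def sumsq_alternate)
  have "\<exists>z\<in>set (p # sB @ [r]) \<union> set (p # sL @ [- r]). \<bar>z\<bar> = \<bar>x u\<bar>"
  proof -
    have "\<bar>r\<bar> = \<bar>x b\<bar>" by (simp add: r_def abs_mult power_abs)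
    then show ?thesis using u(1) abs_alternate[of u B "- 1" x] abs_alternate[of u L "- 1" x]
      by (auto simp: p_def sB_def sL_def)
  qed
  then obtain z where z: "z \<in> set (p # sB @ [r]) \<union> set (p # sL @ [- r])" "\<bar>z\<bar> = \<bar>x u\<bar>" by blast
  have "\<forall>t\<in>set T. \<bar>t\<bar> \<le> \<bar>z\<bar>" using u(2) z(2) ws(1) by (auto simp: T_def)
  from insert_all[OF z(1) this] obtain B' L' where BL: "length sB \<le> length B'" "length sL \<le> length L'"
    "length B' + length L' = length sB + length sL + length T"
    "sumsq B' + sumsq L' = sumsq sB + sumsq sL + sumsq T"
    "path_energy (p # B' @ [r]) + path_energy (p # L' @ [- r]) \<le> path_energy (p # sB @ [r]) + path_energy (p # sL @ [- r])"
    "length sL < length L' \<longrightarrow>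
      path_energy (p # B' @ [r]) + path_energy (p # L' @ [- r]) < path_energy (p # sB @ [r]) + path_energy (p # sL @ [- r]) \<or>
      (\<exists>us y vs. p # L' @ [- r] = us @ y # y # vs)" by blast
  have n': "length sA + length B' + length L' + 2 = n" using BL(3) n_eq lens by simp
  have ne': "sA \<noteq> []" "B' \<noteq> []" using ne BL(1) lens by auto
  have N': "?N = p\<^sup>2 + r\<^sup>2 + sumsq sA + sumsq B' + sumsq L'" using N BL(4) by simp
  note tb = theta_bound[OF n' ne' \<theta>, of p r, folded N']
  define K where "K = (2 - 2 * cos \<theta>) * ?N"
  have tb1: "K \<le> path_energy (p # sA @ [r]) + path_energy (p # B' @ [r]) + path_energy (p # L' @ [- r])"
    using tb(1) by (simp add: K_def)
  have K2: "2 * (2 - 2 * cos \<theta>) * ?N = 2 * K" by (simp add: K_def)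
  have K3: "K \<le> path_energy (p # sA @ [r]) + path_energy (p # sB @ [r]) + path_energy (p # sL @ [- r])"
    using tb1 BL(5) by linarith
  show "2 * (2 - 2 * cos \<theta>) * ?N \<le> ?E" unfolding K2
    using K3 ge(1) by (meson mult_left_mono order_trans zero_le_numeral)
  assume "?E = 2 * (2 - 2 * cos \<theta>) * ?N" and N0: "?N \<noteq> 0"
  then have eq: "?E = 2 * K" unfolding K2 by simp
  have e1: "path_energy (p # sA @ [r]) + path_energy (p # B' @ [r]) + path_energy (p # L' @ [- r]) = (2 - 2 * cos \<theta>) * ?N"
    and e2: "path_energy (p # sA @ [r]) + path_energy (p # sB @ [r]) + path_energy (p # sL @ [- r]) = (2 - 2 * cos \<theta>) * ?N"
  proof -
    have "path_energy (p # sA @ [r]) + path_energy (p # sB @ [r]) + path_energy (p # sL @ [- r]) \<le> K"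
      using ge(1) unfolding eq by simp
    then show e1: "path_energy (p # sA @ [r]) + path_energy (p # B' @ [r]) + path_energy (p # L' @ [- r]) = (2 - 2 * cos \<theta>) * ?N"
      and e2: "path_energy (p # sA @ [r]) + path_energy (p # sB @ [r]) + path_energy (p # sL @ [- r]) = (2 - 2 * cos \<theta>) * ?N"
      unfolding K_def[symmetric] using K3 tb1 BL(5) by linarith+
  qed
  from tb(2)[OF e1 N0] have tq: "kappa n \<theta> = 0" "length sA = 1" "length B' = 1" "p = r" "p \<noteq> 0"
    "\<And>i. i \<le> n - 3 \<Longrightarrow> (p # L' @ [- r]) ! i = p * sin (((real n - 3) / 2 - real i) * \<theta>) / sin ((real n - 3) / 2 * \<theta>)"
    by blast+
  have "\<not> length sL < length L'"
  proof
    assume "length sL < length L'"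
    moreover have "path_energy (p # B' @ [r]) + path_energy (p # L' @ [- r]) = path_energy (p # sB @ [r]) + path_energy (p # sL @ [- r])"
      using e1 e2 by linarith
    ultimately have "\<exists>us y vs. p # L' @ [- r] = us @ y # y # vs" using BL(6) by simp
    then obtain us y vs where rep: "p # L' @ [- r] = us @ y # y # vs" by blast
    let ?i = "length us"
    have i: "Suc ?i \<le> n - 3" using arg_cong[OF rep, of length] n' tq(2,3) by simp
    have "n \<ge> 4" using n' tq(2,3) by simp
    have "(p # L' @ [- r]) ! ?i = (p # L' @ [- r]) ! Suc ?i" unfolding rep by (simp add: nth_append)
    from trans[OF HOL.sym[OF tq(6)[OF Suc_leD[OF i]]] trans[OF this tq(6)[OF i]]] have s: "p * sin (((real n - 3) / 2 - real ?i) * \<theta>) / sin ((real n - 3) / 2 * \<theta>)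
      = p * sin (((real n - 3) / 2 - real (Suc ?i)) * \<theta>) / sin ((real n - 3) / 2 * \<theta>)" .
    have half: "0 < (real n - 3) / 2 * \<theta>" "(real n - 3) / 2 * \<theta> < pi / 2"
      using \<theta>(1,2) \<open>n \<ge> 4\<close> by (auto simp: left_diff_distrib)
    have "sin ((real n - 3) / 2 * \<theta>) > 0" using half by (intro sin_gt_zero) auto
    then have "sin (((real n - 3) / 2 - real ?i) * \<theta>) = sin (((real n - 3) / 2 - real (Suc ?i)) * \<theta>)"
      using s tq(5) by simp
    moreover have "sin (((real n - 3) / 2 - real (Suc ?i)) * \<theta>) < sin (((real n - 3) / 2 - real ?i) * \<theta>)"
    proof (rule sin_monotone_2pi)
      have "real (Suc ?i) \<le> real n - 3" using i \<open>n \<ge> 4\<close> by linarith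
      then have "- ((real n - 3) / 2) \<le> (real n - 3) / 2 - real (Suc ?i)" by (simp add: field_simps)
      then have "- ((real n - 3) / 2) * \<theta> \<le> ((real n - 3) / 2 - real (Suc ?i)) * \<theta>"
        using \<theta>(1) by (intro mult_right_mono) simp_all
      moreover have "- (pi / 2) \<le> - ((real n - 3) / 2) * \<theta>" using half(2) by simp
      ultimately show "- (pi / 2) \<le> ((real n - 3) / 2 - real (Suc ?i)) * \<theta>" by (rule order_trans[rotated])
      show "((real n - 3) / 2 - real (Suc ?i)) * \<theta> < ((real n - 3) / 2 - real ?i) * \<theta>"
        using \<theta>(1) by (intro mult_strict_right_mono) auto
      have "H - real ?i \<le> H" for H by simp
      from mult_right_mono[OF this less_imp_le[OF \<theta>(1)]]
      have "((real n - 3) / 2 - real ?i) * \<theta> \<le> (real n - 3) / 2 * \<theta>" .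
      then show "((real n - 3) / 2 - real ?i) * \<theta> \<le> pi / 2" using half(2) by (meson less_imp_le order_trans)
    qed
    ultimately show False by simp
  qed
  then have "length L' = length sL" "length B' = length sB" using BL(1,2) tq(3) lens ne by (cases B; auto)+
  then have ws0: "ws = []" using BL(3) lens by simp
  have n2: "length sA + length sB + length sL + 2 = n" using n_eq ws0 lens by simp
  have ne2: "sB \<noteq> []" using ne lens by auto
  have N2: "?N = p\<^sup>2 + r\<^sup>2 + sumsq sA + sumsq sB + sumsq sL" using N ws0 by (simp add: T_def)
  note final = theta_bound(2)[OF n2 ne'(1) ne2 \<theta>, of p r, folded N2, OF e2 N0]
  obtain w where w: "A = [w]" using final lens by (cases A) auto
  obtain v where v: "B = [v]" using final lens by (cases B) auto
  have xa: "x a = p" by (simp add: p_def)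
  have xb: "x b = p" using final w by (simp add: r_def)
  have xw: "x w = - p / cos \<theta>" "x v = - p / cos \<theta>" using final w v by (auto simp: sA_def sB_def)
  have "(- 1) ^ i * x ((a # L @ [b]) ! i) = p * sin (((real n - 3) / 2 - real i) * \<theta>) / sin ((real n - 3) / 2 * \<theta>)"
    if "i \<le> n - 3" for i
  proof -
    have "i < length (a # L @ [b])" using that n2 lens w v by simp
    then have "alternate 1 (map x (a # L @ [b])) ! i = (- 1) ^ i * x ((a # L @ [b]) ! i)"
      by (subst nth_alternate) (auto simp del: map_append list.map simp: nth_map)
    then have nth: "(p # sL @ [- r]) ! i = (- 1) ^ i * x ((a # L @ [b]) ! i)" unfolding paths .
    have "(p # sL @ [- r]) ! i = p * sin (((real n - 3) / 2 - real i) * \<theta>) / sin ((real n - 3) / 2 * \<theta>)"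
      using final that by blast
    then show ?thesis by (rule trans[OF HOL.sym[OF nth]])
  qed
  moreover have "(u, v) \<in> ?F \<or> (v, u) \<in> ?F \<or> x u + x v = 0" if "(u, v) \<in> parcs G" for u v
    using ge(2)[OF _ that] e2 eq by (auto simp: K_def)
  moreover have "?S = pverts G" using all(2) ws0 by simp
  moreover have "length L + 4 = n" using n2 w v lens by simp
  ultimately show "kappa n \<theta> = 0 \<and> set (a # b # A @ B @ L) = pverts G \<and> length L + 4 = n \<and>
      (\<exists>w v p. A = [w] \<and> B = [v] \<and> p \<noteq> 0 \<and> x a = p \<and> x b = p \<and> x w = - p / cos \<theta> \<and> x v = - p / cos \<theta> \<and>
        (\<forall>i\<le>n - 3. (- 1) ^ i * x ((a # L @ [b]) ! i) = p * sin (((real n - 3) / 2 - real i) * \<theta>) / sin ((real n - 3) / 2 * \<theta>))) \<and>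
      (\<forall>(u, v)\<in>parcs G. (u, v) \<in> ?F \<or> (v, u) \<in> ?F \<or> x u + x v = 0)"
    using tq(1) w v xa xb xw tq(5) by blast
qed

end

section \<open>The extremal graphs\<close>

lemma cycle_edges_mod: "(i, j) \<in> cycle_edges n \<longleftrightarrow> i < n \<and> j = Suc i mod n"
  by (auto simp: cycle_edges_def)

context nonbipartite_2_connected_pair_graph
begin

lemma chord_index_sum:
  fixes x :: "'a \<Rightarrow> real"
  assumes c: "cycle_list xs" "set xs = pverts G" and odd: "odd n"
    and eq: "(\<Sum>(u, v)\<in>parcs G. (x u + x v)\<^sup>2) = 2 * (2 - 2 * cos (pi / n)) * (\<Sum>v\<in>pverts G. (x v)\<^sup>2)"
    and x0: "(\<Sum>v\<in>pverts G. (x v)\<^sup>2) \<noteq> 0"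
  shows "\<exists>\<phi>. \<forall>i<n. \<forall>j<n. (xs ! i, xs ! j) \<in> parcs G \<longrightarrow> (i, j) \<in> cycle_edges n \<union> (cycle_edges n)\<inverse> \<or>
    (\<exists>k :: int. real (i + j) * (pi / n) + \<phi> = k * pi)"
proof -
  define \<theta> where "\<theta> = pi / n"
  have xs: "distinct xs" "length xs = n" "n \<ge> 3" using c card_n distinct_card[of xs] by (auto simp: cycle_list_def)
  have n\<theta>: "real n * \<theta> = pi" "\<theta> > 0" using xs by (auto simp: \<theta>_def)
  from hamiltonian_bound(2)[OF c odd eq] obtain a b where
    ab: "\<And>i. i < n \<Longrightarrow> (- 1) ^ i * x (xs ! i) = a * cos (real i * \<theta>) + b * sin (real i * \<theta>)"
    and chord: "\<And>i j. i < n \<Longrightarrow> j < n \<Longrightarrow> (xs ! i, xs ! j) \<in> parcs G \<Longrightarrow>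
      (i, j) \<in> cycle_edges n \<union> (cycle_edges n)\<inverse> \<or> x (xs ! i) + x (xs ! j) = 0"
    unfolding \<theta>_def by blast
  obtain \<rho> \<phi> where \<rho>: "a = \<rho> * cos \<phi>" "- b = \<rho> * sin \<phi>" using polar_Ex[of a "- b"] by blast
  have g: "(- 1) ^ i * x (xs ! i) = \<rho> * cos (real i * \<theta> + \<phi>)" if "i < n" for i
  proof -
    have b: "b = - (\<rho> * sin \<phi>)" using \<rho>(2) by simp
    show ?thesis unfolding ab[OF that] unfolding \<rho>(1) b by (simp add: cos_add algebra_simps)
  qed
  have \<rho>0: "\<rho> \<noteq> 0"
  proof
    assume "\<rho> = 0"
    then have "x (xs ! i) = 0" if "i < n" for i using g[OF that] by simp
    then have "x v = 0" if "v \<in> pverts G" for v using that c(2) xs(2) by (metis in_set_conv_nth)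
    then show False using x0 by simp
  qed
  have "\<exists>k :: int. real (i + j) * \<theta> + 2 * \<phi> = k * pi" if ij: "i < n" "j < n" "i \<noteq> j" "x (xs ! i) + x (xs ! j) = 0" for i j
  proof -
    define \<alpha> \<beta> where "\<alpha> = real i * \<theta> + \<phi>" and "\<beta> = real j * \<theta> + \<phi>"
    have sq: "(x (xs ! k))\<^sup>2 = \<rho>\<^sup>2 * (cos (real k * \<theta> + \<phi>))\<^sup>2" if "k < n" for k
    proof -
      have "((- 1) ^ k * x (xs ! k))\<^sup>2 = (x (xs ! k))\<^sup>2" by (simp add: power_mult_distrib flip: power_mult)
      then show ?thesis unfolding g[OF that] by (simp add: power_mult_distrib)
    qed
    have "x (xs ! i) = - x (xs ! j)" using ij(4) by simp
    then have "(x (xs ! i))\<^sup>2 = (x (xs ! j))\<^sup>2" by simp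
    then have "(cos \<alpha>)\<^sup>2 = (cos \<beta>)\<^sup>2" using sq ij \<rho>0 by (simp add: \<alpha>_def \<beta>_def)
    moreover have "sin (\<alpha> + \<beta>) * sin (\<alpha> - \<beta>) = (cos \<beta>)\<^sup>2 - (cos \<alpha>)\<^sup>2"
    proof -
      have "sin (\<alpha> + \<beta>) * sin (\<alpha> - \<beta>) = (sin \<alpha>)\<^sup>2 * (cos \<beta>)\<^sup>2 - (cos \<alpha>)\<^sup>2 * (sin \<beta>)\<^sup>2"
        by (simp add: sin_add sin_diff power2_eq_square algebra_simps)
      then show ?thesis by (simp add: sin_squared_eq algebra_simps)
    qed
    ultimately have "sin (\<alpha> + \<beta>) * sin (\<alpha> - \<beta>) = 0" by simp
    moreover have "sin (\<alpha> - \<beta>) \<noteq> 0"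
    proof -
      have pos: "sin ((real k - real l) * \<theta>) > 0" if "l < k" "k < n" for k l
      proof (rule sin_gt_zero)
        show "0 < (real k - real l) * \<theta>" using that n\<theta> by simp
        have "(real k - real l) * \<theta> < real n * \<theta>" using that n\<theta> by (intro mult_strict_right_mono) auto
        then show "(real k - real l) * \<theta> < pi" using n\<theta> by simp
      qed
      have e: "\<alpha> - \<beta> = (real i - real j) * \<theta>" "\<alpha> - \<beta> = - ((real j - real i) * \<theta>)" by (simp_all add: \<alpha>_def \<beta>_def algebra_simps)
      show ?thesis
      proof (cases "j < i")
        case True
        show ?thesis unfolding e(1) using pos[of j i] True ij by simp
      next
        case False
        show ?thesis unfolding e(2) using pos[of i j] False ij by simp
      qed
    qed
    ultimately have "sin (\<alpha> + \<beta>) = 0" by simp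
    then obtain k :: int where "\<alpha> + \<beta> = k * pi" unfolding sin_zero_iff_int2 by blast
    then show ?thesis by (intro exI[of _ k]) (simp add: \<alpha>_def \<beta>_def algebra_simps)
  qed
  then show ?thesis using chord irrefl unfolding \<theta>_def by (intro exI[of _ "2 * \<phi>"]) metis
qed

lemma odd_equality_iso:
  fixes x :: "'a \<Rightarrow> real"
  assumes c: "cycle_list xs" "set xs = pverts G" and odd: "odd n"
    and eq: "(\<Sum>(u, v)\<in>parcs G. (x u + x v)\<^sup>2) = 2 * (2 - 2 * cos (pi / n)) * (\<Sum>v\<in>pverts G. (x v)\<^sup>2)"
    and x0: "(\<Sum>v\<in>pverts G. (x v)\<^sup>2) \<noteq> 0"
  shows "digraph_iso (with_proj G) (with_proj (cycle_graph n)) \<or>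
    (\<exists>k js. 1 \<le> k \<and> k \<le> (n - 3) div 2 \<and> length js = k \<and> sorted js \<and>
       set js \<subseteq> {1..(n - 3) div 2} \<and> digraph_iso (with_proj G) (with_proj (H_graph n js)))"
proof -
  have xs: "distinct xs" "length xs = n" "n \<ge> 3" using c card_n distinct_card[of xs] by (auto simp: cycle_list_def)
  have edge: "(ys ! i, ys ! j) \<in> parcs G"
    if "cycle_list ys" "length ys = n" "i < n" "j < n" "(i, j) \<in> cycle_edges n \<union> (cycle_edges n)\<inverse>" for ys i j
    using that sym by (auto simp: cycle_edges_mod cycle_list_nth)
  show ?thesis
  proof (cases "\<forall>i<n. \<forall>j<n. (xs ! i, xs ! j) \<in> parcs G \<longrightarrow> (i, j) \<in> cycle_edges n \<union> (cycle_edges n)\<inverse>")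
    case True
    have "digraph_iso (with_proj G) (with_proj (graph_of_edges n (cycle_edges n)))"
    proof (rule digraph_iso_graph_of_edges[OF G xs(2,1) c(2)])
      show "cycle_edges n \<subseteq> {..<n} \<times> {..<n}" using xs(3) by (intro cycle_edges_subset) auto
      show "(xs ! i, xs ! j) \<in> parcs G \<longleftrightarrow> (i, j) \<in> cycle_edges n \<union> (cycle_edges n)\<inverse>" if "i < n" "j < n" for i j
        using True that edge[OF c(1) xs(2) that] by blast
    qed
    then show ?thesis by (simp add: cycle_graph_def)
  next
    case False
    then obtain i0 j0 where ij0: "i0 < n" "j0 < n" "(xs ! i0, xs ! j0) \<in> parcs G" "(i0, j0) \<notin> cycle_edges n \<union> (cycle_edges n)\<inverse>"
      by blast
    define s m z where "s = i0 + j0" and "m = (n + 1) div 2" and "z = (s * m) mod n"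
    have m: "2 * m = n + 1" using odd by (auto simp: m_def)
    have zn: "z < n" using xs(3) by (simp add: z_def)
    define ys where "ys = rotate z xs"
    have ys: "distinct ys" "length ys = n" "set ys = pverts G" using xs c(2) by (simp_all add: ys_def)
    have nth: "ys ! i = xs ! ((z + i) mod n)" if "i < n" for i
      using nth_rotate[of i xs z] that xs(2) by (simp add: ys_def)
    have cy: "cycle_list ys"
      unfolding cycle_list_nth ys(2)
    proof (intro conjI allI impI)
      fix i assume i: "i < n"
      have "(xs ! ((z + i) mod n), xs ! (Suc ((z + i) mod n) mod n)) \<in> parcs G"
        using c(1) xs unfolding cycle_list_nth by simp
      moreover have "ys ! (Suc i mod n) = xs ! (Suc ((z + i) mod n) mod n)"
        using nth[of "Suc i mod n"] xs(3) by (simp add: mod_simps)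
      ultimately show "(ys ! i, ys ! (Suc i mod n)) \<in> parcs G" using nth[OF i] by simp
    qed (use ys xs in auto)
    define i1 j1 where "i1 = (i0 + (n - z)) mod n" and "j1 = (j0 + (n - z)) mod n"
    have i1: "i1 < n" "j1 < n" using xs(3) by (auto simp: i1_def j1_def)
    have shift: "(z + i1) mod n = i0" "(z + j1) mod n = j0"
      using zn ij0(1,2) by (simp_all add: i1_def j1_def mod_simps)
    have arc1: "(ys ! i1, ys ! j1) \<in> parcs G" using ij0(3) nth i1 shift by simp
    have "i1 \<noteq> j1" using arc1 irrefl by metis
    have sum1: "i1 + j1 = n"
    proof -
      have q: "int z + int i1 = int i0 + int n * int ((z + i1) div n)" "int z + int j1 = int j0 + int n * int ((z + j1) div n)"
        using div_mult_mod_eq[of "z + i1" n] div_mult_mod_eq[of "z + j1" n] shift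
        by (metis add.commute mult.commute of_nat_add of_nat_mult)+
      have q3: "int s * int m = int n * int (s * m div n) + int z"
        unfolding z_def by (metis mult_div_mod_eq of_nat_add of_nat_mult)
      have "2 * (int s * int m) = int s * (int n + 1)" using m by (metis mult.left_commute of_nat_1 of_nat_add of_nat_mult of_nat_numeral)
      then have "int i1 + int j1 = int n * (int ((z + i1) div n) + int ((z + j1) div n) + 2 * int (s * m div n) - int s)"
        using q q3 by (simp add: s_def algebra_simps)
      then have "int n dvd int (i1 + j1)" by simp
      then have "n dvd i1 + j1" using int_dvd_int_iff by blast
      then obtain t where t: "i1 + j1 = n * t" by blast
      have "0 < i1 + j1" "i1 + j1 < n * 2" using \<open>i1 \<noteq> j1\<close> i1 by auto
      then have "t = 1" unfolding t by (cases t) auto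
      then show ?thesis using t by simp
    qed
    have nc1: "(i1, j1) \<notin> cycle_edges n \<union> (cycle_edges n)\<inverse>"
    proof -
      have "Suc i1 mod n \<noteq> j1"
      proof
        assume "Suc i1 mod n = j1"
        then have "Suc i0 mod n = j0" using shift by (metis add_Suc_right mod_Suc_eq mod_add_right_eq)
        then show False using ij0 by (auto simp: cycle_edges_mod)
      qed
      moreover have "Suc j1 mod n \<noteq> i1"
      proof
        assume "Suc j1 mod n = i1"
        then have "Suc j0 mod n = i0" using shift by (metis add_Suc_right mod_Suc_eq mod_add_right_eq)
        then show False using ij0 by (auto simp: cycle_edges_mod)
      qed
      ultimately show ?thesis by (auto simp: cycle_edges_mod)
    qed
    from chord_index_sum[OF cy ys(3) odd eq x0] obtain \<phi> where
      \<phi>: "\<And>i j. i < n \<Longrightarrow> j < n \<Longrightarrow> (ys ! i, ys ! j) \<in> parcs G \<Longrightarrow> (i, j) \<notin> cycle_edges n \<union> (cycle_edges n)\<inverse> \<Longrightarrow>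
        \<exists>k :: int. real (i + j) * (pi / n) + \<phi> = k * pi" by blast
    obtain k1 :: int where k1: "real (i1 + j1) * (pi / n) + \<phi> = k1 * pi" using \<phi>[OF i1 arc1 nc1] by blast
    have sum_n: "i + j = n" if ij: "i < n" "j < n" "(ys ! i, ys ! j) \<in> parcs G" "(i, j) \<notin> cycle_edges n \<union> (cycle_edges n)\<inverse>" for i j
    proof -
      obtain k :: int where "real (i + j) * (pi / n) + \<phi> = k * pi" using \<phi>[OF ij] by blast
      moreover have "\<phi> = (k1 - 1) * pi" using k1 xs(3) unfolding sum1 by (simp add: algebra_simps)
      ultimately have "real (i + j) * (pi / n) = (k - k1 + 1) * pi" by (simp add: algebra_simps)
      then have "pi * real (i + j) = pi * ((k - k1 + 1) * real n)" using xs(3) by (simp add: field_simps)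
      then have "real (i + j) = (k - k1 + 1) * real n" unfolding mult_cancel_left by simp
      then have "int (i + j) = (k - k1 + 1) * int n" by (metis of_int_eq_iff of_int_mult of_int_of_nat_eq)
      then have "int n dvd int (i + j)" by simp
      then have "n dvd i + j" using int_dvd_int_iff by blast
      then obtain t where t: "i + j = n * t" by blast
      have "i \<noteq> j" using ij(3) irrefl by metis
      then have "0 < i + j" "i + j < n * 2" using ij by auto
      then have "t = 1" unfolding t by (cases t) auto
      then show ?thesis using t by simp
    qed
    define J where "J = {i \<in> {1..(n - 3) div 2}. (ys ! i, ys ! (n - i)) \<in> parcs G}"
    have inJ: "i \<in> J \<and> j = n - i" if "i < j" "i < n" "j < n" "(ys ! i, ys ! j) \<in> parcs G" "(i, j) \<notin> cycle_edges n" "i + j = n" for i j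
    proof -
      have "j \<noteq> Suc i" using that by (auto simp: cycle_edges_mod)
      then have "i \<le> (n - 3) div 2" "1 \<le> i" "j = n - i" using that odd by presburger+
      then show ?thesis using that by (simp add: J_def)
    qed
    define js where "js = sorted_list_of_set J"
    have finJ: "finite J" by (simp add: J_def)
    have js: "sorted js" "set js = J" "length js = card J" using finJ by (simp_all add: js_def)
    have "J \<noteq> {}"
    proof (cases "i1 < j1")
      case True
      then show ?thesis using inJ[of i1 j1] i1 arc1 nc1 sum1 by auto
    next
      case False
      then show ?thesis using inJ[of j1 i1] i1 sym[OF arc1] nc1 sum1 \<open>i1 \<noteq> j1\<close> by auto
    qed
    then have cJ: "1 \<le> card J" using finJ by (simp add: Suc_le_eq card_gt_0_iff)
    have "card J \<le> card {1..(n - 3) div 2}" by (rule card_mono) (auto simp: J_def)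
    then have cJ2: "card J \<le> (n - 3) div 2" by simp
    have "digraph_iso (with_proj G) (with_proj (graph_of_edges n (cycle_edges n \<union> {(j, n - j) | j. j \<in> set js})))"
    proof (rule digraph_iso_graph_of_edges[OF G ys(2,1,3)])
      let ?E = "cycle_edges n \<union> {(j, n - j) | j. j \<in> set js}"
      show "?E \<subseteq> {..<n} \<times> {..<n}"
        using cycle_edges_subset[of n] xs(3) by (auto simp: js J_def)
      show "(ys ! i, ys ! j) \<in> parcs G \<longleftrightarrow> (i, j) \<in> ?E \<union> ?E\<inverse>" if ij: "i < n" "j < n" for i j
      proof
        assume arc: "(ys ! i, ys ! j) \<in> parcs G"
        show "(i, j) \<in> ?E \<union> ?E\<inverse>"
        proof (cases "(i, j) \<in> cycle_edges n \<union> (cycle_edges n)\<inverse>")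
          case False
          have "i \<noteq> j" using arc irrefl by metis
          then consider "i < j" | "j < i" by linarith
          then show ?thesis
          proof cases
            case 1
            then show ?thesis using inJ[OF 1 ij arc] False sum_n[OF ij arc False] js(2) by auto
          next
            case 2
            have "i + j = n" using sum_n[OF ij arc False] .
            then show ?thesis using inJ[OF 2 ij(2,1) sym[OF arc]] False js(2) by auto
          qed
        qed auto
      next
        assume "(i, j) \<in> ?E \<union> ?E\<inverse>"
        then consider "(i, j) \<in> cycle_edges n \<union> (cycle_edges n)\<inverse>" | "i \<in> J" "j = n - i" | "j \<in> J" "i = n - j"
          using js(2) by auto
        then show "(ys ! i, ys ! j) \<in> parcs G"
        proof cases
          case 1
          then show ?thesis using edge[OF cy ys(2) ij] by blast
        next
          case 2
          then show ?thesis by (simp add: J_def)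
        next
          case 3
          then show ?thesis using sym by (simp add: J_def)
        qed
      qed
    qed
    then have "digraph_iso (with_proj G) (with_proj (H_graph n js))" by (simp add: H_graph_def)
    moreover have "set js \<subseteq> {1..(n - 3) div 2}" by (auto simp: js J_def)
    ultimately show ?thesis using js cJ cJ2 by blast
  qed
qed

lemma even_equality_iso:
  fixes x :: "'a \<Rightarrow> real"
  assumes th: "theta a b A B L" and u: "u \<in> set (a # b # B @ L)" "\<And>v. v \<in> pverts G \<Longrightarrow> \<bar>x v\<bar> \<le> \<bar>x u\<bar>"
    and \<theta>: "0 < \<theta>" "(real n - 1) * \<theta> < pi" "kappa n \<theta> \<ge> 0"
    and eq: "(\<Sum>(u, v)\<in>parcs G. (x u + x v)\<^sup>2) = 2 * (2 - 2 * cos \<theta>) * (\<Sum>v\<in>pverts G. (x v)\<^sup>2)"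
    and x0: "(\<Sum>v\<in>pverts G. (x v)\<^sup>2) \<noteq> 0"
  shows "digraph_iso (with_proj G) (with_proj (Theta_graph n))"
proof -
  from theta_graph_bound(2)[OF th u \<theta> eq x0] obtain w v p where
    V: "set (a # b # A @ B @ L) = pverts G" and len: "length L + 4 = n" and AB: "A = [w]" "B = [v]" and p: "p \<noteq> 0"
    and xa: "x w = - p / cos \<theta>" "x v = - p / cos \<theta>"
    and xL: "\<And>i. i \<le> n - 3 \<Longrightarrow> (- 1) ^ i * x ((a # L @ [b]) ! i) = p * sin (((real n - 3) / 2 - real i) * \<theta>) / sin ((real n - 3) / 2 * \<theta>)"
    and arcs: "\<And>u v. (u, v) \<in> parcs G \<Longrightarrow> (u, v) \<in> path_arcs (a # A @ [b]) \<union> path_arcs (a # B @ [b]) \<union> path_arcs (a # L @ [b]) \<or>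
        (v, u) \<in> path_arcs (a # A @ [b]) \<union> path_arcs (a # B @ [b]) \<union> path_arcs (a # L @ [b]) \<or> x u + x v = 0"
    by blast
  define c where "c = a # L @ [b]"
  define vs where "vs = w # v # c"
  have "even (length L)" using th AB by (simp add: theta_def)
  define l where "l = n - 3"
  have l: "odd l" "length c = Suc l" "n = l + 3" using \<open>even (length L)\<close> len by (auto simp: l_def c_def)
  have vs: "length vs = n" "distinct vs" "set vs = pverts G"
    using th V l by (auto simp: vs_def c_def theta_def AB)
  have rl: "real n - 3 = real l" using l by simp
  define h where "h = sin (real l / 2 * \<theta>)"
  define \<alpha> where "\<alpha> i = (real l / 2 - real i) * \<theta>" for i
  have c_val: "(- 1) ^ i * x (c ! i) = p * sin (\<alpha> i) / h" if "i \<le> l" for i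
    using xL[of i] that unfolding c_def[symmetric] l_def[symmetric] rl h_def \<alpha>_def by simp
  have l\<theta>: "0 < real l * \<theta>" "real l * \<theta> + 2 * \<theta> < pi"
    using \<theta>(1,2) l odd_pos[OF l(1)] by (simp_all add: algebra_simps)
  have h: "h > 0" unfolding h_def using l\<theta> \<theta>(1) by (intro sin_gt_zero) auto
  have cos: "0 < cos \<theta>" "cos \<theta> < 1"
  proof -
    have "\<theta> < pi / 2" using l\<theta> by simp
    then show "0 < cos \<theta>" using \<theta>(1) by (intro cos_gt_zero_pi) auto
    show "cos \<theta> < 1" using cos_monotone_0_pi[of 0 \<theta>] \<theta>(1) l\<theta> by simp
  qed
  have \<alpha>_le: "\<bar>\<alpha> i\<bar> \<le> real l / 2 * \<theta>" if "i \<le> l" for i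
  proof -
    have "real i \<le> real l" using that by simp
    then have "\<bar>real l / 2 - real i\<bar> \<le> real l / 2" by linarith
    then show ?thesis unfolding \<alpha>_def abs_mult using \<theta>(1) by (simp add: mult_right_mono)
  qed
  have c_le: "\<bar>x (c ! i)\<bar> \<le> \<bar>p\<bar>" if "i \<le> l" for i
  proof -
    have "\<bar>sin (\<alpha> i)\<bar> \<le> h"
    proof -
      have "- (pi / 2) \<le> \<alpha> i" "\<alpha> i \<le> real l / 2 * \<theta>" "- (pi / 2) \<le> - \<alpha> i" "- \<alpha> i \<le> real l / 2 * \<theta>" "real l / 2 * \<theta> \<le> pi / 2"
        using \<alpha>_le[OF that] l\<theta> \<theta>(1) by linarith+
      then have "sin (\<alpha> i) \<le> h" "sin (- \<alpha> i) \<le> h"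
        unfolding h_def by (blast intro: sin_monotone_2pi_le)+
      then show ?thesis by (simp add: abs_le_iff)
    qed
    moreover have "\<bar>x (c ! i)\<bar> = \<bar>p\<bar> * \<bar>sin (\<alpha> i)\<bar> / h"
      using arg_cong[OF c_val[OF that], of abs] h by (simp add: abs_mult power_abs)
    ultimately show ?thesis using h by (simp add: divide_le_eq mult_left_mono)
  qed
  have top: "\<bar>p\<bar> < \<bar>- p / cos \<theta>\<bar>" using p cos by (simp add: field_simps)
  have top_c: "- p / cos \<theta> + x (c ! i) \<noteq> 0" if "i \<le> l" for i using c_le[OF that] top by auto
  have c_c: "x (c ! i) + x (c ! j) \<noteq> 0" if ij: "i < j" "j \<le> l" for i j
  proof
    assume z: "x (c ! i) + x (c ! j) = 0"
    have sq: "(x (c ! k))\<^sup>2 = (p / h)\<^sup>2 * (sin (\<alpha> k))\<^sup>2" if "k \<le> l" for k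
    proof -
      have "((- 1) ^ k * x (c ! k))\<^sup>2 = (x (c ! k))\<^sup>2" by (simp add: power_mult_distrib flip: power_mult)
      then show ?thesis unfolding c_val[OF that] by (simp add: power_mult_distrib power_divide)
    qed
    have "x (c ! i) = - x (c ! j)" using z by simp
    then have "(x (c ! i))\<^sup>2 = (x (c ! j))\<^sup>2" by simp
    then have "(sin (\<alpha> i))\<^sup>2 = (sin (\<alpha> j))\<^sup>2" using sq ij p h by simp
    moreover have "sin (\<alpha> i + \<alpha> j) * sin (\<alpha> i - \<alpha> j) = (sin (\<alpha> i))\<^sup>2 - (sin (\<alpha> j))\<^sup>2"
    proof -
      have "sin (\<alpha> i + \<alpha> j) * sin (\<alpha> i - \<alpha> j) = (sin (\<alpha> i))\<^sup>2 * (cos (\<alpha> j))\<^sup>2 - (cos (\<alpha> i))\<^sup>2 * (sin (\<alpha> j))\<^sup>2"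
        by (simp add: sin_add sin_diff power2_eq_square algebra_simps)
      then show ?thesis by (simp add: cos_squared_eq algebra_simps)
    qed
    ultimately have "sin (\<alpha> i + \<alpha> j) * sin (\<alpha> i - \<alpha> j) = 0" by simp
    moreover have "sin (\<alpha> i - \<alpha> j) > 0"
    proof (rule sin_gt_zero)
      have e: "\<alpha> i - \<alpha> j = (real j - real i) * \<theta>" by (simp add: \<alpha>_def algebra_simps)
      show "0 < \<alpha> i - \<alpha> j" unfolding e using ij \<theta>(1) by simp
      have "(real j - real i) * \<theta> \<le> real l * \<theta>" using ij \<theta>(1) by (intro mult_right_mono) auto
      then show "\<alpha> i - \<alpha> j < pi" unfolding e using l\<theta> \<theta>(1) by linarith
    qed
    ultimately have s0: "sin (\<alpha> i + \<alpha> j) = 0" by simp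
    have "\<bar>\<alpha> i + \<alpha> j\<bar> < pi" using \<alpha>_le[of i] \<alpha>_le[of j] ij l\<theta> \<theta>(1) by linarith
    then have a0: "\<alpha> i + \<alpha> j = 0" using s0 sin_eq_0_pi by (metis abs_less_iff minus_less_iff)
    have "(real l - (real i + real j)) * \<theta> = 0" using a0 by (simp add: \<alpha>_def algebra_simps)
    then have sum: "i + j = l" using \<theta>(1) by (simp flip: of_nat_add)
    have "\<alpha> j = - \<alpha> i" using a0 by simp
    then have "(- 1) ^ j * x (c ! j) = - ((- 1) ^ i * x (c ! i))"
      using c_val[of i] c_val[of j] ij by simp
    moreover have "(- 1) ^ j = - ((- 1) ^ i :: real)" using l(1) sum by (cases "even i"; auto)
    ultimately have "x (c ! j) = x (c ! i)" by simp
    then have "x (c ! i) = 0" using z by simp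
    then have "sin (\<alpha> i) = 0" using c_val[of i] ij p h by simp
    moreover have "\<bar>\<alpha> i\<bar> < pi" using \<alpha>_le[of i] ij l\<theta> \<theta>(1) by linarith
    ultimately have "\<alpha> i = 0" using sin_eq_0_pi by (metis abs_less_iff minus_less_iff)
    then have "real l = 2 * real i" using \<theta>(1) by (simp add: \<alpha>_def)
    then have "l = 2 * i" by linarith
    then show False using l(1) by simp
  qed
  have vs_nth: "vs ! 0 = w" "vs ! 1 = v" "\<And>i. 2 \<le> i \<Longrightarrow> vs ! i = c ! (i - 2)"
    by (simp_all add: vs_def nth_Cons' numeral_2_eq_2)
  have nz: "x (vs ! i) + x (vs ! j) \<noteq> 0" if ij: "i < j" "j < n" for i j
  proof -
    consider "i = 0" "j = 1" | "i < 2" "2 \<le> j" | "2 \<le> i" using ij by linarith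
    then show ?thesis
    proof cases
      case 1
      then show ?thesis using vs_nth xa p cos by simp
    next
      case 2
      then have "x (vs ! i) = - p / cos \<theta>" using vs_nth(1,2) xa by (auto simp: less_2_cases_iff)
      then show ?thesis using top_c[of "j - 2"] vs_nth(3)[of j] 2 ij l by auto
    next
      case 3
      then show ?thesis using c_c[of "i - 2" "j - 2"] vs_nth(3) ij l by auto
    qed
  qed
  let ?F = "path_arcs (a # A @ [b]) \<union> path_arcs (a # B @ [b]) \<union> path_arcs (a # L @ [b])"
  let ?I = "{(2, 0), (0, n - 1), (2, 1), (1, n - 1)} \<union> {(k, Suc k) | k. 2 \<le> k \<and> Suc k < n}"
  have ends: "vs ! 2 = a" "vs ! (n - 1) = b" using l len by (auto simp: vs_def c_def nth_append)
  have F_img: "?F = (\<lambda>(i, j). (vs ! i, vs ! j)) ` ?I"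
  proof -
    have "path_arcs (a # L @ [b]) = (\<lambda>(i, j). (vs ! i, vs ! j)) ` {(k, Suc k) | k. 2 \<le> k \<and> Suc k < n}"
    proof (intro equalityI subsetI)
      fix e assume "e \<in> path_arcs (a # L @ [b])"
      then obtain i where i: "Suc i < length c" "e = (c ! i, c ! Suc i)" by (auto simp: path_arcs_nth c_def)
      then have "e = (vs ! (i + 2), vs ! Suc (i + 2))" by (simp add: vs_def)
      moreover have "Suc (i + 2) < n" using i l by simp
      ultimately show "e \<in> (\<lambda>(i, j). (vs ! i, vs ! j)) ` {(k, Suc k) | k. 2 \<le> k \<and> Suc k < n}" by force
    next
      fix e assume "e \<in> (\<lambda>(i, j). (vs ! i, vs ! j)) ` {(k, Suc k) | k. 2 \<le> k \<and> Suc k < n}"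
      then obtain k where k: "2 \<le> k" "Suc k < n" "e = (vs ! k, vs ! Suc k)" by auto
      define t where "t = k - 2"
      have t: "k = Suc (Suc t)" using k(1) by (simp add: t_def)
      have "e = (c ! t, c ! Suc t)" "Suc t < length c"
        using k l t by (simp_all add: vs_def)
      then show "e \<in> path_arcs (a # L @ [b])" unfolding path_arcs_nth c_def by blast
    qed
    moreover have "path_arcs (a # A @ [b]) \<union> path_arcs (a # B @ [b]) = {(a, w), (w, b), (a, v), (v, b)}"
      by (auto simp: AB)
    moreover have "(\<lambda>(i, j). (vs ! i, vs ! j)) ` {(2, 0), (0, n - 1), (2, 1), (1, n - 1)} = {(a, w), (w, b), (a, v), (v, b)}"
      using ends vs_nth(1,2) by simp
    ultimately show ?thesis unfolding image_Un by simp
  qed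
  have inj: "vs ! i = vs ! j \<longleftrightarrow> i = j" if "i < n" "j < n" for i j
    using vs that by (simp add: nth_eq_iff_index_eq)
  define I where "I = ?I"
  have I_sub: "i < n \<and> j < n" if "(i, j) \<in> I" for i j using that l by (auto simp: I_def)
  have F_iff: "(vs ! i, vs ! j) \<in> ?F \<longleftrightarrow> (i, j) \<in> I" if "i < n" "j < n" for i j
  proof
    assume "(vs ! i, vs ! j) \<in> ?F"
    then have "(vs ! i, vs ! j) \<in> (\<lambda>(i, j). (vs ! i, vs ! j)) ` I" unfolding F_img I_def .
    then obtain i' j' where e: "(i', j') \<in> I" "vs ! i = vs ! i'" "vs ! j = vs ! j'" by auto
    then show "(i, j) \<in> I" using I_sub[OF e(1)] inj that by metis
  next
    assume "(i, j) \<in> I"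
    then show "(vs ! i, vs ! j) \<in> ?F" unfolding F_img I_def[symmetric] by (rule rev_image_eqI) simp
  qed
  have edges: "I \<union> I\<inverse> = theta_edges n \<union> (theta_edges n)\<inverse>"
  proof -
    define X where "X = {(k, Suc k) | k. 2 \<le> k \<and> Suc k < n}"
    have "(i, j) \<in> {(i, i + 1) | i. 1 \<le> i \<and> i < n - 1} \<longleftrightarrow> (i, j) \<in> insert (1, 2) X" for i j
      using l by (cases "i = 1") (auto simp: X_def)
    then have Y: "{(i, i + 1) | i. 1 \<le> i \<and> i < n - 1} = insert (1, 2) X"
      unfolding set_eq_iff split_paired_All by blast
    show ?thesis unfolding I_def Y X_def[symmetric] by blast
  qed
  have "digraph_iso (with_proj G) (with_proj (graph_of_edges n (theta_edges n)))"
  proof (rule digraph_iso_graph_of_edges[OF G vs])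
    show "theta_edges n \<subseteq> {..<n} \<times> {..<n}" using l by auto
    show "(vs ! i, vs ! j) \<in> parcs G \<longleftrightarrow> (i, j) \<in> theta_edges n \<union> (theta_edges n)\<inverse>" if ij: "i < n" "j < n" for i j
    proof -
      have "(vs ! i, vs ! j) \<in> parcs G \<longleftrightarrow> (vs ! i, vs ! j) \<in> ?F \<or> (vs ! j, vs ! i) \<in> ?F"
      proof
        assume arc: "(vs ! i, vs ! j) \<in> parcs G"
        then have "i \<noteq> j" using irrefl by metis
        then have "x (vs ! i) + x (vs ! j) \<noteq> 0" using nz[of i j] nz[of j i] ij by (metis add.commute linorder_neqE_nat)
        then show "(vs ! i, vs ! j) \<in> ?F \<or> (vs ! j, vs ! i) \<in> ?F" using arcs[OF arc] by blast
      next
        assume "(vs ! i, vs ! j) \<in> ?F \<or> (vs ! j, vs ! i) \<in> ?F"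
        then show "(vs ! i, vs ! j) \<in> parcs G" using theta_arcs(1)[OF th] sym by blast
      qed
      also have "\<dots> \<longleftrightarrow> (i, j) \<in> I \<union> I\<inverse>" using F_iff ij by blast
      finally show ?thesis unfolding edges .
    qed
  qed
  then show ?thesis by (simp add: Theta_graph_def)
qed

end

theorem theorem1p1:
  fixes G :: "'a pair_pre_digraph" and n :: nat
  assumes "pair_graph G"
    and "Digraph_Component.connected G"
    and "\<not> bipartite G"
    and "two_connected G"
    and "card (pverts G) = n"
    and "n \<ge> 3"
  shows "(odd n \<longrightarrow>
            least_q (cycle_graph n) \<le> least_q G \<and>
            (least_q (cycle_graph n) = least_q G \<longrightarrow>
               digraph_iso G (cycle_graph n) \<or>
               (\<exists>k js. 1 \<le> k \<and> k \<le> (n - 3) div 2 \<and> length js = k \<and> sorted js \<and>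
                  set js \<subseteq> {1..(n - 3) div 2} \<and> digraph_iso G (H_graph n js)))) \<and>
         (even n \<longrightarrow>
            least_q (Theta_graph n) \<le> least_q G \<and>
            (least_q (Theta_graph n) = least_q G \<longleftrightarrow> digraph_iso G (Theta_graph n)))"
proof -
  interpret nonbipartite_2_connected_pair_graph G n
    using assms(1,5) nonbipartite_2_connected_graph[OF assms(1,3,4)]
    by (rule nonbipartite_2_connected_pair_graph.intro)
  have ne: "pverts G \<noteq> {}" using assms by auto
  define q where "q = least_q (with_proj G)"
  obtain x where x: "Q_eigenfunction G q x" using least_q_eigenfunction[OF G ne] by (auto simp: q_def)
  define N where "N = (\<Sum>v\<in>pverts G. (x v)\<^sup>2)"
  have E: "(\<Sum>(u, v)\<in>parcs G. (x u + x v)\<^sup>2) = 2 * q * N"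
    using Q_eigenfunction_energy[OF G x] by (simp add: N_def)
  have N: "N > 0" unfolding N_def
    using x finite_V by (auto simp: Q_eigenfunction_def intro!: sum_pos2)
  obtain u where u: "u \<in> pverts G" "\<And>v. v \<in> pverts G \<Longrightarrow> \<bar>x v\<bar> \<le> \<bar>x u\<bar>"
  proof -
    obtain u where "u \<in> pverts G" "\<bar>x u\<bar> = Max ((\<lambda>v. \<bar>x v\<bar>) ` pverts G)"
      using obtains_MAX[OF finite_V ne, of "\<lambda>v. \<bar>x v\<bar>"] by metis
    then show ?thesis using that[of u] finite_V by simp
  qed
  have cmp: "l \<le> q" if "2 * l * N \<le> 2 * q * N" for l using that N by simp
  have theta_case: "4 \<le> n" if "theta a b A B L" for a b A B L
  proof -
    have d: "distinct (a # b # A @ B @ L)" "A \<noteq> []" "B \<noteq> []" using that by (auto simp: theta_def)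
    have "set (a # b # A @ B @ L) \<subseteq> pverts G"
      using walk_subset_V[of "a # A @ [b]"] walk_subset_V[of "a # B @ [b]"] walk_subset_V[of "a # L @ [b]"] that
      by (auto simp: theta_def)
    then have "length (a # b # A @ B @ L) \<le> n"
      using d(1) card_mono[OF finite_V] card_n distinct_card by metis
    moreover have "length A \<ge> 1" "length B \<ge> 1" using d(2,3) by (auto simp: Suc_le_eq)
    ultimately show ?thesis by simp
  qed
  consider (ham) xs where "cycle_list xs" "odd (length xs)" "set xs = pverts G"
    | (theta) a b A B L where "theta a b A B L" "u \<in> set (a # b # B @ L)"
    using hamiltonian_or_theta[OF u(1)] by blast
  note cases = this
  show ?thesis
  proof (intro conjI impI)
    assume odd: "odd n"
    have up: "least_q (with_proj (cycle_graph n)) \<le> 2 - 2 * cos (pi / n)" by (rule least_q_cycle_le[OF odd assms(6)])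
    have "2 - 2 * cos (pi / n) \<le> q \<and> (2 - 2 * cos (pi / n) = q \<longrightarrow>
      digraph_iso G (cycle_graph n) \<or>
               (\<exists>k js. 1 \<le> k \<and> k \<le> (n - 3) div 2 \<and> length js = k \<and> sorted js \<and>
                  set js \<subseteq> {1..(n - 3) div 2} \<and> digraph_iso G (H_graph n js)))"
      using cases
    proof cases
      case ham
      note hb = hamiltonian_bound[OF ham(1,3) odd, of x, folded N_def, unfolded E]
      have "2 - 2 * cos (pi / n) \<le> q" by (rule cmp) (rule hb(1))
      moreover have "digraph_iso G (cycle_graph n) \<or>
               (\<exists>k js. 1 \<le> k \<and> k \<le> (n - 3) div 2 \<and> length js = k \<and> sorted js \<and>
                  set js \<subseteq> {1..(n - 3) div 2} \<and> digraph_iso G (H_graph n js))" if "2 - 2 * cos (pi / n) = q"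
        by (rule odd_equality_iso[OF ham(1,3) odd, of x]) (use E that N in \<open>simp_all flip: N_def\<close>)
      ultimately show ?thesis by blast
    next
      case theta
      have n4: "n \<ge> 4" using theta_case[OF theta(1)] .
      have t: "0 < pi / n" "(real n - 1) * (pi / n) < pi" "kappa n (pi / n) \<ge> 0" "kappa n (pi / n) \<noteq> 0"
        using n4 kappa_pos[OF n4] by (auto simp: field_simps)
      note tb = theta_graph_bound[where x = x and u = u, OF theta u(2) t(1-3), folded N_def, unfolded E]
      have "2 - 2 * cos (pi / n) \<le> q" by (rule cmp) (rule tb(1))
      moreover have "2 - 2 * cos (pi / n) \<noteq> q" using tb(2) t(4) N by auto
      ultimately show ?thesis by blast
    qed
    then show "least_q (cycle_graph n) \<le> least_q G"
      and "least_q (cycle_graph n) = least_q G \<Longrightarrow> digraph_iso G (cycle_graph n) \<or>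
               (\<exists>k js. 1 \<le> k \<and> k \<le> (n - 3) div 2 \<and> length js = k \<and> sorted js \<and>
                  set js \<subseteq> {1..(n - 3) div 2} \<and> digraph_iso G (H_graph n js))"
      using up unfolding q_def by force+
  next
    assume even: "even n"
    then have n4: "n \<ge> 4" using assms(6) by (cases "n = 3") auto
    obtain \<theta> where \<theta>: "0 < \<theta>" "(real n - 1) * \<theta> < pi" "kappa n \<theta> = 0" using kappa_root[OF n4] by blast
    have up: "least_q (with_proj (Theta_graph n)) \<le> 2 - 2 * cos \<theta>" by (rule least_q_Theta_le[OF even n4 \<theta>])
    have "2 - 2 * cos \<theta> \<le> q \<and> (2 - 2 * cos \<theta> = q \<longrightarrow> digraph_iso G (Theta_graph n))"
      using cases
    proof cases
      case ham
      then show ?thesis using even card_n distinct_card[of xs] by (auto simp: cycle_list_def)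
    next
      case theta
      have k: "kappa n \<theta> \<ge> 0" using \<theta>(3) by simp
      have "2 - 2 * cos \<theta> \<le> q"
        by (rule cmp) (use theta_graph_bound(1)[where x = x and u = u, OF theta u(2) \<theta>(1,2) k] E in \<open>simp flip: N_def\<close>)
      moreover have "digraph_iso G (Theta_graph n)" if "2 - 2 * cos \<theta> = q"
        by (rule even_equality_iso[where x = x and u = u, OF theta u(2) \<theta>(1,2) k]) (use E that N in \<open>simp_all flip: N_def\<close>)
      ultimately show ?thesis by blast
    qed
    then have low: "2 - 2 * cos \<theta> \<le> q" and iso: "2 - 2 * cos \<theta> = q \<Longrightarrow> digraph_iso G (Theta_graph n)" by blast+
    show le: "least_q (Theta_graph n) \<le> least_q G" using up low by (simp add: q_def)
    show "least_q (Theta_graph n) = least_q G \<longleftrightarrow> digraph_iso G (Theta_graph n)"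
    proof
      assume "least_q (Theta_graph n) = least_q G"
      then show "digraph_iso G (Theta_graph n)" using iso up low by (simp add: q_def)
    next
      assume "digraph_iso G (Theta_graph n)"
      from least_q_iso_le[OF G ne pair_graph_Theta[OF n4] this] le
      show "least_q (Theta_graph n) = least_q G" by simp
    qed
  qed
qed

end
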